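(* Let $X$ be a random vector in $\mathbb{R}^d$. Let $b\in\mathbb{R}^d$, $\alpha\in(0,1)$ and let $\nu$ be a Lévy measure on $\mathbb{R}^d$ such that, for all $c>0$, $\nu(du)=c^{-\alpha}T_c(\nu)(du)$. Set $b_0=b-\int_{\|u\|\le1}u\,\nu(du)$. Then $$\mathbb{E}\langle X;\nabla f(X)\rangle=\mathbb{E}\langle b_0;\nabla f(X)\rangle+\alpha\,\mathbb{E}\int_{\mathbb{R}^d}\big(f(X+u)-f(X)\big)\nu(du)$$ holds for all $f\in\mathcal{S}(\mathbb{R}^d)$ if and only if $X$ is a stable random vector with parameter $b$, stability index $\alpha$ and Lévy measure $\nu$.
   Context: $\|\cdot\|$, $\langle\cdot;\cdot\rangle$ are the Euclidean norm and inner product on $\mathbb{R}^d$; $\mathcal{S}(\mathbb{R}^d)$ is the Schwartz space of real-valued rapidly decreasing smooth functions. A Lévy measure is a positive Borel measure $\nu$ on $\mathbb{R}^d$ with $\nu(\{0\})=0$ and $\int(1\wedge\|u\|^2)\nu(du)<+\infty$. For $c>0$, $T_c(\nu)(B)=\nu(B/c)$ for all Borel sets $B\subset\mathbb{R}^d$. "$X$ is stable with parameter $b$, stability index $\alpha$ and Lévy measure $\nu$" means that $X$ is infinitely divisible with no Gaussian part and characteristic function $\varphi(\xi)=\exp\big(i\langle b;\xi\rangle+\int_{\mathbb{R}^d}(e^{i\langle\xi;u\rangle}-1-i\langle\xi;u\rangle\mathbf 1_{\|u\|\le1})\nu(du)\big)$, where $\nu(du)=\mathbf 1_{(0,+\infty)}(r)\mathbf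 1_{\mathbb{S}^{d-1}}(x)\frac{dr}{r^{\alpha+1}}\sigma(dx)$ in polar coordinates $u=rx$, with $\sigma$ a finite positive measure on the Euclidean unit sphere $\mathbb{S}^{d-1}$ (for $\alpha\in(0,1)$ one has $\int_{\|u\|\le1}\|u\|\nu(du)<+\infty$). *)

theory Defs
  imports "HOL-Probability.Probability"
begin

section \<open>Schwartz functions on a Euclidean space\<close>

definition partial_deriv :: "'a::euclidean_space \<Rightarrow> ('a \<Rightarrow> real) \<Rightarrow> 'a \<Rightarrow> real" where
  "partial_deriv i f = (\<lambda>x. frechet_derivative f (at x) i)"

text \<open>\<open>iter_partial [i\<^sub>1, \<dots>, i\<^sub>k] f\<close> is \<open>\<partial>\<^bsub>i\<^sub>1\<^esub> \<dots> \<partial>\<^bsub>i\<^sub>k\<^esub> f\<close>; lists of basis vectors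
  play the role of multi-indices.\<close>

definition iter_partial :: "'a::euclidean_space list \<Rightarrow> ('a \<Rightarrow> real) \<Rightarrow> 'a \<Rightarrow> real" where
  "iter_partial is f = foldr partial_deriv is f"

text \<open>Total differentiability of every iterated partial derivative implies that all of them
  are continuous, so this is \<open>C\<^sup>\<infinity>\<close>. In \<open>partial_deriv\<close> the Frechet derivative is
  unspecified where \<open>f\<close> is not differentiable; this never matters for smooth \<open>f\<close>.\<close>

definition smooth :: "('a::euclidean_space \<Rightarrow> real) \<Rightarrow> bool" where
  "smooth f \<longleftrightarrow> (\<forall>is. set is \<subseteq> Basis \<longrightarrow> iter_partial is f differentiable_on UNIV)"

definition schwartz :: "('a::euclidean_space \<Rightarrow> real) set" where
  "schwartz = {f. smooth f \<and>
     (\<forall>is k. set is \<subseteq> Basis \<longrightarrow> bounded (range (\<lambda>x. (1 + norm x) ^ k * iter_partial is f x)))}"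

definition gradient :: "('a::euclidean_space \<Rightarrow> real) \<Rightarrow> 'a \<Rightarrow> 'a" where
  "gradient f x = (\<Sum>i\<in>Basis. partial_deriv i f x *\<^sub>R i)"

lemma partial_deriv_has_field_derivative:
  fixes f :: "'a::euclidean_space \<Rightarrow> real"
  assumes "f differentiable (at x)"
  shows "((\<lambda>t. f (x + t *\<^sub>R i)) has_field_derivative partial_deriv i f x) (at 0)"
proof -
  have f: "(f has_derivative frechet_derivative f (at x)) (at (x + 0 *\<^sub>R i))"
    using assms by (simp add: frechet_derivative_works)
  have g: "((\<lambda>t::real. x + t *\<^sub>R i) has_derivative (\<lambda>t. t *\<^sub>R i)) (at 0)"
    by (auto intro!: derivative_eq_intros)
  have lin: "linear (frechet_derivative f (at x))"
    using assms by (rule linear_frechet_derivative)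
  have "((\<lambda>t. f (x + t *\<^sub>R i)) has_derivative (\<lambda>t. frechet_derivative f (at x) (t *\<^sub>R i))) (at 0)"
    using has_derivative_compose[OF g] f by simp
  moreover have "(\<lambda>t. frechet_derivative f (at x) (t *\<^sub>R i)) = (*) (partial_deriv i f x)"
    by (rule ext) (simp add: partial_deriv_def linear_cmul[OF lin])
  ultimately show ?thesis
    by (simp only: has_field_derivative_def)
qed

lemma GDERIV_gradient:
  fixes f :: "'a::euclidean_space \<Rightarrow> real"
  assumes "f differentiable (at x)"
  shows "GDERIV f x :> gradient f x"
proof -
  have lin: "linear (frechet_derivative f (at x))"
    using assms by (rule linear_frechet_derivative)
  have "frechet_derivative f (at x) h = h \<bullet> gradient f x" for h
  proof -
    have "frechet_derivative f (at x) h = frechet_derivative f (at x) (\<Sum>i\<in>Basis. (h \<bullet> i) *\<^sub>R i)"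
      by (simp only: euclidean_representation)
    also have "\<dots> = (\<Sum>i\<in>Basis. (h \<bullet> i) * frechet_derivative f (at x) i)"
      by (simp only: linear_sum[OF lin] linear_cmul[OF lin] real_scaleR_def)
    finally show ?thesis
      by (simp add: gradient_def partial_deriv_def inner_sum_right ac_simps)
  qed
  then have "frechet_derivative f (at x) = (\<lambda>h. h \<bullet> gradient f x)"
    by (rule ext)
  moreover have "(f has_derivative frechet_derivative f (at x)) (at x)"
    using assms by (simp add: frechet_derivative_works)
  ultimately show ?thesis
    by (simp only: gderiv_def)
qed

section \<open>Levy measures\<close>

definition levy_measure :: "'a::euclidean_space measure \<Rightarrow> bool" where
  "levy_measure \<nu> \<longleftrightarrow> sets \<nu> = sets borel \<and> emeasure \<nu> {0} = 0 \<and>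
     (\<integral>\<^sup>+u. ennreal (min 1 ((norm u)\<^sup>2)) \<partial>\<nu>) < \<infinity>"

definition dilation :: "real \<Rightarrow> 'a::euclidean_space measure \<Rightarrow> 'a measure" where
  "dilation c \<nu> = distr \<nu> borel (\<lambda>u. c *\<^sub>R u)"

lemma emeasure_dilation:
  fixes \<nu> :: "'a::euclidean_space measure"
  assumes "c > 0" "sets \<nu> = sets borel" "B \<in> sets borel"
  shows "emeasure (dilation c \<nu>) B = emeasure \<nu> ((\<lambda>x. x /\<^sub>R c) ` B)"
proof -
  have m: "(\<lambda>u. c *\<^sub>R u) \<in> measurable \<nu> borel"
    by (simp add: measurable_cong_sets[OF assms(2) refl])
  have "(\<lambda>u. c *\<^sub>R u) -` B = (\<lambda>x. x /\<^sub>R c) ` B"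
  proof (intro equalityI subsetI)
    fix u assume "u \<in> (\<lambda>u. c *\<^sub>R u) -` B"
    then show "u \<in> (\<lambda>x. x /\<^sub>R c) ` B"
      using assms(1) by (intro image_eqI[where x = "c *\<^sub>R u"]) auto
  next
    fix u assume "u \<in> (\<lambda>x. x /\<^sub>R c) ` B"
    then show "u \<in> (\<lambda>u. c *\<^sub>R u) -` B"
      using assms(1) by auto
  qed
  moreover have "space \<nu> = UNIV"
    using sets_eq_imp_space_eq[OF assms(2)] by simp
  ultimately show ?thesis
    using assms(3) by (simp add: dilation_def emeasure_distr[OF m])
qed

section \<open>Stable random vectors\<close>

definition char_fun :: "'b measure \<Rightarrow> ('b \<Rightarrow> 'a::euclidean_space) \<Rightarrow> 'a \<Rightarrow> complex" where
  "char_fun M X \<xi> = (CLINT \<omega>|M. iexp (\<xi> \<bullet> X \<omega>))"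

text \<open>For every \<open>n \<ge> 1\<close>, the law of \<open>X\<close> is the law of a sum of \<open>n\<close> independent random
  vectors with a common law \<open>\<rho>\<close>, realised as the coordinates of a product space.\<close>

definition infinitely_divisible :: "'b measure \<Rightarrow> ('b \<Rightarrow> 'a::euclidean_space) \<Rightarrow> bool" where
  "infinitely_divisible M X \<longleftrightarrow>
     (\<forall>n::nat. n \<ge> 1 \<longrightarrow> (\<exists>\<rho> :: 'a measure. prob_space \<rho> \<and> sets \<rho> = sets borel \<and>
        distr M borel X = distr (\<Pi>\<^sub>M i\<in>{..<n}. \<rho>) borel (\<lambda>Y. \<Sum>i<n. Y i)))"

text \<open>The Levy--Khintchine exponent of the triplet \<open>(b, 0, \<nu>)\<close>, i.e. without Gaussian part.\<close>

definition levy_exponent :: "'a::euclidean_space \<Rightarrow> 'a measure \<Rightarrow> 'a \<Rightarrow> complex" where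
  "levy_exponent b \<nu> \<xi> = \<i> * complex_of_real (b \<bullet> \<xi>) +
     (CLINT u|\<nu>. iexp (\<xi> \<bullet> u) - 1 - \<i> * complex_of_real ((\<xi> \<bullet> u) * indicator {u. norm u \<le> 1} u))"

text \<open>The image under \<open>(r, x) \<mapsto> r x\<close> of the product of \<open>dr / r powr (\<alpha> + 1)\<close> on \<open>(0, \<infinity>)\<close> with a
  measure \<open>\<sigma>\<close> on the unit sphere.\<close>

definition polar_stable_measure ::
    "real \<Rightarrow> 'a::euclidean_space measure \<Rightarrow> 'a measure" where
  "polar_stable_measure \<alpha> \<sigma> =
     distr (density lborel (\<lambda>r. ennreal (indicator {0<..} r / r powr (\<alpha> + 1))) \<Otimes>\<^sub>M \<sigma>) borel
       (\<lambda>(r, x). r *\<^sub>R x)"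

definition stable_vector ::
    "'b measure \<Rightarrow> ('b \<Rightarrow> 'a::euclidean_space) \<Rightarrow> 'a \<Rightarrow> real \<Rightarrow> 'a measure \<Rightarrow> bool" where
  "stable_vector M X b \<alpha> \<nu> \<longleftrightarrow>
     infinitely_divisible M X \<and>
     levy_measure \<nu> \<and>
     (\<forall>\<xi>. char_fun M X \<xi> = exp (levy_exponent b \<nu> \<xi>)) \<and>
     0 < \<alpha> \<and> \<alpha> < 2 \<and>
     (\<exists>\<sigma>. sets \<sigma> = sets (restrict_space borel (sphere 0 1)) \<and> finite_measure \<sigma> \<and>
          \<nu> = polar_stable_measure \<alpha> \<sigma>)"

lemma emeasure_polar_stable_measure:
  fixes \<sigma> :: "'a::euclidean_space measure"
  assumes \<sigma>: "sets \<sigma> = sets (restrict_space borel (sphere 0 1))" "finite_measure \<sigma>"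
    and B: "B \<in> sets borel"
  shows "emeasure (polar_stable_measure \<alpha> \<sigma>) B =
    (\<integral>\<^sup>+r. ennreal (indicator {0<..} r / r powr (\<alpha> + 1)) * (\<integral>\<^sup>+x. indicator B (r *\<^sub>R x) \<partial>\<sigma>) \<partial>lborel)"
proof -
  interpret finite_measure \<sigma> by fact
  let ?D = "density lborel (\<lambda>r::real. ennreal (indicator {0<..} r / r powr (\<alpha> + 1)))"
  have id: "(\<lambda>x. x) \<in> measurable \<sigma> borel"
    by (subst measurable_cong_sets[OF \<sigma>(1) refl]) (rule measurable_restrict_space1, simp)
  have m: "(\<lambda>(r, x). r *\<^sub>R x) \<in> measurable (?D \<Otimes>\<^sub>M \<sigma>) borel"
    unfolding case_prod_beta'
    by (intro borel_measurable_scaleR measurable_compose[OF measurable_snd id])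
       (simp add: measurable_fst'')
  have B': "(\<lambda>(r, x). indicator B (r *\<^sub>R x) :: ennreal) \<in> borel_measurable (?D \<Otimes>\<^sub>M \<sigma>)"
    using measurable_compose[OF m borel_measurable_indicator[OF B]] by (simp add: case_prod_beta')
  have "emeasure (polar_stable_measure \<alpha> \<sigma>) B = (\<integral>\<^sup>+u. indicator B u \<partial>polar_stable_measure \<alpha> \<sigma>)"
    using B by (simp add: polar_stable_measure_def)
  also have "\<dots> = (\<integral>\<^sup>+p. (case p of (r, x) \<Rightarrow> indicator B (r *\<^sub>R x)) \<partial>(?D \<Otimes>\<^sub>M \<sigma>))"
    unfolding polar_stable_measure_def
    using B m by (subst nn_integral_distr) (simp_all add: case_prod_beta')
  also have "\<dots> = (\<integral>\<^sup>+r. (\<integral>\<^sup>+x. indicator B (r *\<^sub>R x) \<partial>\<sigma>) \<partial>?D)"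
    using nn_integral_fst[OF B', symmetric] by simp
  also have "\<dots> = (\<integral>\<^sup>+r. ennreal (indicator {0<..} r / r powr (\<alpha> + 1)) * (\<integral>\<^sup>+x. indicator B (r *\<^sub>R x) \<partial>\<sigma>) \<partial>lborel)"
    using borel_measurable_nn_integral_fst[OF B'] by (subst nn_integral_density) (auto cong: measurable_cong_sets)
  finally show ?thesis .
qed

end

theory Submission
  imports Defs
begin

text \<open>Replacing \<open>X\<close> by \<open>Y = X - b\<^sub>0\<close> removes the drift, so the claim is that \<open>Y\<close> satisfies the
  identity with \<open>b\<^sub>0 = 0\<close> iff its characteristic function is \<open>\<phi> = exp \<eta>\<close>, where
  \<open>\<eta>(\<xi>) = \<integral> (e\<^bsup>i\<langle>\<xi>,u\<rangle>\<^esup> - 1) \<nu>(du)\<close>; the scaling of \<open>\<nu>\<close> gives \<open>\<eta>(t\<xi>) = t\<^bsup>\<alpha>\<^esup> \<eta>(\<xi>)\<close>.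

  If \<open>\<phi> = exp \<eta>\<close>, then \<open>\<phi>(c\<xi>) - \<phi>(\<xi>)\<close> is the integral of \<open>\<alpha> t\<^bsup>\<alpha>-1\<^esup> \<eta>(\<xi>) \<phi>(t\<xi>)\<close> over \<open>[1, c]\<close>. This is
  an identity between integrals of increments of exponentials; Gaussian mollification transfers it
  to Schwartz functions, and differentiating at \<open>c = 1\<close> gives the Stein identity.

  Conversely, the Stein identity for \<open>e\<^bsup>i\<langle>\<xi>,x\<rangle>\<^esup>\<close> damped by a Gaussian yields in the limit, along each
  ray, the differential equation \<open>t d/dt \<phi>(t\<xi>) = \<alpha> t\<^bsup>\<alpha>\<^esup> \<eta>(\<xi>) \<phi>(t\<xi>)\<close>, whose solution with value 1 at
  0 is \<open>exp \<eta>\<close>.\<close>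

section \<open>Gaussian mollification and uniqueness of characteristic functions\<close>

text \<open>For \<alpha> < 1 the first moment of X need not exist and exponentials are not Schwartz
  functions. So the expectation of \<open>iexp (t * (\<xi> \<bullet> Y))\<close> cannot be
  differentiated in t under the integral, and exponentials cannot be inserted into the Stein
  identity. In one direction the remedy is to work with finite dilations f(cY) - f(Y), where all
  integrands are bounded, and to differentiate only for Schwartz f, for which
  \<open>y \<bullet> gradient f y\<close> is bounded. In the other direction the damping stays while
  integrating along a ray from \<delta> > 0; it is removed only after the Stein identity has
  replaced the term with \<xi> \<bullet> y by uniformly bounded ones. Estimates take the form K *
  min 1 |x - y|, since \<nu> may have infinite mass near 0 but integrates min 1 |u| when \<alpha> <
  1. Gaussians serve because their Fourier transforms are Gaussian, so no Fourier inversion for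
  Schwartz functions is involved. Stability also asks for infinite divisibility and a spherical
  measure; both are built explicitly from the scaling.\<close>

lemma integrable_pair_mult:
  fixes f :: "'a \<Rightarrow> real" and g :: "'b \<Rightarrow> real"
  assumes "sigma_finite_measure M1" "sigma_finite_measure M2"
    and f: "integrable M1 f" and g: "integrable M2 g"
  shows "integrable (M1 \<Otimes>\<^sub>M M2) (\<lambda>p. f (fst p) * g (snd p))"
proof -
  interpret M1: sigma_finite_measure M1 by fact
  interpret M2: sigma_finite_measure M2 by fact
  interpret pair_sigma_finite M1 M2 ..
  have [measurable]: "f \<in> borel_measurable M1" "g \<in> borel_measurable M2"
    using f g by auto
  show ?thesis
  proof (rule Fubini_integrable)
    show "integrable M1 (\<lambda>x. \<integral>y. norm (f (fst (x, y)) * g (snd (x, y))) \<partial>M2)"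
      using f by (simp add: abs_mult)
  qed (use g in simp_all)
qed

lemma norm_iexp_diff_le: "norm (iexp x - iexp y) \<le> \<bar>x - y\<bar>"
proof -
  have "iexp x - iexp y = iexp y * (iexp (x - y) - 1)"
    by (simp add: algebra_simps flip: exp_add)
  then have "norm (iexp x - iexp y) = norm (iexp (x - y) - 1)"
    by (simp add: norm_mult)
  also have "\<dots> \<le> \<bar>x - y\<bar>"
    using iexp_approx1[of "x - y" 0] by simp
  finally show ?thesis .
qed

text \<open>The exponential is bounded and Lipschitz; the common bound by min 1 |x - y| is the form
  in which increments can be integrated against \<nu>.\<close>

lemma norm_iexp_inner_diff_le:
  fixes \<xi> x y :: "'a::euclidean_space"
  shows "norm (iexp (\<xi> \<bullet> x) - iexp (\<xi> \<bullet> y)) \<le> (2 + norm \<xi>) * min 1 (norm (x - y))"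
proof -
  have "norm (iexp (\<xi> \<bullet> x) - iexp (\<xi> \<bullet> y)) \<le> 2"
    using norm_triangle_ineq4[of "iexp (\<xi> \<bullet> x)" "iexp (\<xi> \<bullet> y)"] by simp
  moreover have "norm (iexp (\<xi> \<bullet> x) - iexp (\<xi> \<bullet> y)) \<le> norm \<xi> * norm (x - y)"
    using norm_iexp_diff_le[of "\<xi> \<bullet> x" "\<xi> \<bullet> y"] Cauchy_Schwarz_ineq2[of \<xi> "x - y"]
    by (simp add: inner_diff_right)
  moreover have "norm \<xi> * norm (x - y) \<le> (2 + norm \<xi>) * norm (x - y)"
    by (intro mult_right_mono) auto
  moreover have "0 \<le> norm \<xi>"
    by simp
  ultimately show ?thesis
    by (cases "1 \<le> norm (x - y)") (auto simp only: min_def if_True if_False mult_1_right)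
qed

text \<open>Lebesgue measure on the space is the image of the product of real Lebesgue measures
  under recombining coordinates (\<open>lborel_eq\<close>), so integrals of products factor.\<close>

lemma
  fixes f :: "'a::euclidean_space \<Rightarrow> real \<Rightarrow> _::{real_normed_field,banach,second_countable_topology}"
  assumes f: "\<And>b. b \<in> Basis \<Longrightarrow> integrable lborel (f b)"
  shows integrable_lborel_prod: "integrable lborel (\<lambda>x::'a. \<Prod>b\<in>Basis. f b (x \<bullet> b))"
    and integral_lborel_prod:
      "(\<integral>x. (\<Prod>b\<in>Basis. f b (x \<bullet> b)) \<partial>(lborel :: 'a measure)) = (\<Prod>b\<in>Basis. integral\<^sup>L lborel (f b))"
proof -
  interpret product_sigma_finite "\<lambda>_::'a. lborel :: real measure" ..
  have [measurable]: "f b \<in> borel_measurable borel" if "b \<in> Basis" for b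
    using borel_measurable_integrable[OF f[OF that]] by simp
  have eq: "(\<Prod>b\<in>Basis. f b ((\<Sum>b'\<in>Basis. y b' *\<^sub>R b') \<bullet> b)) = (\<Prod>b\<in>Basis. f b (y b))" for y
    by (intro prod.cong refl) (simp add: inner_sum_left inner_Basis if_distrib cong: if_cong)
  show "integrable lborel (\<lambda>x::'a. \<Prod>b\<in>Basis. f b (x \<bullet> b))"
    unfolding lborel_eq[where 'a='a]
    by (subst integrable_distr_eq) (auto simp: eq intro!: product_integrable_prod f)
  show "(\<integral>x. (\<Prod>b\<in>Basis. f b (x \<bullet> b)) \<partial>(lborel :: 'a measure)) = (\<Prod>b\<in>Basis. integral\<^sup>L lborel (f b))"
    unfolding lborel_eq[where 'a='a]
    by (subst integral_distr) (auto simp: eq intro!: product_integral_prod f)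
qed

section \<open>The standard Gaussian measure on a Euclidean space\<close>

text \<open>The product form lets integrals factor over coordinates;
  \<open>std_gaussian_density_eq\<close> recovers the radial form used for convolution.\<close>

definition std_gaussian_density :: "'a::euclidean_space \<Rightarrow> real" where
  "std_gaussian_density x = (\<Prod>b\<in>Basis. std_normal_density (x \<bullet> b))"

definition std_gaussian :: "'a::euclidean_space measure" where
  "std_gaussian = density lborel std_gaussian_density"

lemma std_gaussian_density_nonneg [simp]: "0 \<le> std_gaussian_density x"
  by (simp add: std_gaussian_density_def prod_nonneg)

lemma borel_measurable_std_gaussian_density [measurable]:
  "std_gaussian_density \<in> borel_measurable borel"
  unfolding std_gaussian_density_def by measurable

lemma sets_std_gaussian [simp, measurable_cong]: "sets std_gaussian = sets borel"
  by (simp add: std_gaussian_def)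

lemma space_std_gaussian [simp]: "space std_gaussian = UNIV"
  by (simp add: std_gaussian_def)

lemma exp_norm_power2_eq_prod:
  "exp (- (norm (x::'a::euclidean_space))\<^sup>2 / 2) = (\<Prod>b\<in>Basis. exp (- (x \<bullet> b)\<^sup>2 / 2))"
proof -
  have "(norm x)\<^sup>2 = (\<Sum>b\<in>Basis. (x \<bullet> b)\<^sup>2)"
    unfolding power2_norm_eq_inner by (subst euclidean_inner) (simp add: power2_eq_square)
  then show ?thesis
    by (simp add: sum_divide_distrib exp_sum flip: sum_negf)
qed

lemma std_gaussian_density_eq:
  "std_gaussian_density (x::'a::euclidean_space) =
     (1 / sqrt (2 * pi)) ^ DIM('a) * exp (- (norm x)\<^sup>2 / 2)"
  unfolding std_gaussian_density_def std_normal_density_def exp_norm_power2_eq_prod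
  by (simp add: prod.distrib prod_constant prod_dividef power_one_over)

lemma prob_space_std_gaussian: "prob_space (std_gaussian :: 'a::euclidean_space measure)"
proof
  have eq: "ennreal (std_gaussian_density x) = (\<Prod>b\<in>Basis. ennreal (std_normal_density (x \<bullet> b)))"
    for x :: 'a
    by (simp add: std_gaussian_density_def prod_ennreal)
  have 1: "(\<integral>\<^sup>+x. ennreal (std_normal_density x) \<partial>lborel) = 1"
    using prob_space.emeasure_space_1[OF prob_space_normal_density[of 1 0]]
    by (simp add: emeasure_density)
  have "(\<integral>\<^sup>+x. (\<Prod>b\<in>Basis. ennreal (std_normal_density (x \<bullet> b))) \<partial>(lborel :: 'a measure))
      = (\<Prod>b\<in>(Basis::'a set). \<integral>\<^sup>+x. ennreal (std_normal_density x) \<partial>lborel)"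
    by (rule nn_integral_lborel_prod) auto
  then show "emeasure (std_gaussian :: 'a measure) (space std_gaussian) = 1"
    by (simp add: std_gaussian_def emeasure_density eq 1)
qed

text \<open>The one-dimensional formula holds in each coordinate. Read from right to left, it writes
  a Gaussian bump as an average of exponentials, which makes mollified functions accessible to
  characteristic functions.\<close>

lemma integral_iexp_std_gaussian:
  "(CLINT z|std_gaussian. iexp (z \<bullet> (\<xi>::'a::euclidean_space))) = of_real (exp (- (norm \<xi>)\<^sup>2 / 2))"
proof -
  let ?f = "\<lambda>b t. std_normal_density t *\<^sub>R iexp (t * (\<xi> \<bullet> b))"
  have int: "integrable lborel (?f b)" for b
    by (rule Bochner_Integration.integrable_bound[where f = std_normal_density]) auto
  have 1: "(CLINT t|lborel. ?f b t) = of_real (exp (- (\<xi> \<bullet> b)\<^sup>2 / 2))" for b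
    using char_std_normal_distribution[THEN fun_cong, of "\<xi> \<bullet> b"]
    by (simp add: char_def integral_density mult.commute)
  have "iexp (z \<bullet> \<xi>) = (\<Prod>b\<in>Basis. iexp ((z \<bullet> b) * (\<xi> \<bullet> b)))" for z
    by (simp add: euclidean_inner[of z \<xi>] exp_sum sum_distrib_left)
  then have "std_gaussian_density z *\<^sub>R iexp (z \<bullet> \<xi>) = (\<Prod>b\<in>Basis. ?f b (z \<bullet> b))" for z
    by (simp add: std_gaussian_density_def scaleR_conv_of_real prod.distrib)
  then have "(CLINT z|std_gaussian. iexp (z \<bullet> \<xi>)) = (CLINT z|lborel. (\<Prod>b\<in>Basis. ?f b (z \<bullet> b)))"
    by (simp add: std_gaussian_def integral_density)
  also have "\<dots> = (\<Prod>b\<in>Basis. of_real (exp (- (\<xi> \<bullet> b)\<^sup>2 / 2)))"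
    by (simp only: integral_lborel_prod[OF int] 1)
  also have "\<dots> = of_real (exp (- (norm \<xi>)\<^sup>2 / 2))"
    by (simp only: exp_norm_power2_eq_prod of_real_prod)
  finally show ?thesis .
qed

text \<open>The exponential of frequency s z has increment constant 2 + s |z|, so Fubini in
  \<open>integral_mollification_eq\<close> requires a finite first Gaussian moment.\<close>

lemma integrable_norm_std_gaussian: "integrable (std_gaussian :: 'a::euclidean_space measure) norm"
proof -
  have "integrable lborel (\<lambda>z::'a. std_gaussian_density z * \<bar>z \<bullet> b0\<bar>)" if "b0 \<in> Basis" for b0
  proof -
    let ?f = "\<lambda>b t. std_normal_density t * (if b = b0 then \<bar>t\<bar> else 1)"
    have "integrable lborel (\<lambda>t. std_normal_density t * \<bar>t\<bar>)"
      using normal_moment_abs_odd[of 1 0 0] by (simp add: has_bochner_integral_iff)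
    then have "integrable lborel (?f b)" for b
      by (cases "b = b0") auto
    from integrable_lborel_prod[OF this, of id] show ?thesis
      using that by (simp add: std_gaussian_density_def prod.distrib prod.delta)
  qed
  then have "integrable std_gaussian (\<lambda>z::'a. \<Sum>b\<in>Basis. \<bar>z \<bullet> b\<bar>)"
    by (simp add: std_gaussian_def integrable_density)
  then show ?thesis
    by (rule Bochner_Integration.integrable_bound) (auto intro!: AE_I2 order_trans[OF norm_le_l1])
qed

text \<open>The substitution y = x + z / s has Jacobian factor \<open>s ^ DIM('a)\<close>: averaging
  over Gaussian translates is convolution with a bump of width 1 / s.\<close>

lemma integral_shift_std_gaussian:
  fixes f :: "'a::euclidean_space \<Rightarrow> real"
  assumes [measurable]: "f \<in> borel_measurable borel" and s: "s > 0"
  shows "(\<integral>z. f (x + z /\<^sub>R s) \<partial>std_gaussian)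
    = (\<integral>y. s ^ DIM('a) * std_gaussian_density (s *\<^sub>R (x - y)) * f y \<partial>lborel)"
proof -
  define h where "h y = s ^ DIM('a) * std_gaussian_density (s *\<^sub>R (x - y)) * f y" for y
  have [measurable]: "h \<in> borel_measurable borel"
    unfolding h_def by measurable
  have "(\<integral>y. h y \<partial>lborel)
      = (\<integral>y. h y \<partial>density (distr lborel borel (\<lambda>z. x + inverse s *\<^sub>R z)) (\<lambda>_. \<bar>inverse s\<bar>^DIM('a)))"
    by (rule arg_cong[OF lborel_affine]) (use s in simp)
  also have "\<dots> = (\<integral>z. \<bar>inverse s\<bar>^DIM('a) *\<^sub>R h (x + z /\<^sub>R s) \<partial>lborel)"
    by (subst integral_density) (simp_all add: integral_distr)
  also have "\<dots> = (\<integral>z. std_gaussian_density z * f (x + z /\<^sub>R s) \<partial>lborel)"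
  proof (intro Bochner_Integration.integral_cong refl)
    fix z :: 'a
    have 1: "\<bar>inverse s\<bar>^DIM('a) * s^DIM('a) = 1"
      using s by (simp flip: power_mult_distrib)
    have "s *\<^sub>R (x - (x + z /\<^sub>R s)) = - z"
      using s by simp
    then have "std_gaussian_density (s *\<^sub>R (x - (x + z /\<^sub>R s))) = std_gaussian_density z"
      by (simp only: std_gaussian_density_eq norm_minus_cancel)
    then show "\<bar>inverse s\<bar>^DIM('a) *\<^sub>R h (x + z /\<^sub>R s) = std_gaussian_density z * f (x + z /\<^sub>R s)"
      by (simp only: h_def real_scaleR_def mult.assoc[symmetric] 1 mult_1)
  qed
  also have "\<dots> = (\<integral>z. f (x + z /\<^sub>R s) \<partial>std_gaussian)"
    by (simp add: std_gaussian_def integral_density)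
  finally show ?thesis
    by (simp add: h_def)
qed

text \<open>Gaussian mollification writes a function as a superposition of exponentials with an
  integrable weight, so integrals of mollified functions only depend on integrals of exponentials.\<close>

lemma mollification_eq_integral_iexp:
  fixes f :: "'a::euclidean_space \<Rightarrow> real" and s :: real
  defines "w \<equiv> \<lambda>p. complex_of_real (s ^ DIM('a) * (1 / sqrt (2 * pi)) ^ DIM('a) * f (fst p))
      * iexp (- ((s *\<^sub>R snd p) \<bullet> fst p))"
  assumes f: "integrable lborel f" and s: "s > 0"
  shows "complex_of_real (\<integral>z. f (x + z /\<^sub>R s) \<partial>std_gaussian) =
      (CLINT p|lborel \<Otimes>\<^sub>M std_gaussian. w p * iexp ((s *\<^sub>R snd p) \<bullet> x))" (is ?eq)
    and "integrable (lborel \<Otimes>\<^sub>M std_gaussian) (\<lambda>p. w p * iexp ((s *\<^sub>R snd p) \<bullet> x))" (is ?int)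
proof -
  let ?c = "s ^ DIM('a) * (1 / sqrt (2 * pi)) ^ DIM('a)"
  interpret G: prob_space "std_gaussian :: 'a measure"
    by (rule prob_space_std_gaussian)
  interpret pair_sigma_finite lborel "std_gaussian :: 'a measure" ..
  have [measurable]: "f \<in> borel_measurable borel"
    using f by (simp flip: measurable_lborel1)
  have wm [measurable]: "w \<in> borel_measurable (lborel \<Otimes>\<^sub>M std_gaussian)"
    unfolding w_def by measurable
  have "integrable (lborel \<Otimes>\<^sub>M (std_gaussian :: 'a measure)) (\<lambda>p. (?c * f (fst p)) * 1)"
    by (rule integrable_pair_mult) (use f in \<open>auto intro: sigma_finite_lborel G.sigma_finite_measure_axioms\<close>)
  then show ?int
  proof (rule Bochner_Integration.integrable_bound, measurable, intro AE_I2)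
    show "norm (w p * iexp ((s *\<^sub>R snd p) \<bullet> x)) \<le> norm (?c * f (fst p) * 1)" for p
      by (simp only: w_def norm_mult norm_of_real norm_exp_i_times mult_1_right real_norm_def order_refl)
  qed
  note int = this
  have split: "w (y, z) * iexp ((s *\<^sub>R z) \<bullet> x) = complex_of_real (?c * f y) * iexp (z \<bullet> (s *\<^sub>R (x - y)))"
    for y z
  proof -
    have "iexp (- ((s *\<^sub>R z) \<bullet> y)) * iexp ((s *\<^sub>R z) \<bullet> x) = iexp (z \<bullet> (s *\<^sub>R (x - y)))"
      unfolding exp_add[symmetric] by (simp add: algebra_simps inner_diff_right)
    then show ?thesis
      by (simp add: w_def mult.assoc)
  qed
  have "(CLINT p|lborel \<Otimes>\<^sub>M std_gaussian. w p * iexp ((s *\<^sub>R snd p) \<bullet> x))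
      = (CLINT y|lborel. CLINT z|std_gaussian. w (y, z) * iexp ((s *\<^sub>R z) \<bullet> x))"
    using integral_fst'[OF int] by simp
  \<comment> \<open>Integrating out z at frequency s (x - y) turns the exponential back into the
    Gaussian kernel in x - y.\<close>
  also have "\<dots> = (CLINT y|lborel. complex_of_real (?c * f y * exp (- (norm (s *\<^sub>R (x - y)))\<^sup>2 / 2)))"
    by (simp only: split integral_mult_right_zero integral_iexp_std_gaussian of_real_mult)
  also have "\<dots> = complex_of_real (LINT y|lborel. ?c * f y * exp (- (norm (s *\<^sub>R (x - y)))\<^sup>2 / 2))"
    by (rule integral_complex_of_real)
  also have "\<dots> = complex_of_real (\<integral>z. f (x + z /\<^sub>R s) \<partial>std_gaussian)"
    using s by (simp add: integral_shift_std_gaussian std_gaussian_density_eq mult_ac)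
  finally show ?eq ..
qed

text \<open>Fubini moves the integral over \<open>m\<close> innermost, where \<open>A\<close> and
  \<open>B\<close> enter only through exponential increments. The difference is kept together
  because \<open>m\<close> may be infinite, so that the two terms need not be integrable
  separately.\<close>

lemma integral_mollification_eq:
  fixes f :: "'a::euclidean_space \<Rightarrow> real" and A B :: "'b \<Rightarrow> 'a"
  assumes m: "sigma_finite_measure m"
    and [measurable]: "A \<in> borel_measurable m" "B \<in> borel_measurable m"
    and AB: "integrable m (\<lambda>\<omega>. min 1 (norm (A \<omega> - B \<omega>)))"
    and f: "integrable lborel f" and s: "s > 0"
  shows "complex_of_real (\<integral>\<omega>. (\<integral>z. f (A \<omega> + z /\<^sub>R s) \<partial>std_gaussian) - (\<integral>z. f (B \<omega> + z /\<^sub>R s) \<partial>std_gaussian) \<partial>m) =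
    (CLINT p|lborel \<Otimes>\<^sub>M std_gaussian.
        complex_of_real (s ^ DIM('a) * (1 / sqrt (2 * pi)) ^ DIM('a) * f (fst p))
        * iexp (- ((s *\<^sub>R snd p) \<bullet> fst p))
        * (CLINT \<omega>|m. iexp ((s *\<^sub>R snd p) \<bullet> A \<omega>) - iexp ((s *\<^sub>R snd p) \<bullet> B \<omega>)))"
proof -
  let ?c = "s ^ DIM('a) * (1 / sqrt (2 * pi)) ^ DIM('a)"
  let ?P = "lborel \<Otimes>\<^sub>M std_gaussian :: ('a \<times> 'a) measure"
  define w where "w p = complex_of_real (?c * f (fst p)) * iexp (- ((s *\<^sub>R snd p) \<bullet> fst p))" for p
  note moll = mollification_eq_integral_iexp[OF f s, folded w_def]
  interpret m: sigma_finite_measure m by fact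
  interpret G: prob_space "std_gaussian :: 'a measure"
    by (rule prob_space_std_gaussian)
  interpret LG: pair_sigma_finite lborel "std_gaussian :: 'a measure" ..
  interpret mP: pair_sigma_finite m ?P ..
  have [measurable]: "f \<in> borel_measurable borel"
    using f by (simp flip: measurable_lborel1)
  have wm [measurable]: "w \<in> borel_measurable ?P"
    unfolding w_def by measurable
  define D where "D \<omega> p = iexp ((s *\<^sub>R snd p) \<bullet> A \<omega>) - iexp ((s *\<^sub>R snd p) \<bullet> B \<omega>)" for \<omega> and p :: "'a \<times> 'a"
  have [measurable]: "(\<lambda>(\<omega>, p). w p * D \<omega> p) \<in> borel_measurable (m \<Otimes>\<^sub>M ?P)"
    unfolding D_def by measurable
  \<comment> \<open>The factor 2 + s |z| is the increment constant at frequency s z from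
    \<open>norm_iexp_inner_diff_le\<close>; multiplied by min 1 |A - B| it gives the Fubini
    majorant.\<close>
  have "integrable ?P (\<lambda>p. (?c * f (fst p)) * (2 + s * norm (snd p)))"
    by (rule integrable_pair_mult)
      (use f integrable_norm_std_gaussian in
        \<open>auto intro: sigma_finite_lborel G.sigma_finite_measure_axioms\<close>)
  from integrable_pair_mult[OF m LG.P.sigma_finite_measure_axioms AB this]
  have int: "integrable (m \<Otimes>\<^sub>M ?P) (\<lambda>(\<omega>, p). w p * D \<omega> p)"
  proof (rule Bochner_Integration.integrable_bound, measurable, intro AE_I2, clarify)
    fix \<omega> and y z :: 'a
    have "norm (D \<omega> (y, z)) \<le> (2 + s * norm z) * min 1 (norm (A \<omega> - B \<omega>))"
      using norm_iexp_inner_diff_le[of "s *\<^sub>R z" "A \<omega>" "B \<omega>"] s by (simp add: D_def)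
    moreover have "norm (w (y, z)) = \<bar>?c * f y\<bar>"
      by (simp only: w_def norm_mult norm_of_real norm_exp_i_times mult_1_right fst_conv)
    ultimately have "norm (w (y, z)) * norm (D \<omega> (y, z))
        \<le> \<bar>?c * f y\<bar> * ((2 + s * norm z) * min 1 (norm (A \<omega> - B \<omega>)))"
      by (simp only: mult_left_mono abs_ge_zero)
    then show "norm (w (y, z) * D \<omega> (y, z)) \<le> norm (min 1 (norm (A (fst (\<omega>, y, z)) - B (fst (\<omega>, y, z)))) *
               (s ^ DIM('a) * (1 / sqrt (2 * pi)) ^ DIM('a) * f (fst (snd (\<omega>, y, z))) * (2 + s * norm (snd (snd (\<omega>, y, z))))))"
      using s by (simp add: norm_mult abs_mult mult_ac)
  qed
  have "complex_of_real (\<integral>\<omega>. (\<integral>z. f (A \<omega> + z /\<^sub>R s) \<partial>std_gaussian) - (\<integral>z. f (B \<omega> + z /\<^sub>R s) \<partial>std_gaussian) \<partial>m)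
      = (CLINT \<omega>|m. complex_of_real ((\<integral>z. f (A \<omega> + z /\<^sub>R s) \<partial>std_gaussian) - (\<integral>z. f (B \<omega> + z /\<^sub>R s) \<partial>std_gaussian)))"
    by (rule integral_complex_of_real[symmetric])
  also have "\<dots> = (CLINT \<omega>|m. CLINT p|?P. w p * D \<omega> p)"
    by (simp only: of_real_diff moll(1) D_def right_diff_distrib
        Bochner_Integration.integral_diff[OF moll(2) moll(2)])
  also have "\<dots> = (CLINT p|?P. CLINT \<omega>|m. w p * D \<omega> p)"
    by (rule mP.Fubini_integral[symmetric]) (use int in simp)
  also have "\<dots> = (CLINT p|?P. w p * (CLINT \<omega>|m. D \<omega> p))"
    by simp
  finally show ?thesis
    by (simp add: w_def D_def)
qed

text \<open>Averaging over common translates preserves the increment bound, so K * min 1 |A - B|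
  dominates for all n; pointwise, the shift z / (n + 1) disappears in the limit.\<close>

lemma mollification_tendsto:
  fixes f :: "'a::euclidean_space \<Rightarrow> real" and A B :: "'b \<Rightarrow> 'a"
  assumes [measurable]: "A \<in> borel_measurable m" "B \<in> borel_measurable m"
    and AB: "integrable m (\<lambda>\<omega>. min 1 (norm (A \<omega> - B \<omega>)))"
    and f: "\<And>x y. \<bar>f x - f y\<bar> \<le> K * min 1 (norm (x - y))"
  shows "(\<lambda>n. \<integral>\<omega>. (\<integral>z. f (A \<omega> + z /\<^sub>R real (Suc n)) \<partial>std_gaussian)
      - (\<integral>z. f (B \<omega> + z /\<^sub>R real (Suc n)) \<partial>std_gaussian) \<partial>m)
    \<longlonglongrightarrow> (\<integral>\<omega>. f (A \<omega>) - f (B \<omega>) \<partial>m)"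
proof -
  interpret G: prob_space "std_gaussian :: 'a measure"
    by (rule prob_space_std_gaussian)
  have K: "0 \<le> K"
  proof -
    obtain b :: 'a where "b \<in> Basis" using nonempty_Basis by blast
    then show ?thesis
      using f[of b 0] by simp
  qed
  have "continuous_on UNIV f"
  proof (intro continuous_onI)
    fix x :: 'a and e :: real assume "e > 0"
    show "\<exists>d>0. \<forall>x'\<in>UNIV. dist x' x < d \<longrightarrow> dist (f x') (f x) \<le> e"
    proof (intro exI conjI ballI impI)
      \<comment> \<open>The summand 1 covers the case K = 0.\<close>
      show "e / (K + 1) > 0" using \<open>e > 0\<close> K by simp
      fix x' assume "dist x' x < e / (K + 1)"
      then have "(K + 1) * dist x' x < e"
        using K by (simp add: field_simps)
      moreover have "K * min 1 (dist x' x) \<le> (K + 1) * dist x' x"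
        using K by (intro mult_mono) auto
      ultimately show "dist (f x') (f x) \<le> e"
        using f[of x' x] by (simp add: dist_norm)
    qed
  qed
  note fc = this
  have [measurable]: "f \<in> borel_measurable borel"
    by (rule borel_measurable_continuous_onI[OF fc])
  have bounded: "\<bar>f x\<bar> \<le> \<bar>f 0\<bar> + K" for x
  proof -
    have "K * min 1 (norm (x - 0)) \<le> K * 1"
      using K by (intro mult_left_mono) auto
    then show ?thesis using f[of x 0] by simp
  qed
  have int: "integrable std_gaussian (\<lambda>z. f (x + z /\<^sub>R s))" for x s
    by (rule G.integrable_const_bound[where B = "\<bar>f 0\<bar> + K"]) (auto simp: bounded)
  have lim: "(\<lambda>n. \<integral>z. f (x + z /\<^sub>R real (Suc n)) \<partial>std_gaussian) \<longlonglongrightarrow> f x" for x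
  proof -
    have "(\<lambda>n. \<integral>z. f (x + z /\<^sub>R real (Suc n)) \<partial>std_gaussian) \<longlonglongrightarrow> (\<integral>z. f x \<partial>(std_gaussian :: 'a measure))"
    proof (rule integral_dominated_convergence[where w = "\<lambda>_. \<bar>f 0\<bar> + K"])
      show "AE z in std_gaussian. (\<lambda>n. f (x + z /\<^sub>R real (Suc n))) \<longlonglongrightarrow> f x"
      proof (intro AE_I2)
        fix z :: 'a
        have "(\<lambda>n. x + z /\<^sub>R real (Suc n)) \<longlonglongrightarrow> x + 0 *\<^sub>R z"
          by (intro tendsto_intros LIMSEQ_inverse_real_of_nat)
        then show "(\<lambda>n. f (x + z /\<^sub>R real (Suc n))) \<longlonglongrightarrow> f x"
          by (intro continuous_on_tendsto_compose[OF fc]) auto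
      qed
    qed (auto simp: bounded)
    then show ?thesis by (simp add: G.prob_space[simplified])
  qed
  show ?thesis
  proof (rule integral_dominated_convergence[where w = "\<lambda>\<omega>. K * min 1 (norm (A \<omega> - B \<omega>))"])
    show "integrable m (\<lambda>\<omega>. K * min 1 (norm (A \<omega> - B \<omega>)))"
      using AB by simp
    show "AE \<omega> in m. norm ((\<integral>z. f (A \<omega> + z /\<^sub>R real (Suc n)) \<partial>std_gaussian)
        - (\<integral>z. f (B \<omega> + z /\<^sub>R real (Suc n)) \<partial>std_gaussian)) \<le> K * min 1 (norm (A \<omega> - B \<omega>))" for n
    proof (intro AE_I2)
      fix \<omega>
      have "norm (\<integral>z. f (A \<omega> + z /\<^sub>R real (Suc n)) - f (B \<omega> + z /\<^sub>R real (Suc n)) \<partial>std_gaussian)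
          \<le> (\<integral>z. norm (f (A \<omega> + z /\<^sub>R real (Suc n)) - f (B \<omega> + z /\<^sub>R real (Suc n))) \<partial>std_gaussian)"
        by (rule integral_norm_bound)
      also have "\<dots> \<le> (\<integral>z. K * min 1 (norm (A \<omega> - B \<omega>)) \<partial>(std_gaussian :: 'a measure))"
      proof (intro integral_mono integrable_norm Bochner_Integration.integrable_diff int)
        show "norm (f (A \<omega> + z /\<^sub>R real (Suc n)) - f (B \<omega> + z /\<^sub>R real (Suc n)))
            \<le> K * min 1 (norm (A \<omega> - B \<omega>))" for z
          using f[of "A \<omega> + z /\<^sub>R real (Suc n)" "B \<omega> + z /\<^sub>R real (Suc n)"] by simp
      qed simp
      also have "\<dots> = K * min 1 (norm (A \<omega> - B \<omega>))"
        using G.prob_space by simp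
      finally show "norm ((\<integral>z. f (A \<omega> + z /\<^sub>R real (Suc n)) \<partial>std_gaussian)
        - (\<integral>z. f (B \<omega> + z /\<^sub>R real (Suc n)) \<partial>std_gaussian)) \<le> K * min 1 (norm (A \<omega> - B \<omega>))"
        by (simp only: Bochner_Integration.integral_diff[OF int int])
    qed
    show "AE \<omega> in m. (\<lambda>n. (\<integral>z. f (A \<omega> + z /\<^sub>R real (Suc n)) \<partial>std_gaussian)
        - (\<integral>z. f (B \<omega> + z /\<^sub>R real (Suc n)) \<partial>std_gaussian)) \<longlonglongrightarrow> f (A \<omega>) - f (B \<omega>)"
      by (intro AE_I2 tendsto_diff lim)
  qed measurable
qed

text \<open>The transfer principle: for each width the mollified integrals agree, as they see only
  exponential increments, and then the width tends to 0. It serves twice, for uniqueness of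
  characteristic functions and for the dilation identity behind the Stein identity.\<close>

proposition integral_diff_eq_if_iexp_eq:
  fixes f :: "'a::euclidean_space \<Rightarrow> real"
    and A1 B1 :: "'b \<Rightarrow> 'a" and A2 B2 :: "'c \<Rightarrow> 'a"
  assumes m: "sigma_finite_measure m1" "sigma_finite_measure m2"
    and meas: "A1 \<in> borel_measurable m1" "B1 \<in> borel_measurable m1"
      "A2 \<in> borel_measurable m2" "B2 \<in> borel_measurable m2"
    and AB: "integrable m1 (\<lambda>\<omega>. min 1 (norm (A1 \<omega> - B1 \<omega>)))"
      "integrable m2 (\<lambda>\<omega>. min 1 (norm (A2 \<omega> - B2 \<omega>)))"
    and eq: "\<And>\<xi>. (CLINT \<omega>|m1. iexp (\<xi> \<bullet> A1 \<omega>) - iexp (\<xi> \<bullet> B1 \<omega>))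
      = (CLINT \<omega>|m2. iexp (\<xi> \<bullet> A2 \<omega>) - iexp (\<xi> \<bullet> B2 \<omega>))"
    and f: "integrable lborel f" "\<And>x y. \<bar>f x - f y\<bar> \<le> K * min 1 (norm (x - y))"
  shows "(\<integral>\<omega>. f (A1 \<omega>) - f (B1 \<omega>) \<partial>m1) = (\<integral>\<omega>. f (A2 \<omega>) - f (B2 \<omega>) \<partial>m2)"
proof (rule LIMSEQ_unique[OF mollification_tendsto[OF meas(1,2) AB(1) f(2)]])
  have "(\<integral>\<omega>. (\<integral>z. f (A1 \<omega> + z /\<^sub>R s) \<partial>std_gaussian) - (\<integral>z. f (B1 \<omega> + z /\<^sub>R s) \<partial>std_gaussian) \<partial>m1)
      = (\<integral>\<omega>. (\<integral>z. f (A2 \<omega> + z /\<^sub>R s) \<partial>std_gaussian) - (\<integral>z. f (B2 \<omega> + z /\<^sub>R s) \<partial>std_gaussian) \<partial>m2)"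
    if "s > 0" for s
    unfolding of_real_eq_iff[where 'a = complex, symmetric]
      integral_mollification_eq[OF m(1) meas(1,2) AB(1) f(1) that]
      integral_mollification_eq[OF m(2) meas(3,4) AB(2) f(1) that] eq ..
  then show "(\<lambda>n. \<integral>\<omega>. (\<integral>z. f (A1 \<omega> + z /\<^sub>R real (Suc n)) \<partial>std_gaussian)
      - (\<integral>z. f (B1 \<omega> + z /\<^sub>R real (Suc n)) \<partial>std_gaussian) \<partial>m1) \<longlonglongrightarrow> (\<integral>\<omega>. f (A2 \<omega>) - f (B2 \<omega>) \<partial>m2)"
    using mollification_tendsto[OF meas(3,4) AB(2) f(2)] by simp
qed

text \<open>Compact sets determine a finite Borel measure by inner regularity, and the indicator of
  a compact set is a limit of Lipschitz cutoffs to which the transfer principle applies.\<close>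

lemma measure_eq_if_iexp_eq:
  fixes \<mu> \<nu> :: "'a::euclidean_space measure"
  assumes "prob_space \<mu>" "prob_space \<nu>" and sets: "sets \<mu> = sets borel" "sets \<nu> = sets borel"
    and eq: "\<And>\<xi>. (CLINT x|\<mu>. iexp (\<xi> \<bullet> x)) = (CLINT x|\<nu>. iexp (\<xi> \<bullet> x))"
  shows "\<mu> = \<nu>"
proof -
  interpret \<mu>: prob_space \<mu> by fact
  interpret \<nu>: prob_space \<nu> by fact
  note [measurable_cong] = sets
  have compact: "emeasure \<mu> K = emeasure \<nu> K" if K: "compact K" for K
  proof (cases "K = {}")
    case False
    \<comment> \<open>Lipschitz cutoffs that are 1 on \<open>K\<close> and vanish beyond distance 1
      / (n + 1) from it; hence they are supported in a compact set.\<close>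
    define f where "f n x = max 0 (1 - real (Suc n) * infdist x K)" for n x
    have cont: "continuous_on S (f n)" for n S
      unfolding f_def by (intro continuous_intros)
    have [measurable]: "f n \<in> borel_measurable borel" for n
      by (intro borel_measurable_continuous_onI cont)
    have bounds: "0 \<le> f n x" "f n x \<le> 1" for n x
      by (simp_all add: f_def infdist_nonneg)
    have int: "integrable M (f n)" if "prob_space M" "sets M = sets borel" for M n
    proof -
      interpret M: prob_space M by fact
      note that(2)[measurable_cong]
      show ?thesis
        by (rule M.integrable_const_bound[where B = 1]) (auto simp: bounds)
    qed
    have int_lborel: "integrable lborel (f n)" for n
    proof -
      let ?C = "{x. infdist x K \<le> 1}"
      have "integrable lborel (\<lambda>x. indicator ?C x *\<^sub>R f n x)"
        by (intro borel_integrable_compact compact_infdist_le K False cont) simp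
      moreover have "indicator ?C x *\<^sub>R f n x = f n x" for x
      proof (cases "infdist x K \<le> 1")
        case False
        then have "1 * 1 \<le> real (Suc n) * infdist x K"
          by (intro mult_mono) auto
        with False show ?thesis by (simp add: f_def)
      qed simp
      ultimately show ?thesis by (simp only:)
    qed
    have lip: "\<bar>f n x - f n y\<bar> \<le> (1 + real (Suc n)) * min 1 (norm (x - y))" for n x y
    proof -
      have "\<bar>f n x - f n y\<bar> \<le> \<bar>real (Suc n) * infdist x K - real (Suc n) * infdist y K\<bar>"
        unfolding f_def by linarith
      also have "\<dots> = real (Suc n) * \<bar>infdist x K - infdist y K\<bar>"
        by (simp only: abs_mult abs_of_nat flip: right_diff_distrib)
      also have "\<dots> \<le> (1 + real (Suc n)) * norm (x - y)"
        using infdist_triangle_abs[of x K y] by (intro mult_mono) (auto simp: dist_norm)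
      finally have "\<bar>f n x - f n y\<bar> \<le> (1 + real (Suc n)) * norm (x - y)" .
      moreover have "\<bar>f n x - f n y\<bar> \<le> (1 + real (Suc n)) * 1"
        using bounds[of n x] bounds[of n y] by simp
      ultimately show ?thesis by (simp only: min_def split: if_split) auto
    qed
    have lim: "(\<lambda>n. f n x) \<longlonglongrightarrow> indicator K x" for x
    proof (cases "x \<in> K")
      case False
      then have pos: "infdist x K > 0"
        using K \<open>K \<noteq> {}\<close> by (intro infdist_pos_not_in_closed compact_imp_closed)
      then obtain N where N: "inverse (real (Suc N)) < infdist x K"
        using reals_Archimedean by blast
      have "f n x = 0" if "n \<ge> N" for n
      proof -
        have "1 = real (Suc N) * inverse (real (Suc N))" by simp
        also have "\<dots> \<le> real (Suc n) * infdist x K"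
          using N that by (intro mult_mono) auto
        finally show ?thesis by (simp add: f_def)
      qed
      then show ?thesis
        using False by (intro tendsto_eventually eventually_sequentiallyI[of N]) simp
    qed (simp add: f_def)
    have lim_int: "(\<lambda>n. \<integral>x. f n x \<partial>M) \<longlonglongrightarrow> measure M K" if "prob_space M" "sets M = sets borel" for M
    proof -
      interpret M: prob_space M by fact
      note that(2)[measurable_cong]
      have [measurable]: "K \<in> sets M"
        using K that(2) by (simp add: compact_imp_closed)
      have "(\<lambda>n. \<integral>x. f n x \<partial>M) \<longlonglongrightarrow> (\<integral>x. indicator K x \<partial>M)"
        by (rule integral_dominated_convergence[where w = "\<lambda>_. 1"]) (auto simp: bounds lim)
      then show ?thesis by simp
    qed
    \<comment> \<open>The second map is taken constantly 0; the constants it adds cancel because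
      both measures have mass 1.\<close>
    have "(\<integral>x. f n x - f n 0 \<partial>\<mu>) = (\<integral>x. f n x - f n 0 \<partial>\<nu>)" for n
    proof (rule integral_diff_eq_if_iexp_eq[OF \<mu>.sigma_finite_measure_axioms \<nu>.sigma_finite_measure_axioms
          _ _ _ _ _ _ _ int_lborel lip])
      have "integrable M (\<lambda>x. iexp (\<xi> \<bullet> x))" if "prob_space M" "sets M = sets borel"
        for M and \<xi> :: 'a
      proof -
        interpret M: prob_space M by fact
        note that(2)[measurable_cong]
        show ?thesis
          by (rule M.integrable_const_bound[where B = 1]) simp_all
      qed
      then show "(CLINT x|\<mu>. iexp (\<xi> \<bullet> x) - iexp (\<xi> \<bullet> 0)) = (CLINT x|\<nu>. iexp (\<xi> \<bullet> x) - iexp (\<xi> \<bullet> 0))" for \<xi>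
        using assms eq \<mu>.prob_space \<nu>.prob_space by (subst (1 2) Bochner_Integration.integral_diff) auto
      show "integrable \<mu> (\<lambda>x. min 1 (norm (x - 0)))"
        by (rule \<mu>.integrable_const_bound[where B = 1]) auto
      show "integrable \<nu> (\<lambda>x. min 1 (norm (x - 0)))"
        by (rule \<nu>.integrable_const_bound[where B = 1]) auto
    qed measurable
    then have "(\<integral>x. f n x \<partial>\<mu>) = (\<integral>x. f n x \<partial>\<nu>)" for n
      using int assms \<mu>.prob_space \<nu>.prob_space by simp
    then have "measure \<mu> K = measure \<nu> K"
      using lim_int[of \<mu>] lim_int[of \<nu>] assms by (auto intro: LIMSEQ_unique)
    then show ?thesis
      by (simp add: \<mu>.emeasure_eq_measure \<nu>.emeasure_eq_measure)
  qed simp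
  show ?thesis
  proof (rule measure_eqI)
    fix B assume "B \<in> sets \<mu>"
    then have "B \<in> sets borel" using sets by simp
    then show "emeasure \<mu> B = emeasure \<nu> B"
      using inner_regular[of \<mu> B] inner_regular[of \<nu> B] sets compact by simp
  qed (simp add: sets)
qed

section \<open>Levy measures that scale with index \<open>\<alpha> \<in> (0, 1)\<close>\<close>

lemma nn_integral_powr_Ioo:
  assumes "a > -1" "R \<ge> 0"
  shows "(\<integral>\<^sup>+s. ennreal (s powr a) * indicator {0<..<R} s \<partial>lborel) = ennreal (R powr (a + 1) / (a + 1))"
proof -
  have "(\<integral>\<^sup>+s. ennreal (s powr a) * indicator {0<..<R} s \<partial>lborel)
      = (\<integral>\<^sup>+s. ennreal (s powr a) * indicator {0..R} s \<partial>lborel)"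
  proof (rule nn_integral_cong_AE)
    have "AE s in lborel. s \<noteq> 0 \<and> s \<noteq> R"
      by (simp add: AE_lborel_singleton)
    then show "AE s in lborel. ennreal (s powr a) * indicator {0<..<R} s = ennreal (s powr a) * indicator {0..R} s"
      by eventually_elim (auto simp: indicator_def)
  qed
  also have "\<dots> = ennreal (R powr (a + 1) / (a + 1))"
    using assms by (intro nn_integral_has_integral_lebesgue' has_integral_powr_from_0) auto
  finally show ?thesis .
qed

locale stable_levy =
  fixes \<nu> :: "'a::euclidean_space measure" and \<alpha> :: real
  assumes \<alpha>: "0 < \<alpha>" "\<alpha> < 1"
    and levy: "levy_measure \<nu>"
    and scaling: "\<And>c. 0 < c \<Longrightarrow> \<nu> = scale_measure (ennreal (c powr (- \<alpha>))) (dilation c \<nu>)"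
begin

lemma sets_nu [simp, measurable_cong]: "sets \<nu> = sets borel"
  using levy by (simp add: levy_measure_def)

lemma space_nu [simp]: "space \<nu> = UNIV"
  using sets_eq_imp_space_eq[OF sets_nu] by simp

lemma nu_zero: "emeasure \<nu> {0} = 0"
  using levy by (simp add: levy_measure_def)

lemma AE_nu_nonzero: "AE u in \<nu>. u \<noteq> 0"
  by (rule AE_I[of _ _ "{0}"]) (auto simp: nu_zero)

text \<open>A constant density in place of \<open>scale_measure\<close> makes the integration rules
  for \<open>density\<close> and \<open>distr\<close> applicable.\<close>

lemma nu_eq_density:
  assumes "0 < c"
  shows "\<nu> = density (distr \<nu> borel (\<lambda>u. c *\<^sub>R u)) (\<lambda>_. ennreal (c powr (- \<alpha>)))"
proof (subst scaling[OF assms], rule measure_eqI)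
  fix A assume "A \<in> sets (scale_measure (ennreal (c powr - \<alpha>)) (dilation c \<nu>))"
  then show "emeasure (scale_measure (ennreal (c powr - \<alpha>)) (dilation c \<nu>)) A =
      emeasure (density (distr \<nu> borel ((*\<^sub>R) c)) (\<lambda>_. ennreal (c powr - \<alpha>))) A"
    by (simp add: dilation_def emeasure_density nn_integral_cmult)
qed (simp add: dilation_def)

lemma nn_integral_nu_scale:
  assumes "0 < c" and [measurable]: "g \<in> borel_measurable borel"
  shows "(\<integral>\<^sup>+u. g u \<partial>\<nu>) = ennreal (c powr (- \<alpha>)) * (\<integral>\<^sup>+u. g (c *\<^sub>R u) \<partial>\<nu>)"
  by (subst nu_eq_density[OF assms(1)])
    (simp add: nn_integral_density nn_integral_distr nn_integral_cmult)

lemma integral_nu_scale: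
  fixes g :: "'a \<Rightarrow> 'c::{banach, second_countable_topology}"
  assumes "0 < c" and [measurable]: "g \<in> borel_measurable borel"
  shows "(\<integral>u. g (c *\<^sub>R u) \<partial>\<nu>) = c powr \<alpha> *\<^sub>R (\<integral>u. g u \<partial>\<nu>)"
proof -
  have "(\<integral>u. g u \<partial>\<nu>) = c powr (- \<alpha>) *\<^sub>R (\<integral>u. g (c *\<^sub>R u) \<partial>\<nu>)"
    by (subst nu_eq_density[OF assms(1)], subst integral_density)
      (simp_all add: integral_distr)
  then show ?thesis
    using assms(1) by (simp flip: powr_add)
qed

text \<open>Markov's inequality for min 1 |u|^2, which is at least min 1 e^2 on this set.\<close>

lemma emeasure_nu_large_finite:
  assumes "e > 0"
  shows "emeasure \<nu> {u. norm u > e} < \<infinity>"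
proof -
  have "emeasure \<nu> {u. norm u > e} = (\<integral>\<^sup>+u. indicator {u. norm u > e} u \<partial>\<nu>)"
    by simp
  also have "\<dots> \<le> (\<integral>\<^sup>+u. ennreal (1 / min 1 (e\<^sup>2)) * ennreal (min 1 ((norm u)\<^sup>2)) \<partial>\<nu>)"
  proof (rule nn_integral_mono)
    fix u :: 'a
    show "indicator {u. norm u > e} u \<le> ennreal (1 / min 1 (e\<^sup>2)) * ennreal (min 1 ((norm u)\<^sup>2))"
    proof (cases "norm u > e")
      case True
      then have "e\<^sup>2 \<le> (norm u)\<^sup>2"
        using assms by (intro power_mono) auto
      then have "min 1 (e\<^sup>2) \<le> min 1 ((norm u)\<^sup>2)"
        by auto
      moreover have "0 < min 1 (e\<^sup>2)"
        using assms by simp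
      ultimately have "1 \<le> 1 / min 1 (e\<^sup>2) * min 1 ((norm u)\<^sup>2)"
        by (simp add: field_simps)
      then show ?thesis
        using True by (simp add: ennreal_mult[symmetric] del: min_less_iff_conj)
    qed simp
  qed
  also have "\<dots> = ennreal (1 / min 1 (e\<^sup>2)) * (\<integral>\<^sup>+u. ennreal (min 1 ((norm u)\<^sup>2)) \<partial>\<nu>)"
    by (rule nn_integral_cmult) simp
  also have "\<dots> < \<infinity>"
    using levy by (simp add: levy_measure_def ennreal_mult_less_top)
  finally show ?thesis .
qed

text \<open>Fubini is applied to \<nu> although it may have infinite mass near 0: the origin is null
  and each set |u| > 1 / (n + 1) has finite mass.\<close>

sublocale sigma_finite_measure \<nu>
proof
  let ?A = "insert {0} (range (\<lambda>n. {u. norm u > inverse (real (Suc n))}))"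
  have "u \<in> \<Union>?A" for u :: 'a
    using reals_Archimedean[of "norm u"] by (cases "u = 0") auto
  then have "\<Union>?A = space \<nu>" by auto
  moreover have "emeasure \<nu> a \<noteq> \<infinity>" if "a \<in> ?A" for a
    using that emeasure_nu_large_finite nu_zero by (auto simp: less_top[symmetric])
  moreover have "?A \<subseteq> sets \<nu>" by auto
  ultimately show "\<exists>A. countable A \<and> A \<subseteq> sets \<nu> \<and> \<Union>A = space \<nu> \<and> (\<forall>a\<in>A. emeasure \<nu> a \<noteq> \<infinity>)"
    by (intro exI[of _ ?A]) auto
qed

text \<open>Layer-cake: integrate the tail \<open>\<nu>{\<parallel>u\<parallel> > t} = t\<^bsup>-\<alpha>\<^esup> \<nu>{\<parallel>u\<parallel> > 1}\<close> over \<open>t \<in> (0, 1)\<close>.\<close>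

lemma integrable_min_norm: "integrable \<nu> (\<lambda>u. min 1 (norm u))"
proof (rule integrableI_bounded)
  let ?T = "emeasure \<nu> {u. norm u > 1}"
  interpret L: pair_sigma_finite lborel \<nu> ..
  have tail: "(\<integral>\<^sup>+u. indicator {u. norm u > t} u \<partial>\<nu>) = ennreal (t powr (- \<alpha>)) * ?T" if "t > 0" for t
  proof -
    have "(\<integral>\<^sup>+u. indicator {u. norm u > t} u \<partial>\<nu>)
        = ennreal (t powr (- \<alpha>)) * (\<integral>\<^sup>+u. indicator {u. norm u > t} (t *\<^sub>R u) \<partial>\<nu>)"
      by (rule nn_integral_nu_scale[OF that]) measurable
    also have "(\<lambda>u::'a. indicator {u. norm u > t} (t *\<^sub>R u) :: ennreal) = indicator {u. norm u > 1}"
      using that by (auto simp: indicator_def fun_eq_iff)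
    finally show ?thesis by simp
  qed
  have layer: "ennreal (min 1 (norm u)) = (\<integral>\<^sup>+t. indicator {0<..<1} t * indicator {u. norm u > t} u \<partial>lborel)"
    for u :: 'a
  proof -
    have "indicator {0<..<1} t * indicator {u. norm u > t} u = (indicator {0<..<min 1 (norm u)} t :: ennreal)" for t
      by (auto simp: indicator_def)
    then show ?thesis by simp
  qed
  have "(\<integral>\<^sup>+u. ennreal (norm (min 1 (norm u))) \<partial>\<nu>)
      = (\<integral>\<^sup>+u. (\<integral>\<^sup>+t. indicator {0<..<1} t * indicator {u. norm u > t} u \<partial>lborel) \<partial>\<nu>)"
    by (intro nn_integral_cong) (simp add: layer abs_of_nonneg)
  also have "\<dots> = (\<integral>\<^sup>+t. (\<integral>\<^sup>+u. indicator {0<..<1} t * indicator {u. norm u > t} u \<partial>\<nu>) \<partial>lborel)"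
    by (rule L.Fubini') measurable
  also have "\<dots> = (\<integral>\<^sup>+t. (ennreal (t powr (- \<alpha>)) * indicator {0<..<1} t) * ?T \<partial>lborel)"
    using tail by (intro nn_integral_cong) (auto simp: nn_integral_cmult indicator_def)
  \<comment> \<open>The integral of t^(-\<alpha>) over (0, 1) is 1 / (1 - \<alpha>); its convergence
    is where \<alpha> < 1 enters.\<close>
  also have "\<dots> = ennreal (1 / (1 - \<alpha>)) * ?T"
    using nn_integral_powr_Ioo[of "- \<alpha>" 1] \<alpha> by (subst nn_integral_multc) simp_all
  also have "\<dots> < \<infinity>"
    unfolding infinity_ennreal_def ennreal_mult_less_top
    using emeasure_nu_large_finite[of 1] by simp
  finally show "(\<integral>\<^sup>+u. ennreal (norm (min 1 (norm u))) \<partial>\<nu>) < \<infinity>" .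
qed simp

text \<open>In the polar form, the part of \<nu> with |u| > 1 and direction in A has mass
  \<sigma>(A) times the integral of r^(-\<alpha>-1) over (1, \<infinity>), that is \<sigma>(A) /
  \<alpha>. This dictates \<sigma>: \<alpha> times the image under the direction map of \<nu>
  restricted to |u| > 1. To verify it, substitute r = s |u| for the radius and rescale u = v / s by
  the scaling of \<nu>; the remaining s-integral cancels the weight.\<close>

lemma nu_eq_polar_stable_measure:
  "\<exists>\<sigma>. sets \<sigma> = sets (restrict_space borel (sphere 0 1)) \<and> finite_measure \<sigma> \<and>
     \<nu> = polar_stable_measure \<alpha> \<sigma>"
proof -
  obtain e :: 'a where e: "norm e = 1"
    using nonempty_Basis norm_Basis by blast
  interpret L: pair_sigma_finite lborel \<nu> ..
  \<comment> \<open>The value \<open>e\<close> at 0 only makes \<open>dir\<close> map into the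
    sphere; the density in \<sigma> excludes 0.\<close>
  define dir where "dir u = (if u = 0 then e else u /\<^sub>R norm u)" for u
  define \<sigma> where "\<sigma> = distr (density \<nu> (\<lambda>u. ennreal \<alpha> * indicator {u. norm u > 1} u))
    (restrict_space borel (sphere 0 1)) dir"
  define w where "w r = ennreal (indicator {0<..} r / r powr (\<alpha> + 1))" for r :: real
  have [measurable]: "w \<in> borel_measurable borel"
    unfolding w_def by measurable
  have dirm: "dir \<in> measurable (density \<nu> (\<lambda>u. ennreal \<alpha> * indicator {u. norm u > 1} u)) (restrict_space borel (sphere 0 1))"
  proof (rule measurable_restrict_space2)
    show "dir \<in> space (density \<nu> (\<lambda>u. ennreal \<alpha> * indicator {u. norm u > 1} u)) \<rightarrow> sphere 0 1"
      by (auto simp: dir_def e)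
    show "dir \<in> borel_measurable (density \<nu> (\<lambda>u. ennreal \<alpha> * indicator {u. norm u > 1} u))"
      unfolding dir_def by measurable
  qed
  have sets: "sets \<sigma> = sets (restrict_space borel (sphere 0 1))"
    by (simp add: \<sigma>_def)
  have "emeasure \<sigma> (space \<sigma>) = (\<integral>\<^sup>+u. ennreal \<alpha> * indicator {u. norm u > 1} u \<partial>\<nu>)"
  proof -
    let ?D = "density \<nu> (\<lambda>u. ennreal \<alpha> * indicator {u. norm u > 1} u)"
    have "emeasure \<sigma> (space \<sigma>) = emeasure ?D (dir -` space \<sigma> \<inter> space ?D)"
      unfolding \<sigma>_def by (rule emeasure_distr[OF dirm]) (simp only: space_distr sets.top)
    also have "dir -` space \<sigma> \<inter> space ?D = space ?D"
      unfolding \<sigma>_def space_distr using measurable_space[OF dirm] by blast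
    finally show ?thesis
      by (simp add: emeasure_density)
  qed
  also have "\<dots> < \<infinity>"
    using emeasure_nu_large_finite[of 1] by (simp add: nn_integral_cmult ennreal_mult_less_top)
  finally have fin: "finite_measure \<sigma>"
    by (intro finite_measureI) (simp add: less_top)
  have "\<nu> = polar_stable_measure \<alpha> \<sigma>"
  proof (rule measure_eqI)
    fix B assume "B \<in> sets \<nu>"
    then have [measurable]: "B \<in> sets borel" by simp
    \<comment> \<open>What remains of the integrand after r = s |u|: the Jacobian |u| combines with
      |u|^(-\<alpha>-1) from the radial density to |u|^(-\<alpha>).\<close>
    define k where "k s u = ennreal (\<alpha> * norm u powr (- \<alpha>)) * (indicator {u. norm u > 1} u * indicator B (s *\<^sub>R u))"
      for s :: real and u :: 'a
    have inner: "(\<integral>\<^sup>+x. indicator B (r *\<^sub>R x) \<partial>\<sigma>)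
        = (\<integral>\<^sup>+u. ennreal \<alpha> * indicator {u. norm u > 1} u * indicator B (r *\<^sub>R (u /\<^sub>R norm u)) \<partial>\<nu>)" for r
    proof -
      have "(\<integral>\<^sup>+x. indicator B (r *\<^sub>R x) \<partial>\<sigma>)
          = (\<integral>\<^sup>+u. indicator B (r *\<^sub>R dir u) \<partial>density \<nu> (\<lambda>u. ennreal \<alpha> * indicator {u. norm u > 1} u))"
        unfolding \<sigma>_def by (rule nn_integral_distr[OF dirm]) (subst measurable_distr_eq1, rule measurable_restrict_space1, measurable)
      also have "\<dots> = (\<integral>\<^sup>+u. ennreal \<alpha> * indicator {u. norm u > 1} u * indicator B (r *\<^sub>R dir u) \<partial>\<nu>)"
        unfolding dir_def by (subst nn_integral_density) auto
      also have "\<dots> = (\<integral>\<^sup>+u. ennreal \<alpha> * indicator {u. norm u > 1} u * indicator B (r *\<^sub>R (u /\<^sub>R norm u)) \<partial>\<nu>)"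
        by (intro nn_integral_cong) (auto simp: dir_def indicator_def)
      finally show ?thesis .
    qed
    have subst: "(\<integral>\<^sup>+r. w r * (ennreal \<alpha> * indicator {u. norm u > 1} u * indicator B (r *\<^sub>R (u /\<^sub>R norm u))) \<partial>lborel)
        = (\<integral>\<^sup>+s. w s * k s u \<partial>lborel)" for u
    proof (cases "norm u > 1")
      case True
      then have nz: "norm u \<noteq> 0" "u \<noteq> 0" by auto
      have "(\<integral>\<^sup>+r. w r * (ennreal \<alpha> * indicator {u. norm u > 1} u * indicator B (r *\<^sub>R (u /\<^sub>R norm u))) \<partial>lborel)
        = ennreal \<bar>norm u\<bar> * (\<integral>\<^sup>+s. w (0 + norm u * s) * (ennreal \<alpha> * indicator {u. norm u > 1} u *
            indicator B ((0 + norm u * s) *\<^sub>R (u /\<^sub>R norm u))) \<partial>lborel)"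
        by (rule nn_integral_real_affine) (use nz in measurable)
      also have "\<dots> = (\<integral>\<^sup>+s. ennreal \<bar>norm u\<bar> * (w (0 + norm u * s) * (ennreal \<alpha> * indicator {u. norm u > 1} u *
            indicator B ((0 + norm u * s) *\<^sub>R (u /\<^sub>R norm u)))) \<partial>lborel)"
        by (rule nn_integral_cmult[symmetric]) measurable
      also have "\<dots> = (\<integral>\<^sup>+s. w s * k s u \<partial>lborel)"
      proof (rule nn_integral_cong)
        fix s :: real
        have "norm u * (indicator {0<..} (norm u * s) / (norm u * s) powr (\<alpha> + 1)) * \<alpha>
            = indicator {0<..} s / s powr (\<alpha> + 1) * (\<alpha> * norm u powr (- \<alpha>))"
        proof (cases "s > 0")
          case True
          with nz show ?thesis
            by (simp add: powr_mult powr_add powr_minus field_simps)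
        qed (use nz in \<open>auto simp: zero_less_mult_iff\<close>)
        then have "ennreal (norm u) * w (norm u * s) * ennreal \<alpha> = w s * ennreal (\<alpha> * norm u powr (- \<alpha>))"
          using \<alpha> by (simp add: w_def ennreal_mult[symmetric])
        moreover have "(norm u * s) *\<^sub>R (u /\<^sub>R norm u) = s *\<^sub>R u"
          using nz by simp
        ultimately show "ennreal \<bar>norm u\<bar> * (w (0 + norm u * s) * (ennreal \<alpha> * indicator {u. norm u > 1} u *
            indicator B ((0 + norm u * s) *\<^sub>R (u /\<^sub>R norm u)))) = w s * k s u"
          by (simp only: k_def add_0 abs_norm_cancel mult.assoc[symmetric])
      qed
      finally show ?thesis .
    qed (simp add: k_def)
    \<comment> \<open>With u = v / s the condition |u| > 1 becomes s < |v|, whence the interval (0,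
      |v|); s^(\<alpha>-1) collects the powers of s from the radial density, the scaling of \<nu>
      and |v / s|^(-\<alpha>).\<close>
    have scale: "w s * (\<integral>\<^sup>+u. k s u \<partial>\<nu>)
        = (\<integral>\<^sup>+v. ennreal (\<alpha> * norm v powr (- \<alpha>)) * indicator B v * (ennreal (s powr (\<alpha> - 1)) * indicator {0<..<norm v} s) \<partial>\<nu>)" for s
    proof (cases "s > 0")
      case True
      have eq: "ennreal (s powr \<alpha>) * ennreal (s powr (- \<alpha>)) = 1"
        using True by (simp add: ennreal_mult[symmetric] flip: powr_add)
      define g where "g v = k s (v /\<^sub>R s)" for v
      have [measurable]: "g \<in> borel_measurable borel"
        unfolding g_def k_def by measurable
      have "(\<integral>\<^sup>+v. g v \<partial>\<nu>) = ennreal (s powr (- \<alpha>)) * (\<integral>\<^sup>+u. k s u \<partial>\<nu>)"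
        using nn_integral_nu_scale[OF True, of g] True by (simp add: g_def)
      then have "(\<integral>\<^sup>+u. k s u \<partial>\<nu>) = ennreal (s powr \<alpha>) * (\<integral>\<^sup>+v. g v \<partial>\<nu>)"
        by (simp add: mult.assoc[symmetric] eq)
      then have "w s * (\<integral>\<^sup>+u. k s u \<partial>\<nu>) = (\<integral>\<^sup>+v. w s * ennreal (s powr \<alpha>) * g v \<partial>\<nu>)"
        by (simp add: nn_integral_cmult mult.assoc)
      also have "\<dots> = (\<integral>\<^sup>+v. ennreal (\<alpha> * norm v powr (- \<alpha>)) * indicator B v * (ennreal (s powr (\<alpha> - 1)) * indicator {0<..<norm v} s) \<partial>\<nu>)"
      proof (rule nn_integral_cong)
        fix v :: 'a
        show "w s * ennreal (s powr \<alpha>) * g v = ennreal (\<alpha> * norm v powr (- \<alpha>)) * indicator B v * (ennreal (s powr (\<alpha> - 1)) * indicator {0<..<norm v} s)"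
        proof (cases "norm v > s")
          case gt: True
          have "1 / s powr (\<alpha> + 1) * s powr \<alpha> * (\<alpha> * (norm v / s) powr (- \<alpha>)) = \<alpha> * norm v powr (- \<alpha>) * s powr (\<alpha> - 1)"
            using True gt by (simp add: powr_divide powr_add powr_minus powr_diff field_simps)
          then have "w s * ennreal (s powr \<alpha>) * ennreal (\<alpha> * (norm v / s) powr (- \<alpha>)) = ennreal (\<alpha> * norm v powr (- \<alpha>)) * ennreal (s powr (\<alpha> - 1))"
            using \<alpha> True by (simp add: w_def ennreal_mult[symmetric])
          moreover have "norm (v /\<^sub>R s) = norm v / s" "1 < norm v / s" "s *\<^sub>R (v /\<^sub>R s) = v"
            using gt True by (simp_all add: field_simps)
          then have "g v = ennreal (\<alpha> * (norm v / s) powr (- \<alpha>)) * indicator B v"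
            by (simp add: g_def k_def)
          moreover have "indicator {0<..<norm v} s = (1::ennreal)"
            using gt True by simp
          ultimately show ?thesis
            by (simp only: mult_1_right mult.assoc[symmetric]) (simp only: ac_simps)
        next
          case False
          then show ?thesis
            using True by (simp add: g_def k_def field_simps)
        qed
      qed
      finally show ?thesis .
    qed (simp add: w_def)
    have "emeasure (polar_stable_measure \<alpha> \<sigma>) B
        = (\<integral>\<^sup>+r. w r * (\<integral>\<^sup>+u. ennreal \<alpha> * indicator {u. norm u > 1} u * indicator B (r *\<^sub>R (u /\<^sub>R norm u)) \<partial>\<nu>) \<partial>lborel)"
      using emeasure_polar_stable_measure[OF sets fin \<open>B \<in> sets borel\<close>, of \<alpha>] by (simp add: w_def inner)
    also have "\<dots> = (\<integral>\<^sup>+r. (\<integral>\<^sup>+u. w r * (ennreal \<alpha> * indicator {u. norm u > 1} u * indicator B (r *\<^sub>R (u /\<^sub>R norm u))) \<partial>\<nu>) \<partial>lborel)"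
      by (intro nn_integral_cong nn_integral_cmult[symmetric]) measurable
    also have "\<dots> = (\<integral>\<^sup>+u. (\<integral>\<^sup>+r. w r * (ennreal \<alpha> * indicator {u. norm u > 1} u * indicator B (r *\<^sub>R (u /\<^sub>R norm u))) \<partial>lborel) \<partial>\<nu>)"
      by (rule L.Fubini'[symmetric]) measurable
    also have "\<dots> = (\<integral>\<^sup>+u. (\<integral>\<^sup>+s. w s * k s u \<partial>lborel) \<partial>\<nu>)"
      by (simp only: subst)
    also have "\<dots> = (\<integral>\<^sup>+s. (\<integral>\<^sup>+u. w s * k s u \<partial>\<nu>) \<partial>lborel)"
      unfolding k_def by (rule L.Fubini') measurable
    also have "\<dots> = (\<integral>\<^sup>+s. w s * (\<integral>\<^sup>+u. k s u \<partial>\<nu>) \<partial>lborel)"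
      unfolding k_def by (intro nn_integral_cong nn_integral_cmult) measurable
    also have "\<dots> = (\<integral>\<^sup>+s. (\<integral>\<^sup>+v. ennreal (\<alpha> * norm v powr (- \<alpha>)) * indicator B v * (ennreal (s powr (\<alpha> - 1)) * indicator {0<..<norm v} s) \<partial>\<nu>) \<partial>lborel)"
      by (simp only: scale)
    also have "\<dots> = (\<integral>\<^sup>+v. (\<integral>\<^sup>+s. ennreal (\<alpha> * norm v powr (- \<alpha>)) * indicator B v * (ennreal (s powr (\<alpha> - 1)) * indicator {0<..<norm v} s) \<partial>lborel) \<partial>\<nu>)"
      by (rule L.Fubini'[symmetric]) (unfold greaterThanLessThan_def greaterThan_def lessThan_def, measurable)
    also have "\<dots> = (\<integral>\<^sup>+v. ennreal (\<alpha> * norm v powr (- \<alpha>)) * indicator B v * ennreal (norm v powr \<alpha> / \<alpha>) \<partial>\<nu>)"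
      using nn_integral_powr_Ioo[of "\<alpha> - 1"] \<alpha> by (simp add: nn_integral_cmult)
    \<comment> \<open>The radial weights cancel except at v = 0, where \<open>0 powr _\<close> is 0;
      that point is \<nu>-null.\<close>
    also have "\<dots> = (\<integral>\<^sup>+v. indicator B v \<partial>\<nu>)"
      using AE_nu_nonzero
    proof (intro nn_integral_cong_AE, eventually_elim)
      fix v :: 'a assume "v \<noteq> 0"
      then have "\<alpha> * norm v powr (- \<alpha>) * (norm v powr \<alpha> / \<alpha>) = 1"
        using \<alpha> by (simp flip: powr_add)
      then have "ennreal (\<alpha> * norm v powr (- \<alpha>)) * ennreal (norm v powr \<alpha> / \<alpha>) = 1"
        using \<alpha> by (simp add: ennreal_mult[symmetric])
      then show "ennreal (\<alpha> * norm v powr (- \<alpha>)) * indicator B v * ennreal (norm v powr \<alpha> / \<alpha>) = indicator B v"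
        by (simp add: indicator_def)
    qed
    also have "\<dots> = emeasure \<nu> B"
      by simp
    finally show "emeasure \<nu> B = emeasure (polar_stable_measure \<alpha> \<sigma>) B" ..
  qed (simp add: polar_stable_measure_def)
  with sets fin show ?thesis by blast
qed

end

section \<open>Schwartz functions\<close>

lemma continuous_on_integral_dominated:
  fixes g :: "'s::metric_space \<Rightarrow> 'b \<Rightarrow> 'c::{banach, second_countable_topology}"
  assumes [measurable]: "\<And>t. g t \<in> borel_measurable M"
    and w: "integrable M w" "\<And>t y. t \<in> S \<Longrightarrow> norm (g t y) \<le> w y"
    and cont: "\<And>y. continuous_on S (\<lambda>t. g t y)"
  shows "continuous_on S (\<lambda>t. \<integral>y. g t y \<partial>M)"
  unfolding continuous_on_sequentially comp_def
proof (intro allI ballI impI)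
  fix x a assume a: "a \<in> S" and x: "(\<forall>n. x n \<in> S) \<and> x \<longlonglongrightarrow> a"
  show "(\<lambda>n. \<integral>y. g (x n) y \<partial>M) \<longlonglongrightarrow> (\<integral>y. g a y \<partial>M)"
  proof (rule integral_dominated_convergence[OF _ _ w(1)])
    show "AE y in M. (\<lambda>n. g (x n) y) \<longlonglongrightarrow> g a y"
      using a x by (intro AE_I2 continuous_on_tendsto_compose[OF cont]) auto
  qed (use w(2) x in auto)
qed

lemma schwartz_differentiable:
  assumes "f \<in> schwartz" "set is \<subseteq> Basis"
  shows "iter_partial is f differentiable (at x)"
  using assms by (auto simp: schwartz_def smooth_def differentiable_on_def)

lemma schwartz_bounded:
  assumes "f \<in> schwartz" "set is \<subseteq> Basis"
  obtains B where "B > 0" "\<And>x. (1 + norm x) ^ k * \<bar>iter_partial is f x\<bar> \<le> B"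
proof -
  have "bounded (range (\<lambda>x. (1 + norm x) ^ k * iter_partial is f x))"
    using assms by (auto simp: schwartz_def)
  then obtain B where "B > 0" "\<And>x. norm ((1 + norm x) ^ k * iter_partial is f x) \<le> B"
    by (auto simp: bounded_pos)
  then show ?thesis
    by (intro that[of B]) (auto simp: abs_mult)
qed

lemma schwartz_continuous_on:
  assumes "f \<in> schwartz"
  shows "continuous_on S f"
  using schwartz_differentiable[OF assms, of "[]"]
  by (auto simp: iter_partial_def intro!: continuous_at_imp_continuous_on differentiable_imp_continuous_within)

lemma schwartz_gradient_continuous_on:
  assumes "f \<in> schwartz"
  shows "continuous_on S (gradient f)"
proof -
  have "continuous_on S (partial_deriv i f)" if "i \<in> Basis" for i
    using schwartz_differentiable[OF assms, of "[i]"] that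
    by (auto simp: iter_partial_def intro!: continuous_at_imp_continuous_on differentiable_imp_continuous_within)
  then show ?thesis
    unfolding gradient_def by (intro continuous_intros)
qed

text \<open>The weight 1 + |x| bounds \<open>x \<bullet> gradient f x\<close>, so the left side of
  the Stein identity is the expectation of a bounded function although X need not have a first
  moment.\<close>

lemma schwartz_gradient_bounded:
  fixes f :: "'a::euclidean_space \<Rightarrow> real"
  assumes "f \<in> schwartz"
  obtains B where "B > 0" "\<And>x. (1 + norm x) * norm (gradient f x) \<le> B"
proof -
  have "\<exists>B>0. \<forall>x. (1 + norm x) * \<bar>partial_deriv i f x\<bar> \<le> B" if i: "i \<in> Basis" for i
  proof -
    obtain B where "B > 0" "\<And>x. (1 + norm x) ^ 1 * \<bar>iter_partial [i] f x\<bar> \<le> B"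
      by (rule schwartz_bounded[OF assms, of "[i]" 1]) (use i in auto)
    then show ?thesis by (auto simp: iter_partial_def)
  qed
  then obtain B where B: "\<And>i. i \<in> Basis \<Longrightarrow> B i > 0"
    "\<And>i x. i \<in> Basis \<Longrightarrow> (1 + norm x) * \<bar>partial_deriv i f x\<bar> \<le> B i"
    by metis
  have "(1 + norm x) * norm (gradient f x) \<le> (\<Sum>i\<in>Basis. B i)" for x
  proof -
    have "norm (gradient f x) \<le> (\<Sum>i\<in>Basis. \<bar>partial_deriv i f x\<bar>)"
      unfolding gradient_def by (rule order_trans[OF norm_sum]) simp
    then have "(1 + norm x) * norm (gradient f x) \<le> (\<Sum>i\<in>Basis. (1 + norm x) * \<bar>partial_deriv i f x\<bar>)"
      by (subst sum_distrib_left[symmetric]) (intro mult_left_mono, auto)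
    also have "\<dots> \<le> (\<Sum>i\<in>Basis. B i)"
      by (intro sum_mono B)
    finally show ?thesis .
  qed
  moreover have "(\<Sum>i\<in>Basis. B i) > 0"
    by (intro sum_pos B) auto
  ultimately show ?thesis using that by blast
qed

lemma schwartz_has_derivative:
  assumes "f \<in> schwartz"
  shows "(f has_derivative (\<lambda>h. h \<bullet> gradient f x)) (at x within S)"
proof -
  have "f differentiable (at x)"
    using schwartz_differentiable[OF assms, of "[]"] by (simp add: iter_partial_def)
  then show ?thesis
    by (auto simp: gderiv_def dest!: GDERIV_gradient intro: has_derivative_at_withinI)
qed

text \<open>Bounds on f and on its gradient combine into the increment format that \<nu> can
  integrate: 2 C serves large distances, the mean value bound B small ones.\<close>

lemma schwartz_diff_le:
  fixes f :: "'a::euclidean_space \<Rightarrow> real"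
  assumes "f \<in> schwartz"
  obtains K where "\<And>x y. \<bar>f x - f y\<bar> \<le> K * min 1 (norm (x - y))"
proof -
  obtain B where B: "B > 0" "\<And>x. (1 + norm x) * norm (gradient f x) \<le> B"
    using schwartz_gradient_bounded[OF assms] by blast
  obtain C where C: "C > 0" "\<And>x. \<bar>f x\<bar> \<le> C"
    using schwartz_bounded[OF assms, of "[]" 0] by (auto simp: iter_partial_def)
  have grad: "norm (gradient f x) \<le> B" for x
  proof -
    have "1 * norm (gradient f x) \<le> (1 + norm x) * norm (gradient f x)"
      by (intro mult_right_mono) auto
    with B(2)[of x] show ?thesis by simp
  qed
  have "\<bar>f x - f y\<bar> \<le> (2 * C + B) * min 1 (norm (x - y))" for x y
  proof -
    have "norm (f x - f y) \<le> B * norm (x - y)"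
    proof (rule differentiable_bound[of UNIV])
      show "(f has_derivative (\<lambda>h. h \<bullet> gradient f z)) (at z within UNIV)" for z
        by (rule schwartz_has_derivative[OF assms])
      show "onorm (\<lambda>h. h \<bullet> gradient f z) \<le> B" for z
      proof (rule onorm_le)
        show "norm (h \<bullet> gradient f z) \<le> B * norm h" for h
          using Cauchy_Schwarz_ineq2[of h "gradient f z"] mult_left_mono[OF grad[of z] norm_ge_zero[of h]]
          by (simp add: mult.commute)
      qed
    qed auto
    moreover have "B * norm (x - y) \<le> (2 * C + B) * norm (x - y)"
      using C by (intro mult_right_mono) auto
    moreover have "\<bar>f x - f y\<bar> \<le> (2 * C + B) * 1"
      using C(2)[of x] C(2)[of y] B by simp
    ultimately show ?thesis
      by (simp only: min_def real_norm_def split: if_split) auto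
  qed
  then show ?thesis by (rule that)
qed

lemma integrable_lborel_inverse_prod:
  "integrable lborel (\<lambda>x::'a::euclidean_space. \<Prod>b\<in>Basis. inverse (1 + (x \<bullet> b)\<^sup>2))"
proof (rule integrable_lborel_prod)
  show "integrable lborel (\<lambda>t::real. inverse (1 + t\<^sup>2))"
    using integrable_inverse_1_plus_square by (simp add: einterval_eq_UNIV set_integrable_def)
qed

text \<open>Decay of order \<open>2 * DIM('a)\<close> suffices, because (1 + |x|)^2 dominates 1 + (x
  \<bullet> b)^2 for each coordinate and the product of the reciprocals of the latter is
  integrable.\<close>

lemma schwartz_integrable:
  fixes f :: "'a::euclidean_space \<Rightarrow> real"
  assumes "f \<in> schwartz"
  shows "integrable lborel f"
proof -
  obtain B where B: "\<And>x. (1 + norm x) ^ (2 * DIM('a)) * \<bar>f x\<bar> \<le> B"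
    using schwartz_bounded[OF assms, of "[]" "2 * DIM('a)"] by (auto simp: iter_partial_def)
  have "\<bar>f x\<bar> \<le> B * (\<Prod>b\<in>Basis. inverse (1 + (x \<bullet> b)\<^sup>2))" for x
  proof -
    have "(\<Prod>b\<in>(Basis::'a set). 1 + (x \<bullet> b)\<^sup>2) \<le> (\<Prod>b\<in>(Basis::'a set). (1 + norm x)\<^sup>2)"
    proof (intro prod_mono conjI)
      fix b :: 'a assume "b \<in> Basis"
      then have "(x \<bullet> b)\<^sup>2 \<le> (norm x)\<^sup>2"
        using Basis_le_norm[of b x] power_mono[of "\<bar>x \<bullet> b\<bar>" "norm x" 2] by simp
      then show "1 + (x \<bullet> b)\<^sup>2 \<le> (1 + norm x)\<^sup>2"
        using norm_ge_zero[of x] unfolding power2_sum by (simp add: add_increasing2)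
    qed auto
    also have "\<dots> = (1 + norm x) ^ (2 * DIM('a))"
      by (simp add: power_mult)
    finally have "(\<Prod>b\<in>(Basis::'a set). 1 + (x \<bullet> b)\<^sup>2) * \<bar>f x\<bar> \<le> B"
      using mult_right_mono[of _ _ "\<bar>f x\<bar>"] B[of x] by (meson abs_ge_zero order_trans)
    moreover have pos: "(\<Prod>b\<in>(Basis::'a set). 1 + (x \<bullet> b)\<^sup>2) > 0"
      by (intro prod_pos) (simp add: add_pos_nonneg)
    moreover have "(\<Prod>b\<in>(Basis::'a set). inverse (1 + (x \<bullet> b)\<^sup>2)) = inverse (\<Prod>b\<in>(Basis::'a set). 1 + (x \<bullet> b)\<^sup>2)"
      by (simp add: prod_inversef[unfolded comp_def])
    ultimately show ?thesis
      by (simp only:) (simp add: field_simps)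
  qed
  then show ?thesis
    using schwartz_continuous_on[OF assms]
    by (intro Bochner_Integration.integrable_bound[OF integrable_mult_right[OF integrable_lborel_inverse_prod, of B]])
      (auto intro!: borel_measurable_continuous_onI AE_I2 order_trans[OF _ abs_ge_self] simp: measurable_lborel1)
qed

section \<open>Translation invariance of the Schwartz space\<close>

text \<open>\<open>frechet_derivative\<close> chooses among the possible derivatives. Both sides
  choose by equivalent predicates, so they agree even at points of non-differentiability.\<close>

lemma partial_deriv_translate:
  "partial_deriv i (\<lambda>x. f (x + a)) x = partial_deriv i f (x + a)"
proof -
  have "((\<lambda>x. f (x + a)) has_derivative D) (at x) \<longleftrightarrow> (f has_derivative D) (at (x + a))" for D
  proof
    assume "((\<lambda>x. f (x + a)) has_derivative D) (at x)"
    then have "((\<lambda>x. f (x + a)) has_derivative D) (at ((x + a) - a))" by simp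
    moreover have "((\<lambda>y. y - a) has_derivative (\<lambda>h. h)) (at (x + a))"
      by (auto intro!: derivative_eq_intros)
    ultimately show "(f has_derivative D) (at (x + a))"
      using has_derivative_compose[of "\<lambda>y. y - a" "\<lambda>h. h" "x + a" UNIV "\<lambda>x. f (x + a)" D] by simp
  next
    assume "(f has_derivative D) (at (x + a))"
    moreover have "((\<lambda>y. y + a) has_derivative (\<lambda>h. h)) (at x)"
      by (auto intro!: derivative_eq_intros)
    ultimately show "((\<lambda>x. f (x + a)) has_derivative D) (at x)"
      using has_derivative_compose[of "\<lambda>y. y + a" "\<lambda>h. h" x UNIV f D] by simp
  qed
  then show ?thesis
    by (simp add: partial_deriv_def frechet_derivative_def)
qed

lemma iter_partial_translate:
  "iter_partial is (\<lambda>x. f (x + a)) = (\<lambda>x. iter_partial is f (x + a))"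
proof (induction "is")
  case (Cons i "is")
  then show ?case
    using partial_deriv_translate[of i "iter_partial is f" a] by (auto simp: iter_partial_def)
qed (simp add: iter_partial_def)

lemma gradient_translate: "gradient (\<lambda>x. f (x + a)) x = gradient f (x + a)"
  by (simp add: gradient_def partial_deriv_translate)

lemma schwartz_translate:
  fixes f :: "'a::euclidean_space \<Rightarrow> real"
  assumes "f \<in> schwartz"
  shows "(\<lambda>x. f (x + a)) \<in> schwartz"
  unfolding schwartz_def smooth_def mem_Collect_eq iter_partial_translate
proof (intro conjI allI impI)
  fix "is" :: "'a list" and k assume basis: "set is \<subseteq> Basis"
  have "iter_partial is f differentiable at (x + a)" for x
    by (rule schwartz_differentiable[OF assms basis])
  then show "(\<lambda>x. iter_partial is f (x + a)) differentiable_on UNIV"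
    unfolding differentiable_on_def
    by (auto intro!: differentiable_compose[of "iter_partial is f" "\<lambda>x. x + a"])
  obtain B where B: "\<And>x. (1 + norm x) ^ k * \<bar>iter_partial is f x\<bar> \<le> B"
    using schwartz_bounded[OF assms basis] by metis
  have "norm ((1 + norm x) ^ k * iter_partial is f (x + a)) \<le> (1 + norm a) ^ k * B" for x
  proof -
    \<comment> \<open>Submultiplicativity of the weight 1 + |x|: a translation changes each power of
      it by at most a constant factor.\<close>
    have "1 + norm x \<le> (1 + norm a) * (1 + norm (x + a))"
    proof -
      have "norm x \<le> norm (x + a) + norm a"
        using norm_triangle_ineq4[of "x + a" a] by simp
      moreover have "0 \<le> norm a * norm (x + a)"
        by simp
      ultimately show ?thesis
        unfolding distrib_left distrib_right by linarith
    qed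
    then have "(1 + norm x) ^ k \<le> (1 + norm a) ^ k * (1 + norm (x + a)) ^ k"
      unfolding power_mult_distrib[symmetric] by (intro power_mono) auto
    then have "(1 + norm x) ^ k * \<bar>iter_partial is f (x + a)\<bar>
        \<le> (1 + norm a) ^ k * ((1 + norm (x + a)) ^ k * \<bar>iter_partial is f (x + a)\<bar>)"
      unfolding mult.assoc[symmetric] by (intro mult_right_mono) auto
    also have "\<dots> \<le> (1 + norm a) ^ k * B"
      by (intro mult_left_mono B) auto
    finally show ?thesis by (simp add: abs_mult)
  qed
  then show "bounded (range (\<lambda>x. (1 + norm x) ^ k * iter_partial is f (x + a)))"
    by (auto simp: bounded_iff)
qed

section \<open>The Stein identity from the characteristic function\<close>

lemma schwartz_ray_has_real_derivative:
  assumes "f \<in> schwartz"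
  shows "((\<lambda>t. f (t *\<^sub>R y)) has_real_derivative y \<bullet> gradient f (t *\<^sub>R y)) (at t within S)"
proof -
  have "((\<lambda>t::real. t *\<^sub>R y) has_derivative (\<lambda>h. h *\<^sub>R y)) (at t within S)"
    by (auto intro!: derivative_eq_intros)
  from has_derivative_compose[OF this schwartz_has_derivative[OF assms]]
  have "((\<lambda>t. f (t *\<^sub>R y)) has_derivative (\<lambda>h. (h *\<^sub>R y) \<bullet> gradient f (t *\<^sub>R y))) (at t within S)" .
  moreover have "(\<lambda>h. (h *\<^sub>R y) \<bullet> gradient f (t *\<^sub>R y)) = (*) (y \<bullet> gradient f (t *\<^sub>R y))"
    by (simp add: fun_eq_iff mult.commute)
  ultimately show ?thesis
    by (simp only: has_field_derivative_def)
qed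

context stable_levy
begin

definition eta :: "'a \<Rightarrow> complex" where
  "eta \<xi> = (CLINT u|\<nu>. iexp (\<xi> \<bullet> u) - 1)"

lemma eta_scale: "t > 0 \<Longrightarrow> eta (t *\<^sub>R \<xi>) = of_real (t powr \<alpha>) * eta \<xi>"
  using integral_nu_scale[of t "\<lambda>u. iexp (\<xi> \<bullet> u) - 1"]
  by (simp add: eta_def scaleR_conv_of_real)

text \<open>The second bound is uniform in x, so the inner \<nu>-integral is a bounded function of x
  and can be integrated against any probability law.\<close>

lemma integrable_increment:
  fixes h :: "'a \<Rightarrow> 'c::{banach, second_countable_topology}"
  assumes [measurable]: "h \<in> borel_measurable borel"
    and h: "\<And>x y. norm (h x - h y) \<le> K * min 1 (norm (x - y))"
  shows "integrable \<nu> (\<lambda>u. h (x + u) - h x)"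
    and "norm (\<integral>u. h (x + u) - h x \<partial>\<nu>) \<le> K * (\<integral>u. min 1 (norm u) \<partial>\<nu>)"
proof -
  have le: "norm (h (x + u) - h x) \<le> K * min 1 (norm u)" for u
    using h[of "x + u" x] by simp
  show int: "integrable \<nu> (\<lambda>u. h (x + u) - h x)"
    by (rule Bochner_Integration.integrable_bound[OF integrable_mult_right[OF integrable_min_norm, of K]])
      (auto intro!: AE_I2 order_trans[OF le])
  have "norm (\<integral>u. h (x + u) - h x \<partial>\<nu>) \<le> (\<integral>u. K * min 1 (norm u) \<partial>\<nu>)"
    by (rule order_trans[OF integral_norm_bound])
      (intro integral_mono integrable_norm int integrable_mult_right integrable_min_norm le)
  then show "norm (\<integral>u. h (x + u) - h x \<partial>\<nu>) \<le> K * (\<integral>u. min 1 (norm u) \<partial>\<nu>)"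
    by simp
qed

lemma continuous_on_increment:
  fixes h :: "'a \<Rightarrow> 'c::{banach, second_countable_topology}"
  assumes cont: "continuous_on UNIV h"
    and h: "\<And>x y. norm (h x - h y) \<le> K * min 1 (norm (x - y))"
  shows "continuous_on S (\<lambda>x. \<integral>u. h (x + u) - h x \<partial>\<nu>)"
proof (rule continuous_on_integral_dominated)
  have [measurable]: "h \<in> borel_measurable borel"
    using cont by (rule borel_measurable_continuous_onI)
  show "(\<lambda>u. h (x + u) - h x) \<in> borel_measurable \<nu>" for x by measurable
  show "integrable \<nu> (\<lambda>u. K * min 1 (norm u))"
    by (intro integrable_mult_right integrable_min_norm)
  show "norm (h (x + u) - h x) \<le> K * min 1 (norm u)" for x u
    using h[of "x + u" x] by simp
  show "continuous_on S (\<lambda>x. h (x + u) - h x)" for u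
    by (intro continuous_intros continuous_on_compose2[OF cont]) auto
qed

text \<open>Scaling gives \<open>\<phi>(c\<xi>) - \<phi>(\<xi>) = \<integral>\<^sub>1\<^sup>c \<alpha> t\<^bsup>\<alpha>-1\<^esup> \<eta>(\<xi>) \<phi>(t\<xi>) dt\<close>; both sides are integrals of
  increments of \<open>x \<mapsto> e\<^bsup>i\<langle>\<xi>,x\<rangle>\<^esup>\<close>, so the identity transfers from exponentials to \<open>f\<close>.\<close>

lemma dilation_increment:
  assumes \<mu>: "prob_space \<mu>" and sets_\<mu>: "sets \<mu> = sets borel"
    and char: "\<And>\<xi>. (CLINT y|\<mu>. iexp (\<xi> \<bullet> y)) = exp (eta \<xi>)"
    and c: "1 \<le> c"
    and f: "integrable lborel f" "continuous_on UNIV f" "\<And>x y. \<bar>f x - f y\<bar> \<le> K * min 1 (norm (x - y))"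
  shows "(\<integral>y. f (c *\<^sub>R y) - f y \<partial>\<mu>) =
    (LINT t|lborel. indicator {1..c} t *\<^sub>R (\<alpha> * t powr (\<alpha> - 1) *
        (\<integral>y. (\<integral>u. f (t *\<^sub>R y + u) - f (t *\<^sub>R y) \<partial>\<nu>) \<partial>\<mu>)))"
proof -
  interpret \<mu>: prob_space \<mu> by fact
  note [measurable_cong] = sets_\<mu>
  have [measurable]: "f \<in> borel_measurable borel"
    using f(2) by (rule borel_measurable_continuous_onI)
  define g where "g t = indicator {1..c} t * (\<alpha> * t powr (\<alpha> - 1))" for t :: real
  have [measurable]: "g \<in> borel_measurable borel"
    unfolding g_def by measurable
  have g_nonneg: "0 \<le> g t" for t
    using \<alpha> by (simp add: g_def)
  have g_int: "integrable lborel g"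
  proof -
    have "integrable lborel (\<lambda>t. indicator {1..c} t *\<^sub>R (\<alpha> * t powr (\<alpha> - 1)))"
      by (intro borel_integrable_compact continuous_intros) auto
    then show ?thesis by (simp add: g_def[abs_def])
  qed
  \<comment> \<open>Absorbing the weight into a finite measure presents the right-hand side as one
    integral of increments over \<open>?m\<close>, the form required by
    \<open>integral_diff_eq_if_iexp_eq\<close>.\<close>
  define T where "T = density lborel (\<lambda>t. ennreal (g t))"
  have [measurable_cong]: "sets T = sets borel"
    by (simp add: T_def)
  interpret T: finite_measure T
  proof (rule finite_measureI)
    show "emeasure T (space T) \<noteq> \<infinity>"
      using g_int g_nonneg by (simp add: T_def emeasure_density integrable_iff_bounded less_top)
  qed
  have T_integral: "(\<integral>t. k t \<partial>T) = (\<integral>t. g t *\<^sub>R k t \<partial>lborel)"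
    if "k \<in> borel_measurable borel" for k :: "real \<Rightarrow> 'd::{banach, second_countable_topology}"
    unfolding T_def using that g_nonneg by (intro integral_density) auto
  interpret \<mu>\<nu>: pair_sigma_finite \<mu> \<nu> ..
  interpret TM: pair_sigma_finite T "\<mu> \<Otimes>\<^sub>M \<nu>"
    by (intro pair_sigma_finite.intro T.sigma_finite_measure_axioms \<mu>\<nu>.P.sigma_finite_measure_axioms)
  let ?m = "T \<Otimes>\<^sub>M (\<mu> \<Otimes>\<^sub>M \<nu>)"
  let ?A = "\<lambda>(t, y, u). t *\<^sub>R y + u :: 'a" and ?B = "\<lambda>(t, y, u). t *\<^sub>R y :: 'a"
  have min_int: "integrable ?m (\<lambda>p. min 1 (norm (snd (snd p))))"
  proof -
    have "integrable (\<mu> \<Otimes>\<^sub>M \<nu>) (\<lambda>p. 1 * min 1 (norm (snd p)))"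
      by (rule integrable_pair_mult) (auto intro: \<mu>.sigma_finite_measure_axioms sigma_finite_measure_axioms integrable_min_norm)
    then have "integrable ?m (\<lambda>p. 1 * min 1 (norm (snd (snd p))))"
      using integrable_pair_mult[of T "\<mu> \<Otimes>\<^sub>M \<nu>" "\<lambda>_. 1" "\<lambda>p. min 1 (norm (snd p))"]
        T.sigma_finite_measure_axioms \<mu>\<nu>.P.sigma_finite_measure_axioms by simp
    then show ?thesis by simp
  qed
  have iterate: "(\<integral>p. h (?A p) - h (?B p) \<partial>?m) =
      (\<integral>t. g t *\<^sub>R (\<integral>y. (\<integral>u. h (t *\<^sub>R y + u) - h (t *\<^sub>R y) \<partial>\<nu>) \<partial>\<mu>) \<partial>lborel)"
    if [measurable]: "h \<in> borel_measurable borel"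
      and h: "\<And>x y. norm (h x - h y) \<le> K * min 1 (norm (x - y))"
    for h :: "'a \<Rightarrow> 'd::{banach, second_countable_topology}" and K
  proof -
    have bound: "norm (h (t *\<^sub>R y + u) - h (t *\<^sub>R y)) \<le> K * min 1 (norm u)" for t y u
      using h[of "t *\<^sub>R y + u" "t *\<^sub>R y"] by simp
    have "integrable ?m (\<lambda>p. K * min 1 (norm (snd (snd p))))"
      using min_int by simp
    then have int: "integrable ?m (\<lambda>p. h (?A p) - h (?B p))"
      by (rule Bochner_Integration.integrable_bound)
        (auto intro!: AE_I2 order_trans[OF bound] simp: case_prod_beta)
    have int2: "integrable (\<mu> \<Otimes>\<^sub>M \<nu>) (\<lambda>p. h (t *\<^sub>R fst p + snd p) - h (t *\<^sub>R fst p))" for t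
    proof (rule Bochner_Integration.integrable_bound)
      show "integrable (\<mu> \<Otimes>\<^sub>M \<nu>) (\<lambda>p. K * (1 * min 1 (norm (snd p))))"
        by (intro integrable_mult_right integrable_pair_mult)
          (auto intro: \<mu>.sigma_finite_measure_axioms sigma_finite_measure_axioms integrable_min_norm)
    qed (auto intro!: AE_I2 order_trans[OF bound])
    have "(\<integral>p. h (?A p) - h (?B p) \<partial>?m) = (\<integral>t. (\<integral>q. h (?A (t, q)) - h (?B (t, q)) \<partial>(\<mu> \<Otimes>\<^sub>M \<nu>)) \<partial>T)"
      using TM.integral_fst'[OF int] by simp
    also have "\<dots> = (\<integral>t. (\<integral>y. (\<integral>u. h (t *\<^sub>R y + u) - h (t *\<^sub>R y) \<partial>\<nu>) \<partial>\<mu>) \<partial>T)"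
      using \<mu>\<nu>.integral_fst'[OF int2] by (simp add: case_prod_beta)
    also have "\<dots> = (\<integral>t. g t *\<^sub>R (\<integral>y. (\<integral>u. h (t *\<^sub>R y + u) - h (t *\<^sub>R y) \<partial>\<nu>) \<partial>\<mu>) \<partial>lborel)"
      by (rule T_integral) measurable
    finally show ?thesis .
  qed
  have char_int: "integrable \<mu> (\<lambda>y. iexp (\<xi> \<bullet> y))" for \<xi>
    by (rule \<mu>.integrable_const_bound[where B = 1]) simp_all
  have eq: "(CLINT y|\<mu>. iexp (\<xi> \<bullet> (c *\<^sub>R y)) - iexp (\<xi> \<bullet> y))
      = (CLINT p|?m. iexp (\<xi> \<bullet> ?A p) - iexp (\<xi> \<bullet> ?B p))" for \<xi>
  proof -
    have "(CLINT p|?m. iexp (\<xi> \<bullet> ?A p) - iexp (\<xi> \<bullet> ?B p))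
        = (CLINT t|lborel. g t *\<^sub>R (CLINT y|\<mu>. CLINT u|\<nu>. iexp (\<xi> \<bullet> (t *\<^sub>R y + u)) - iexp (\<xi> \<bullet> (t *\<^sub>R y))))"
      by (rule iterate[OF _ norm_iexp_inner_diff_le]) measurable
    also have "\<dots> = (CLINT t|lborel. indicator {1..c} t *\<^sub>R (of_real (\<alpha> * t powr (\<alpha> - 1)) * eta \<xi> * exp (of_real (t powr \<alpha>) * eta \<xi>)))"
    proof (intro Bochner_Integration.integral_cong refl)
      fix t :: real
      show "g t *\<^sub>R (CLINT y|\<mu>. CLINT u|\<nu>. iexp (\<xi> \<bullet> (t *\<^sub>R y + u)) - iexp (\<xi> \<bullet> (t *\<^sub>R y)))
        = indicator {1..c} t *\<^sub>R (of_real (\<alpha> * t powr (\<alpha> - 1)) * eta \<xi> * exp (of_real (t powr \<alpha>) * eta \<xi>))"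
      proof (cases "t \<in> {1..c}")
        case True
        have "(CLINT u|\<nu>. iexp (\<xi> \<bullet> (t *\<^sub>R y + u)) - iexp (\<xi> \<bullet> (t *\<^sub>R y))) = eta \<xi> * iexp ((t *\<^sub>R \<xi>) \<bullet> y)" for y
        proof -
          have "iexp (\<xi> \<bullet> (t *\<^sub>R y + u)) - iexp (\<xi> \<bullet> (t *\<^sub>R y)) = (iexp (\<xi> \<bullet> u) - 1) * iexp ((t *\<^sub>R \<xi>) \<bullet> y)" for u
            by (simp add: inner_add_right distrib_left exp_add algebra_simps)
          then show ?thesis
            by (simp only: eta_def integral_mult_left_zero)
        qed
        then have "(CLINT y|\<mu>. CLINT u|\<nu>. iexp (\<xi> \<bullet> (t *\<^sub>R y + u)) - iexp (\<xi> \<bullet> (t *\<^sub>R y))) = eta \<xi> * exp (eta (t *\<^sub>R \<xi>))"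
          by (simp only: integral_mult_right_zero char)
        then show ?thesis
          using True by (simp add: g_def eta_scale scaleR_conv_of_real)
      qed (simp add: g_def)
    qed
    \<comment> \<open>The integrand is the derivative of exp(t^\<alpha> \<eta>(\<xi>)), which equals
      the characteristic function at t \<xi> by scaling.\<close>
    also have "\<dots> = exp (of_real (c powr \<alpha>) * eta \<xi>) - exp (of_real (1 powr \<alpha>) * eta \<xi>)"
    proof (rule integral_FTC_Icc[OF c])
      fix t :: real assume "1 \<le> t" "t \<le> c"
      then have "((\<lambda>t. t powr \<alpha>) has_real_derivative \<alpha> * t powr (\<alpha> - 1)) (at t within {1..c})"
        by (auto intro!: derivative_eq_intros)
      then have "((\<lambda>t. of_real (t powr \<alpha>) :: complex) has_vector_derivative of_real (\<alpha> * t powr (\<alpha> - 1))) (at t within {1..c})"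
        by (simp only: has_real_derivative_iff_has_vector_derivative has_vector_derivative_of_real)
      then have "((\<lambda>t. of_real (t powr \<alpha>) * eta \<xi>) has_vector_derivative of_real (\<alpha> * t powr (\<alpha> - 1)) * eta \<xi>) (at t within {1..c})"
        by (rule has_vector_derivative_mult_left)
      from field_vector_diff_chain_within[OF this, of exp "exp (of_real (t powr \<alpha>) * eta \<xi>)"]
      show "((\<lambda>t. exp (of_real (t powr \<alpha>) * eta \<xi>)) has_vector_derivative
          of_real (\<alpha> * t powr (\<alpha> - 1)) * eta \<xi> * exp (of_real (t powr \<alpha>) * eta \<xi>)) (at t within {1..c})"
        by (simp add: comp_def has_field_derivative_at_within[OF DERIV_exp])
    next
      show "continuous_on {1..c} (\<lambda>t. of_real (\<alpha> * t powr (\<alpha> - 1)) * eta \<xi> * exp (of_real (t powr \<alpha>) * eta \<xi>))"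
        by (intro continuous_intros) auto
    qed
    also have "\<dots> = exp (eta (c *\<^sub>R \<xi>)) - exp (eta \<xi>)"
      using c by (simp add: eta_scale)
    also have "\<dots> = (CLINT y|\<mu>. iexp ((c *\<^sub>R \<xi>) \<bullet> y) - iexp (\<xi> \<bullet> y))"
      by (simp only: Bochner_Integration.integral_diff[OF char_int char_int] char)
    finally show ?thesis by simp
  qed
  \<comment> \<open>The transfer links two different spaces: dilations under \<mu> on one side,
    jumps under \<open>?m\<close> on the other.\<close>
  have "(\<integral>y. f (c *\<^sub>R y) - f y \<partial>\<mu>) = (\<integral>p. f (?A p) - f (?B p) \<partial>?m)"
  proof (rule integral_diff_eq_if_iexp_eq[OF \<mu>.sigma_finite_measure_axioms TM.P.sigma_finite_measure_axioms
        _ _ _ _ _ _ eq f(1,3)])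
    show "integrable \<mu> (\<lambda>y. min 1 (norm (c *\<^sub>R y - y)))"
      by (rule \<mu>.integrable_const_bound[where B = 1]) simp_all
    show "integrable ?m (\<lambda>p. min 1 (norm (?A p - ?B p)))"
      using min_int by (simp add: case_prod_beta)
  qed measurable
  also have "\<dots> = (\<integral>t. g t *\<^sub>R (\<integral>y. (\<integral>u. f (t *\<^sub>R y + u) - f (t *\<^sub>R y) \<partial>\<nu>) \<partial>\<mu>) \<partial>lborel)"
    by (rule iterate) (use f(3) in auto)
  finally show ?thesis
    by (simp add: g_def mult.assoc)
qed

text \<open>The dilation identity is divided by c - 1 and c decreases to 1. On the right this
  differentiates an integral with continuous integrand; on the left the limit passes under \<mu>
  because difference quotients of a Schwartz function along rays are bounded.\<close>

lemma stein_identity_if_char: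
  assumes \<mu>: "prob_space \<mu>" and sets_\<mu>: "sets \<mu> = sets borel"
    and char: "\<And>\<xi>. (CLINT y|\<mu>. iexp (\<xi> \<bullet> y)) = exp (eta \<xi>)"
    and f: "f \<in> schwartz"
  shows "(\<integral>y. y \<bullet> gradient f y \<partial>\<mu>) = \<alpha> * (\<integral>y. (\<integral>u. f (y + u) - f y \<partial>\<nu>) \<partial>\<mu>)"
proof -
  interpret \<mu>: prob_space \<mu> by fact
  note [measurable_cong] = sets_\<mu>
  obtain K where K: "\<And>x y. \<bar>f x - f y\<bar> \<le> K * min 1 (norm (x - y))"
    using schwartz_diff_le[OF f] by blast
  obtain B where B: "B > 0" "\<And>x. (1 + norm x) * norm (gradient f x) \<le> B"
    using schwartz_gradient_bounded[OF f] by blast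
  have fc: "continuous_on UNIV f"
    by (rule schwartz_continuous_on[OF f])
  have [measurable]: "f \<in> borel_measurable borel" "gradient f \<in> borel_measurable borel"
    using fc schwartz_gradient_continuous_on[OF f] by (auto intro: borel_measurable_continuous_onI)
  define G where "G x = (\<integral>u. f (x + u) - f x \<partial>\<nu>)" for x
  have Gc: "continuous_on UNIV G"
    unfolding G_def by (rule continuous_on_increment[OF fc]) (use K in simp)
  have [measurable]: "G \<in> borel_measurable borel"
    using Gc by (rule borel_measurable_continuous_onI)
  have Gb: "norm (G x) \<le> K * (\<integral>u. min 1 (norm u) \<partial>\<nu>)" for x
    unfolding G_def by (rule integrable_increment(2)) (use K in auto)
  define g where "g t = \<alpha> * t powr (\<alpha> - 1) * (\<integral>y. G (t *\<^sub>R y) \<partial>\<mu>)" for t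
  have gc: "continuous_on {1..2} g"
    unfolding g_def
  proof (intro continuous_intros continuous_on_integral_dominated)
    show "norm (G (t *\<^sub>R y)) \<le> K * (\<integral>u. min 1 (norm u) \<partial>\<nu>)" for t y
      by (rule Gb)
    show "continuous_on {1..2} (\<lambda>t. G (t *\<^sub>R y))" for y
      by (intro continuous_intros continuous_on_compose2[OF Gc]) auto
  qed auto
  have \<Phi>: "(\<integral>y. f (c *\<^sub>R y) - f y \<partial>\<mu>) = integral {1..c} g" if "c \<in> {1..2}" for c
  proof -
    have "set_integrable lborel {1..c} g"
      unfolding set_integrable_def
      by (intro borel_integrable_compact continuous_on_subset[OF gc]) (use that in auto)
    from set_borel_integral_eq_integral(2)[OF this] show ?thesis
      using dilation_increment[OF \<mu> sets_\<mu> char _ schwartz_integrable[OF f] fc K, of c] that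
      by (simp add: set_lebesgue_integral_def g_def G_def)
  qed
  define c where "c n = 1 + inverse (real (Suc n))" for n
  have c: "c n \<in> {1..2}" "c n > 1" for n
    by (auto simp: c_def field_simps)
  have c_lim: "c \<longlonglongrightarrow> 1"
    unfolding c_def using tendsto_add[OF tendsto_const[of 1] LIMSEQ_inverse_real_of_nat] by simp
  then have c_filter: "filterlim c (at 1 within {1..2}) sequentially"
    using c by (auto simp: filterlim_at less_imp_neq[symmetric] intro!: always_eventually)
  have "((\<lambda>c. integral {1..c} g) has_real_derivative g 1) (at 1 within {1..2})"
    by (rule integral_has_real_derivative[OF gc]) simp
  then have "((\<lambda>c. (integral {1..c} g - integral {1..1} g) / (c - 1)) \<longlongrightarrow> g 1) (at 1 within {1..2})"
    by (simp add: has_field_derivative_iff)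
  from filterlim_compose[OF this c_filter]
  have lim1: "(\<lambda>n. (\<integral>y. (f (c n *\<^sub>R y) - f y) / (c n - 1) \<partial>\<mu>)) \<longlonglongrightarrow> g 1"
    using \<Phi>[OF c(1)] by simp
  have lim2: "(\<lambda>n. (\<integral>y. (f (c n *\<^sub>R y) - f y) / (c n - 1) \<partial>\<mu>)) \<longlonglongrightarrow> (\<integral>y. y \<bullet> gradient f y \<partial>\<mu>)"
  proof (rule integral_dominated_convergence[where w = "\<lambda>_. B"])
    show "AE y in \<mu>. (\<lambda>n. (f (c n *\<^sub>R y) - f y) / (c n - 1)) \<longlonglongrightarrow> y \<bullet> gradient f y"
    proof (intro AE_I2)
      fix y
      have "((\<lambda>t. (f (t *\<^sub>R y) - f (1 *\<^sub>R y)) / (t - 1)) \<longlongrightarrow> y \<bullet> gradient f (1 *\<^sub>R y)) (at 1 within {1..2})"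
        using schwartz_ray_has_real_derivative[OF f, of y 1 "{1..2}"] by (simp add: has_field_derivative_iff)
      from filterlim_compose[OF this c_filter]
      show "(\<lambda>n. (f (c n *\<^sub>R y) - f y) / (c n - 1)) \<longlonglongrightarrow> y \<bullet> gradient f y"
        by simp
    qed
    show "AE y in \<mu>. norm ((f (c n *\<^sub>R y) - f y) / (c n - 1)) \<le> B" for n
    proof (intro AE_I2)
      fix y
      \<comment> \<open>Since z > 1, |y| is at most |z y|, so the weighted gradient bound at z y
        bounds the quotient by B.\<close>
      obtain z where z: "1 < z" "z < c n" "f (c n *\<^sub>R y) - f (1 *\<^sub>R y) = (c n - 1) * (y \<bullet> gradient f (z *\<^sub>R y))"
        using MVT2[OF c(2)[of n] schwartz_ray_has_real_derivative[OF f, of y _ UNIV]] by blast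
      have "\<bar>y \<bullet> gradient f (z *\<^sub>R y)\<bar> \<le> norm y * norm (gradient f (z *\<^sub>R y))"
        by (rule Cauchy_Schwarz_ineq2)
      also have "\<dots> \<le> (1 + norm (z *\<^sub>R y)) * norm (gradient f (z *\<^sub>R y))"
        using z mult_right_mono[of 1 z "norm y"] by (intro mult_right_mono) auto
      also have "\<dots> \<le> B"
        by (rule B)
      finally show "norm ((f (c n *\<^sub>R y) - f y) / (c n - 1)) \<le> B"
        using z c(2)[of n] by simp
    qed
  qed auto
  have "g 1 = \<alpha> * (\<integral>y. (\<integral>u. f (y + u) - f y \<partial>\<nu>) \<partial>\<mu>)"
    by (simp add: g_def G_def)
  then show ?thesis
    using LIMSEQ_unique[OF lim2 lim1] by simp
qed

end

section \<open>The characteristic function from the Stein identity\<close>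

text \<open>Linear functions are included because differentiating the Gaussian factor produces -s^2
  (x \<bullet> v); with them, Gaussian multiples of this class are closed under partial
  derivatives.\<close>

inductive_set trig_poly :: "'a::euclidean_space \<Rightarrow> ('a \<Rightarrow> real) set" for \<xi> :: 'a where
  const: "(\<lambda>_. c) \<in> trig_poly \<xi>"
| inner: "(\<lambda>x. x \<bullet> i) \<in> trig_poly \<xi>"
| cos: "(\<lambda>x. cos (\<xi> \<bullet> x)) \<in> trig_poly \<xi>"
| sin: "(\<lambda>x. sin (\<xi> \<bullet> x)) \<in> trig_poly \<xi>"
| add: "g \<in> trig_poly \<xi> \<Longrightarrow> h \<in> trig_poly \<xi> \<Longrightarrow> (\<lambda>x. g x + h x) \<in> trig_poly \<xi>"
| mult: "g \<in> trig_poly \<xi> \<Longrightarrow> h \<in> trig_poly \<xi> \<Longrightarrow> (\<lambda>x. g x * h x) \<in> trig_poly \<xi>"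

lemma trig_poly_has_derivative:
  assumes "h \<in> trig_poly \<xi>"
  shows "\<exists>D. (\<forall>v. D v \<in> trig_poly \<xi>) \<and> (\<forall>x. (h has_derivative (\<lambda>v. D v x)) (at x))"
  using assms
proof induction
  case (const c)
  show ?case
    by (intro exI[of _ "\<lambda>_ _. 0"]) (auto intro: trig_poly.const)
next
  case (inner i)
  show ?case
    by (intro exI[of _ "\<lambda>v _. v \<bullet> i"]) (auto intro!: trig_poly.const derivative_eq_intros)
next
  case cos
  show ?case
    by (intro exI[of _ "\<lambda>v x. sin (\<xi> \<bullet> x) * (- (\<xi> \<bullet> v))"])
      (intro conjI allI trig_poly.intros, auto intro!: derivative_eq_intros)
next
  case sin
  show ?case
    by (intro exI[of _ "\<lambda>v x. cos (\<xi> \<bullet> x) * (\<xi> \<bullet> v)"])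
      (auto intro!: trig_poly.intros derivative_eq_intros)
next
  case (add g h)
  then obtain D E where "\<forall>v. D v \<in> trig_poly \<xi>" "\<forall>x. (g has_derivative (\<lambda>v. D v x)) (at x)"
    "\<forall>v. E v \<in> trig_poly \<xi>" "\<forall>x. (h has_derivative (\<lambda>v. E v x)) (at x)"
    by blast
  then show ?case
    by (intro exI[of _ "\<lambda>v x. D v x + E v x"]) (auto intro!: trig_poly.add has_derivative_add)
next
  case (mult g h)
  then obtain D E where "\<forall>v. D v \<in> trig_poly \<xi>" "\<forall>x. (g has_derivative (\<lambda>v. D v x)) (at x)"
    "\<forall>v. E v \<in> trig_poly \<xi>" "\<forall>x. (h has_derivative (\<lambda>v. E v x)) (at x)"
    by blast
  with mult.hyps show ?case
    by (intro exI[of _ "\<lambda>v x. g x * E v x + D v x * h x"])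
      (auto intro!: trig_poly.add trig_poly.mult has_derivative_mult)
qed

lemma trig_poly_growth:
  assumes "h \<in> trig_poly \<xi>"
  shows "\<exists>C n. \<forall>x. \<bar>h x\<bar> \<le> C * (1 + norm x) ^ n"
  using assms
proof induction
  case (const c)
  show ?case
    by (intro exI[of _ "\<bar>c\<bar>"] exI[of _ 0]) simp
next
  case (inner i)
  have "\<bar>x \<bullet> i\<bar> \<le> norm i * (1 + norm x) ^ 1" for x
    using Cauchy_Schwarz_ineq2[of x i] by (simp add: distrib_left mult.commute add_increasing)
  then show ?case by blast
next
  case cos
  show ?case
    by (intro exI[of _ 1] exI[of _ 0]) simp
next
  case sin
  show ?case
    by (intro exI[of _ 1] exI[of _ 0]) simp
next
  case (add g h)
  then obtain C m D n where gh: "\<And>x. \<bar>g x\<bar> \<le> C * (1 + norm x) ^ m" "\<And>x. \<bar>h x\<bar> \<le> D * (1 + norm x) ^ n"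
    by blast
  have CD: "C \<ge> 0" "D \<ge> 0"
    using gh(1)[of 0] gh(2)[of 0] by auto
  have "\<bar>g x + h x\<bar> \<le> (C + D) * (1 + norm x) ^ (m + n)" for x
  proof -
    have "C * (1 + norm x) ^ m \<le> C * (1 + norm x) ^ (m + n)" "D * (1 + norm x) ^ n \<le> D * (1 + norm x) ^ (m + n)"
      using CD by (auto intro!: mult_left_mono power_increasing)
    then show ?thesis
      using gh(1)[of x] gh(2)[of x] by (simp only: distrib_right)
  qed
  then show ?case by blast
next
  case (mult g h)
  then obtain C m D n where gh: "\<And>x. \<bar>g x\<bar> \<le> C * (1 + norm x) ^ m" "\<And>x. \<bar>h x\<bar> \<le> D * (1 + norm x) ^ n"
    by blast
  have "\<bar>g x * h x\<bar> \<le> (C * D) * (1 + norm x) ^ (m + n)" for x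
  proof -
    have "\<bar>g x\<bar> * \<bar>h x\<bar> \<le> (C * (1 + norm x) ^ m) * (D * (1 + norm x) ^ n)"
      by (intro mult_mono gh order_trans[OF abs_ge_zero gh(1)]) simp
    then show ?thesis
      by (simp add: abs_mult power_add mult_ac)
  qed
  then show ?case by blast
qed

definition gauss_factor :: "real \<Rightarrow> 'a::euclidean_space \<Rightarrow> real" where
  "gauss_factor s x = exp (- (s * norm x)\<^sup>2 / 2)"

lemma gauss_factor_has_derivative:
  "(gauss_factor s has_derivative (\<lambda>v. gauss_factor s x * (- s\<^sup>2 * (x \<bullet> v)))) (at x)"
proof -
  have eq: "gauss_factor s = (\<lambda>x. exp (- (s\<^sup>2 * (x \<bullet> x)) / 2))"
    by (simp add: gauss_factor_def fun_eq_iff power_mult_distrib power2_norm_eq_inner)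
  show ?thesis
    unfolding eq by (auto intro!: derivative_eq_intros simp: fun_eq_iff inner_commute field_simps)
qed

text \<open>By 1 + r \<le> e^r it remains to maximise k r - s^2 r^2 / 2; completing the square gives
  the maximum k^2 / (2 s^2).\<close>

lemma gauss_factor_decay:
  assumes "s > 0"
  shows "(1 + norm x) ^ k * gauss_factor s x \<le> exp ((real k)\<^sup>2 / (2 * s\<^sup>2))"
proof -
  have "(1 + norm x) ^ k \<le> exp (norm x) ^ k"
    by (intro power_mono) (auto intro: exp_ge_add_one_self)
  then have "(1 + norm x) ^ k * gauss_factor s x \<le> exp (real k * norm x) * gauss_factor s x"
    by (intro mult_right_mono) (auto simp: gauss_factor_def exp_of_nat_mult)
  also have "\<dots> = exp (real k * norm x - (s * norm x)\<^sup>2 / 2)"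
    by (simp add: gauss_factor_def mult_exp_exp)
  also have "real k * norm x - (s * norm x)\<^sup>2 / 2 = (real k)\<^sup>2 / (2 * s\<^sup>2) - (s * norm x - real k / s)\<^sup>2 / 2"
    using assms by (simp add: power2_diff power_divide field_simps power2_eq_square)
  finally show ?thesis
    by (rule order_trans) simp
qed

lemma gauss_trig_poly_partial:
  assumes "h \<in> trig_poly \<xi>"
  shows "(\<lambda>x. gauss_factor s x * h x) differentiable (at x)"
    and "\<exists>h'\<in>trig_poly \<xi>. partial_deriv i (\<lambda>x. gauss_factor s x * h x) = (\<lambda>x. gauss_factor s x * h' x)"
proof -
  obtain D where D: "\<And>v. D v \<in> trig_poly \<xi>" "\<And>x. (h has_derivative (\<lambda>v. D v x)) (at x)"
    using trig_poly_has_derivative[OF assms] by blast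
  have der: "((\<lambda>x. gauss_factor s x * h x) has_derivative
      (\<lambda>v. gauss_factor s x * D v x + gauss_factor s x * (- s\<^sup>2 * (x \<bullet> v)) * h x)) (at x)" for x
    by (rule has_derivative_mult[OF gauss_factor_has_derivative D(2)])
  then show "(\<lambda>x. gauss_factor s x * h x) differentiable (at x)"
    by (auto simp: differentiable_def)
  have "partial_deriv i (\<lambda>x. gauss_factor s x * h x) = (\<lambda>x. gauss_factor s x * (D i x + - s\<^sup>2 * (x \<bullet> i) * h x))"
    unfolding partial_deriv_def frechet_derivative_at[OF der, symmetric]
    by (simp add: fun_eq_iff algebra_simps)
  moreover have "(\<lambda>x. D i x + - s\<^sup>2 * (x \<bullet> i) * h x) \<in> trig_poly \<xi>"
    by (intro trig_poly.intros D assms)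
  ultimately show "\<exists>h'\<in>trig_poly \<xi>. partial_deriv i (\<lambda>x. gauss_factor s x * h x) = (\<lambda>x. gauss_factor s x * h' x)"
    by (rule rev_bexI[rotated])
qed

text \<open>The instances of interest are cosine and sine; the larger class lets the induction over
  iterated derivatives close, and polynomial growth loses to Gaussian decay.\<close>

lemma gauss_trig_poly_schwartz:
  assumes "h \<in> trig_poly \<xi>" and s: "s > 0"
  shows "(\<lambda>x. gauss_factor s x * h x) \<in> schwartz"
proof -
  have iter: "\<exists>h'\<in>trig_poly \<xi>. iter_partial is (\<lambda>x. gauss_factor s x * h x) = (\<lambda>x. gauss_factor s x * h' x)" for "is"
  proof (induction "is")
    case Nil
    show ?case
      using assms(1) by (auto simp: iter_partial_def)
  next
    case (Cons i "is")
    then obtain h' where "h' \<in> trig_poly \<xi>" "iter_partial is (\<lambda>x. gauss_factor s x * h x) = (\<lambda>x. gauss_factor s x * h' x)"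
      by blast
    then show ?case
      using gauss_trig_poly_partial(2)[of h' \<xi> i s] by (simp add: iter_partial_def)
  qed
  have "bounded (range (\<lambda>x. (1 + norm x) ^ k * (gauss_factor s x * h' x)))" if h': "h' \<in> trig_poly \<xi>" for h' k
  proof -
    obtain C n where C: "\<And>x. \<bar>h' x\<bar> \<le> C * (1 + norm x) ^ n"
      using trig_poly_growth[OF h'] by blast
    have "C \<ge> 0" using C[of 0] by simp
    have "norm ((1 + norm x) ^ k * (gauss_factor s x * h' x)) \<le> C * exp ((real (k + n))\<^sup>2 / (2 * s\<^sup>2))" for x
    proof -
      have "norm ((1 + norm x) ^ k * (gauss_factor s x * h' x)) = (1 + norm x) ^ k * gauss_factor s x * \<bar>h' x\<bar>"
        by (simp add: abs_mult gauss_factor_def)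
      also have "\<dots> \<le> (1 + norm x) ^ k * gauss_factor s x * (C * (1 + norm x) ^ n)"
        by (intro mult_left_mono C) (simp add: gauss_factor_def)
      also have "\<dots> = C * ((1 + norm x) ^ (k + n) * gauss_factor s x)"
        by (simp add: power_add)
      also have "\<dots> \<le> C * exp ((real (k + n))\<^sup>2 / (2 * s\<^sup>2))"
        using \<open>C \<ge> 0\<close> by (intro mult_left_mono gauss_factor_decay s)
      finally show ?thesis .
    qed
    then show ?thesis by (auto simp: bounded_iff)
  qed
  moreover have "(\<lambda>x. gauss_factor s x * h' x) differentiable_on UNIV" if "h' \<in> trig_poly \<xi>" for h'
    using gauss_trig_poly_partial(1)[OF that] by (auto simp: differentiable_on_def)
  ultimately have good: "iter_partial is (\<lambda>x. gauss_factor s x * h x) differentiable_on UNIV \<and>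
      bounded (range (\<lambda>x. (1 + norm x) ^ k * iter_partial is (\<lambda>x. gauss_factor s x * h x) x))" for "is" k
    using iter[of "is"] by fastforce
  show ?thesis
    unfolding schwartz_def smooth_def mem_Collect_eq by (intro conjI allI impI conjunct1[OF good] conjunct2[OF good])
qed

text \<open>These are the real and imaginary parts of i (\<xi> \<bullet> y) - (s |y|)^2 times the
  damped exponential; the square comes from the Gaussian factor.\<close>

lemma gauss_trig_inner_gradient:
  fixes \<xi> y :: "'a::euclidean_space"
  assumes "s > 0"
  shows "y \<bullet> gradient (\<lambda>x. gauss_factor s x * cos (\<xi> \<bullet> x)) y =
      gauss_factor s y * (- (s * norm y)\<^sup>2 * cos (\<xi> \<bullet> y) - (\<xi> \<bullet> y) * sin (\<xi> \<bullet> y))" (is ?cos)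
    and "y \<bullet> gradient (\<lambda>x. gauss_factor s x * sin (\<xi> \<bullet> x)) y =
      gauss_factor s y * (- (s * norm y)\<^sup>2 * sin (\<xi> \<bullet> y) + (\<xi> \<bullet> y) * cos (\<xi> \<bullet> y))" (is ?sin)
proof -
  have eq: "y \<bullet> gradient f y = F y" if "f \<in> schwartz" "(f has_derivative F) (at y)" for f F
    using has_derivative_unique[OF schwartz_has_derivative[OF that(1)] that(2)] by (simp add: fun_eq_iff)
  have "((\<lambda>x. cos (\<xi> \<bullet> x)) has_derivative (\<lambda>v. sin (\<xi> \<bullet> y) * (- (\<xi> \<bullet> v)))) (at y)"
    by (auto intro!: derivative_eq_intros)
  from eq[OF gauss_trig_poly_schwartz[OF trig_poly.cos assms] has_derivative_mult[OF gauss_factor_has_derivative this]]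
  show ?cos
    by (simp add: power_mult_distrib power2_norm_eq_inner algebra_simps)
  have "((\<lambda>x. sin (\<xi> \<bullet> x)) has_derivative (\<lambda>v. cos (\<xi> \<bullet> y) * (\<xi> \<bullet> v))) (at y)"
    by (auto intro!: derivative_eq_intros)
  from eq[OF gauss_trig_poly_schwartz[OF trig_poly.sin assms] has_derivative_mult[OF gauss_factor_has_derivative this]]
  show ?sin
    by (simp add: power_mult_distrib power2_norm_eq_inner algebra_simps)
qed

text \<open>The function exp(-r^2 / 2) is 1-Lipschitz because |r| \<le> 1 + r^2 / 2 \<le> exp(r^2 /
  2). With s \<le> 1 the bound does not depend on s, as dominated convergence for s \<rightarrow> 0
  requires.\<close>

lemma gauss_factor_diff_le:
  assumes "0 \<le> s" "s \<le> 1"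
  shows "\<bar>gauss_factor s x - gauss_factor s y\<bar> \<le> min 1 (norm (x - y))"
proof -
  have lip: "norm (exp (- a\<^sup>2 / 2) - exp (- b\<^sup>2 / 2)) \<le> 1 * norm (a - b)" for a b :: real
  proof (rule field_differentiable_bound[of UNIV])
    fix r :: real
    show "((\<lambda>r. exp (- r\<^sup>2 / 2)) has_field_derivative - r * exp (- r\<^sup>2 / 2)) (at r within UNIV)"
      by (auto intro!: derivative_eq_intros)
    have "\<bar>r\<bar> \<le> 1 + r\<^sup>2 / 2"
      using zero_le_power2[of "\<bar>r\<bar> - 1"] by (simp add: power2_diff)
    also have "\<dots> \<le> exp (r\<^sup>2 / 2)"
      by (rule exp_ge_add_one_self)
    finally show "norm (- r * exp (- r\<^sup>2 / 2)) \<le> 1"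
      by (simp add: abs_mult exp_minus field_simps)
  qed auto
  have "\<bar>gauss_factor s x - gauss_factor s y\<bar> \<le> \<bar>s * norm x - s * norm y\<bar>"
    using lip[of "s * norm x" "s * norm y"] by (simp add: gauss_factor_def)
  also have "\<dots> = s * \<bar>norm x - norm y\<bar>"
    using assms by (simp add: abs_mult flip: right_diff_distrib)
  also have "\<dots> \<le> 1 * norm (x - y)"
    using assms norm_triangle_ineq3[of x y] by (intro mult_mono) auto
  finally have "\<bar>gauss_factor s x - gauss_factor s y\<bar> \<le> norm (x - y)"
    by simp
  moreover have "0 \<le> gauss_factor s z" "gauss_factor s z \<le> 1" for z :: 'a
    by (auto simp: gauss_factor_def)
  then have "\<bar>gauss_factor s x - gauss_factor s y\<bar> \<le> 1"
    by (smt (verit))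
  ultimately show ?thesis by simp
qed

section \<open>Damped exponentials and their estimates\<close>

text \<open>For s > 0 the real and imaginary parts are Schwartz functions; the plain exponential is
  recovered as s \<rightarrow> 0.\<close>

definition gauss_wave :: "real \<Rightarrow> 'a::euclidean_space \<Rightarrow> 'a \<Rightarrow> complex" where
  "gauss_wave s \<xi> x = of_real (gauss_factor s x) * iexp (\<xi> \<bullet> x)"

lemma gauss_factor_bounds: "0 \<le> gauss_factor s x" "gauss_factor s x \<le> 1"
  by (auto simp: gauss_factor_def)

lemma borel_measurable_gauss_factor [measurable]: "gauss_factor s \<in> borel_measurable borel"
  unfolding gauss_factor_def by measurable

lemma borel_measurable_gauss_wave [measurable]: "gauss_wave s \<xi> \<in> borel_measurable borel"
  unfolding gauss_wave_def by measurable

lemma norm_gauss_wave: "norm (gauss_wave s \<xi> x) = gauss_factor s x"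
  by (simp add: gauss_wave_def norm_mult gauss_factor_bounds)

text \<open>A summand 1 comes from the Gaussian factor and 2 + |\<xi>| from the exponential; the
  constant is independent of s.\<close>

lemma gauss_wave_diff_le:
  assumes "0 \<le> s" "s \<le> 1"
  shows "norm (gauss_wave s \<xi> x - gauss_wave s \<xi> y) \<le> (3 + norm \<xi>) * min 1 (norm (x - y))"
proof -
  have "gauss_wave s \<xi> x - gauss_wave s \<xi> y =
      of_real (gauss_factor s x - gauss_factor s y) * iexp (\<xi> \<bullet> x)
      + of_real (gauss_factor s y) * (iexp (\<xi> \<bullet> x) - iexp (\<xi> \<bullet> y))"
    by (simp add: gauss_wave_def algebra_simps)
  also have "norm \<dots> \<le> \<bar>gauss_factor s x - gauss_factor s y\<bar> * 1
      + gauss_factor s y * norm (iexp (\<xi> \<bullet> x) - iexp (\<xi> \<bullet> y))"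
    by (rule order_trans[OF norm_triangle_ineq])
      (simp only: norm_mult norm_of_real norm_exp_i_times abs_of_nonneg[OF gauss_factor_bounds(1)] order_refl)
  also have "\<dots> \<le> min 1 (norm (x - y)) * 1 + 1 * ((2 + norm \<xi>) * min 1 (norm (x - y)))"
    by (intro add_mono mult_mono gauss_factor_diff_le assms gauss_factor_bounds norm_iexp_inner_diff_le) auto
  also have "\<dots> = (3 + norm \<xi>) * min 1 (norm (x - y))"
    by (simp add: algebra_simps)
  finally show ?thesis .
qed

lemma gauss_wave_tendsto: "(\<lambda>n. gauss_wave (inverse (real (Suc n))) \<xi> x) \<longlonglongrightarrow> iexp (\<xi> \<bullet> x)"
proof -
  have "(\<lambda>n. of_real (exp (- (inverse (real (Suc n)) * norm x)\<^sup>2 / 2)) * iexp (\<xi> \<bullet> x))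
      \<longlonglongrightarrow> of_real (exp (- (0 * norm x)\<^sup>2 / 2)) * iexp (\<xi> \<bullet> x)"
    by (intro tendsto_intros LIMSEQ_inverse_real_of_nat) simp
  then show ?thesis
    by (simp add: gauss_wave_def gauss_factor_def)
qed

text \<open>From q \<le> e^q, uniformly in s. This dominates the error term created by
  differentiating the Gaussian factor, which tends to 0 pointwise.\<close>

lemma sq_mult_gauss_factor_le: "(s * norm x)\<^sup>2 * gauss_factor s x \<le> 2"
proof -
  have "(s * norm x)\<^sup>2 / 2 \<le> exp ((s * norm x)\<^sup>2 / 2)"
    using exp_ge_add_one_self[of "(s * norm x)\<^sup>2 / 2"] by linarith
  then show ?thesis
    by (simp add: gauss_factor_def exp_minus field_simps)
qed

text \<open>The bound blows up as s \<rightarrow> 0, so it gives integrability at fixed s only;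
  without damping, |x| need not be integrable.\<close>

lemma norm_mult_gauss_factor_le: "s > 0 \<Longrightarrow> norm x * gauss_factor s x \<le> exp (1 / (2 * s\<^sup>2))"
  using gauss_factor_decay[of s x 1] mult_right_mono[of "norm x" "1 + norm x" "gauss_factor s x"]
  by (simp add: gauss_factor_bounds)

section \<open>Removing the damping and integrating along rays\<close>

context stable_levy
begin

text \<open>The hypothesis concerns real test functions; it is applied to the real and imaginary
  parts, which are then reassembled. The term with (s |y|)^2 is the price of the damping.\<close>

lemma stein_identity_gauss_wave:
  assumes \<mu>: "prob_space \<mu>" and sets_\<mu>: "sets \<mu> = sets borel"
    and stein: "\<And>f. f \<in> schwartz \<Longrightarrow>
      (\<integral>y. y \<bullet> gradient f y \<partial>\<mu>) = \<alpha> * (\<integral>y. (\<integral>u. f (y + u) - f y \<partial>\<nu>) \<partial>\<mu>)"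
    and s: "0 < s" "s \<le> 1"
  shows "(CLINT y|\<mu>. \<i> * of_real (\<xi> \<bullet> y) * gauss_wave s \<xi> y) =
      (CLINT y|\<mu>. of_real ((s * norm y)\<^sup>2) * gauss_wave s \<xi> y)
      + \<alpha> * (CLINT y|\<mu>. CLINT u|\<nu>. gauss_wave s \<xi> (y + u) - gauss_wave s \<xi> y)"
proof -
  interpret \<mu>: prob_space \<mu> by fact
  note [measurable_cong] = sets_\<mu>
  define C where "C x = gauss_factor s x * cos (\<xi> \<bullet> x)" for x
  define S where "S x = gauss_factor s x * sin (\<xi> \<bullet> x)" for x
  have Re: "Re (gauss_wave s \<xi> x) = C x" and Im: "Im (gauss_wave s \<xi> x) = S x" for x
    by (simp_all add: gauss_wave_def C_def S_def Re_exp Im_exp)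
  have C: "C \<in> schwartz" and S: "S \<in> schwartz"
    unfolding C_def[abs_def] S_def[abs_def]
    by (rule gauss_trig_poly_schwartz[OF trig_poly.cos s(1)], rule gauss_trig_poly_schwartz[OF trig_poly.sin s(1)])
  note incr = integrable_increment[OF borel_measurable_gauss_wave gauss_wave_diff_le[OF less_imp_le[OF s(1)] s(2)]]
  define G where "G y = (CLINT u|\<nu>. gauss_wave s \<xi> (y + u) - gauss_wave s \<xi> y)" for y
  have [measurable]: "G \<in> borel_measurable borel"
    unfolding G_def by measurable
  have ReG: "Re (G y) = (\<integral>u. C (y + u) - C y \<partial>\<nu>)" and ImG: "Im (G y) = (\<integral>u. S (y + u) - S y \<partial>\<nu>)" for y
    by (simp_all only: G_def integral_Re[OF incr(1), symmetric] integral_Im[OF incr(1), symmetric] minus_complex.simps Re Im)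
  have G_int: "integrable \<mu> G"
    unfolding G_def[abs_def] by (rule \<mu>.integrable_const_bound[OF AE_I2[OF incr(2)]]) measurable
  have i1: "integrable \<mu> (\<lambda>y. \<i> * of_real (\<xi> \<bullet> y) * gauss_wave s \<xi> y)"
  proof (rule \<mu>.integrable_const_bound)
    show "AE y in \<mu>. norm (\<i> * of_real (\<xi> \<bullet> y) * gauss_wave s \<xi> y) \<le> norm \<xi> * exp (1 / (2 * s\<^sup>2))"
    proof (intro AE_I2)
      fix y
      have "norm (\<i> * of_real (\<xi> \<bullet> y) * gauss_wave s \<xi> y) \<le> (norm \<xi> * norm y) * gauss_factor s y"
        by (simp add: norm_mult norm_gauss_wave) (intro mult_right_mono Cauchy_Schwarz_ineq2 gauss_factor_bounds)
      also have "\<dots> \<le> norm \<xi> * exp (1 / (2 * s\<^sup>2))"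
        unfolding mult.assoc by (intro mult_left_mono norm_mult_gauss_factor_le s) simp
      finally show "norm (\<i> * of_real (\<xi> \<bullet> y) * gauss_wave s \<xi> y) \<le> norm \<xi> * exp (1 / (2 * s\<^sup>2))" .
    qed
  qed measurable
  have i2: "integrable \<mu> (\<lambda>y. of_real ((s * norm y)\<^sup>2) * gauss_wave s \<xi> y)"
  proof (rule \<mu>.integrable_const_bound[where B = 2])
    show "AE y in \<mu>. norm (of_real ((s * norm y)\<^sup>2) * gauss_wave s \<xi> y) \<le> 2"
      by (simp only: norm_mult norm_gauss_wave norm_of_real abs_power2 sq_mult_gauss_factor_le AE_I2)
  qed measurable
  \<comment> \<open>\<open>L y\<close> is y paired with the gradient of the damped exponential at y,
    as \<open>ReL\<close> and \<open>ImL\<close> confirm.\<close>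
  define L where "L y = \<i> * of_real (\<xi> \<bullet> y) * gauss_wave s \<xi> y - of_real ((s * norm y)\<^sup>2) * gauss_wave s \<xi> y" for y
  have L_int: "integrable \<mu> L"
    unfolding L_def using i1 i2 by (rule Bochner_Integration.integrable_diff)
  have ReL: "Re (L y) = y \<bullet> gradient C y" and ImL: "Im (L y) = y \<bullet> gradient S y" for y
  proof -
    have parts: "Re (\<i> * of_real r * z) = - r * Im z" "Im (\<i> * of_real r * z) = r * Re z"
      "Re (of_real r * z) = r * Re z" "Im (of_real r * z) = r * Im z" for r z
      by simp_all
    have "- r * (e * b) - q * (e * a) = e * (- q * a - r * b)"
      "r * (e * a) - q * (e * b) = e * (- q * b + r * a)" for r q e a b :: real
      by (simp_all only: distrib_left right_diff_distrib) simp_all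
    then show "Re (L y) = y \<bullet> gradient C y" "Im (L y) = y \<bullet> gradient S y"
      unfolding L_def minus_complex.simps parts Re Im
      unfolding C_def[abs_def] S_def[abs_def] gauss_trig_inner_gradient[OF s(1)] .
  qed
  have "(CLINT y|\<mu>. L y) = of_real \<alpha> * (CLINT y|\<mu>. G y)"
  proof (rule complex_eqI)
    have "Re (CLINT y|\<mu>. L y) = \<alpha> * Re (CLINT y|\<mu>. G y)"
      by (simp only: integral_Re[OF L_int, symmetric] integral_Re[OF G_int, symmetric] ReL ReG stein[OF C])
    then show "Re (CLINT y|\<mu>. L y) = Re (of_real \<alpha> * (CLINT y|\<mu>. G y))"
      by simp
    have "Im (CLINT y|\<mu>. L y) = \<alpha> * Im (CLINT y|\<mu>. G y)"
      by (simp only: integral_Im[OF L_int, symmetric] integral_Im[OF G_int, symmetric] ImL ImG stein[OF S])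
    then show "Im (CLINT y|\<mu>. L y) = Im (of_real \<alpha> * (CLINT y|\<mu>. G y))"
      by simp
  qed
  moreover have "(CLINT y|\<mu>. L y) = (CLINT y|\<mu>. \<i> * of_real (\<xi> \<bullet> y) * gauss_wave s \<xi> y)
      - (CLINT y|\<mu>. of_real ((s * norm y)\<^sup>2) * gauss_wave s \<xi> y)"
    unfolding L_def by (rule Bochner_Integration.integral_diff[OF i1 i2])
  ultimately have "(CLINT y|\<mu>. \<i> * of_real (\<xi> \<bullet> y) * gauss_wave s \<xi> y)
      - (CLINT y|\<mu>. of_real ((s * norm y)\<^sup>2) * gauss_wave s \<xi> y) = of_real \<alpha> * (CLINT y|\<mu>. G y)"
    by (rule trans[OF sym, rotated])
  then show ?thesis
    unfolding G_def diff_eq_eq by (rule trans[OF _ add.commute])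
qed

text \<open>Each limit has a majorant independent of s: 1, 2 and the increment bound. The term
  containing \<xi> \<bullet> y has no such majorant and is not among them.\<close>

lemma gauss_wave_limits:
  assumes \<mu>: "prob_space \<mu>" and sets_\<mu>: "sets \<mu> = sets borel"
  defines "s \<equiv> \<lambda>n. inverse (real (Suc n))"
  shows "(\<lambda>n. CLINT y|\<mu>. gauss_wave (s n) \<xi> y) \<longlonglongrightarrow> (CLINT y|\<mu>. iexp (\<xi> \<bullet> y))" (is ?wave)
    and "(\<lambda>n. CLINT y|\<mu>. of_real ((s n * norm y)\<^sup>2) * gauss_wave (s n) \<xi> y) \<longlonglongrightarrow> 0" (is ?sq)
    and "(\<lambda>n. CLINT y|\<mu>. CLINT u|\<nu>. gauss_wave (s n) \<xi> (y + u) - gauss_wave (s n) \<xi> y)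
      \<longlonglongrightarrow> eta \<xi> * (CLINT y|\<mu>. iexp (\<xi> \<bullet> y))" (is ?incr)
proof -
  interpret \<mu>: prob_space \<mu> by fact
  note [measurable_cong] = sets_\<mu>
  have s: "0 \<le> s n" "s n \<le> 1" for n
    by (simp_all add: s_def inverse_le_1_iff)
  have s_lim: "s \<longlonglongrightarrow> 0"
    unfolding s_def by (rule LIMSEQ_inverse_real_of_nat)
  have wave_lim: "(\<lambda>n. gauss_wave (s n) \<xi> y) \<longlonglongrightarrow> iexp (\<xi> \<bullet> y)" for y
    unfolding s_def by (rule gauss_wave_tendsto)
  show ?wave
    by (rule integral_dominated_convergence[where w = "\<lambda>_. 1"])
      (simp_all add: norm_gauss_wave gauss_factor_bounds wave_lim)
  have "(\<lambda>n. CLINT y|\<mu>. of_real ((s n * norm y)\<^sup>2) * gauss_wave (s n) \<xi> y) \<longlonglongrightarrow> (CLINT y|\<mu>. 0)"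
  proof (rule integral_dominated_convergence[where w = "\<lambda>_. 2"])
    show "AE y in \<mu>. norm (of_real ((s n * norm y)\<^sup>2) * gauss_wave (s n) \<xi> y) \<le> 2" for n
      by (simp only: norm_mult norm_gauss_wave norm_of_real abs_power2 sq_mult_gauss_factor_le AE_I2)
    show "AE y in \<mu>. (\<lambda>n. of_real ((s n * norm y)\<^sup>2) * gauss_wave (s n) \<xi> y) \<longlonglongrightarrow> 0"
    proof (intro AE_I2)
      fix y
      have "(\<lambda>n. of_real ((s n * norm y)\<^sup>2) * gauss_wave (s n) \<xi> y) \<longlonglongrightarrow> of_real ((0 * norm y)\<^sup>2) * iexp (\<xi> \<bullet> y)"
        by (intro tendsto_mult tendsto_of_real tendsto_power s_lim tendsto_const wave_lim)
      then show "(\<lambda>n. of_real ((s n * norm y)\<^sup>2) * gauss_wave (s n) \<xi> y) \<longlonglongrightarrow> 0"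
        by simp
    qed
  qed simp_all
  then show ?sq by simp
  note incr = integrable_increment[OF borel_measurable_gauss_wave gauss_wave_diff_le[OF s]]
  have inner_lim: "(\<lambda>n. CLINT u|\<nu>. gauss_wave (s n) \<xi> (y + u) - gauss_wave (s n) \<xi> y) \<longlonglongrightarrow> eta \<xi> * iexp (\<xi> \<bullet> y)" for y
  proof -
    have "(\<lambda>n. CLINT u|\<nu>. gauss_wave (s n) \<xi> (y + u) - gauss_wave (s n) \<xi> y)
        \<longlonglongrightarrow> (CLINT u|\<nu>. iexp (\<xi> \<bullet> (y + u)) - iexp (\<xi> \<bullet> y))"
    proof (rule integral_dominated_convergence[where w = "\<lambda>u. (3 + norm \<xi>) * min 1 (norm u)"])
      show "integrable \<nu> (\<lambda>u. (3 + norm \<xi>) * min 1 (norm u))"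
        by (intro integrable_mult_right integrable_min_norm)
      show "AE u in \<nu>. norm (gauss_wave (s n) \<xi> (y + u) - gauss_wave (s n) \<xi> y) \<le> (3 + norm \<xi>) * min 1 (norm u)" for n
        using gauss_wave_diff_le[OF s, of n \<xi> "y + _" y] by (intro AE_I2) simp
      show "AE u in \<nu>. (\<lambda>n. gauss_wave (s n) \<xi> (y + u) - gauss_wave (s n) \<xi> y) \<longlonglongrightarrow> iexp (\<xi> \<bullet> (y + u)) - iexp (\<xi> \<bullet> y)"
        by (intro AE_I2 tendsto_diff wave_lim)
    qed measurable
    also have "(CLINT u|\<nu>. iexp (\<xi> \<bullet> (y + u)) - iexp (\<xi> \<bullet> y)) = (CLINT u|\<nu>. (iexp (\<xi> \<bullet> u) - 1) * iexp (\<xi> \<bullet> y))"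
      by (simp add: inner_add_right distrib_left exp_add algebra_simps)
    also have "\<dots> = eta \<xi> * iexp (\<xi> \<bullet> y)"
      by (simp only: eta_def integral_mult_left_zero)
    finally show ?thesis .
  qed
  have "(\<lambda>n. CLINT y|\<mu>. CLINT u|\<nu>. gauss_wave (s n) \<xi> (y + u) - gauss_wave (s n) \<xi> y)
      \<longlonglongrightarrow> (CLINT y|\<mu>. eta \<xi> * iexp (\<xi> \<bullet> y))"
    by (rule integral_dominated_convergence[where w = "\<lambda>_. (3 + norm \<xi>) * (\<integral>u. min 1 (norm u) \<partial>\<nu>)"])
      (simp_all add: incr(2) inner_lim)
  then show ?incr
    by (simp only: integral_mult_right_zero)
qed

text \<open>\<open>E\<close> is the integrating factor of the differential equation along the ray; integrating
  pathwise and using Fubini replaces differentiation under the integral sign.\<close>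

lemma damped_ray_increment:
  fixes \<xi> :: 'a
  assumes \<mu>: "prob_space \<mu>" and sets_\<mu>: "sets \<mu> = sets borel"
    and s: "0 < s" and \<delta>: "0 < \<delta>" "\<delta> \<le> 1"
  defines "E \<equiv> \<lambda>t. exp (- (of_real (t powr \<alpha>) * eta \<xi>))"
  shows "(CLINT y|\<mu>. gauss_wave s \<xi> y) * E 1 - (CLINT y|\<mu>. gauss_wave s (\<delta> *\<^sub>R \<xi>) y) * E \<delta> =
    (CLINT t|lborel. indicator {\<delta>..1} t *\<^sub>R
      (E t * ((CLINT y|\<mu>. \<i> * of_real (\<xi> \<bullet> y) * gauss_wave s (t *\<^sub>R \<xi>) y)
        - of_real (\<alpha> * t powr (\<alpha> - 1)) * eta \<xi> * (CLINT y|\<mu>. gauss_wave s (t *\<^sub>R \<xi>) y))))"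
proof -
  interpret \<mu>: prob_space \<mu> by fact
  note [measurable_cong] = sets_\<mu>
  interpret L\<mu>: pair_sigma_finite lborel \<mu> ..
  have E_bound: "norm (E t) \<le> exp (norm (eta \<xi>))" if "t \<in> {\<delta>..1}" for t
  proof -
    have "norm (of_real (t powr \<alpha>) * eta \<xi>) \<le> 1 * norm (eta \<xi>)"
      using that \<delta> \<alpha> by (subst norm_mult, intro mult_right_mono) (auto intro: powr_le1)
    then show ?thesis
      unfolding E_def by (intro order_trans[OF norm_exp]) simp
  qed
  \<comment> \<open>The t-derivative of the damped wave at t \<xi> times \<open>E t\<close>, cut off
    to [\<delta>, 1]; the Gaussian factor does not depend on t.\<close>
  define k where "k t y = indicator {\<delta>..1} t *\<^sub>R ((\<i> * of_real (\<xi> \<bullet> y) - of_real (\<alpha> * t powr (\<alpha> - 1)) * eta \<xi>)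
      * gauss_wave s (t *\<^sub>R \<xi>) y * E t)" for t y
  have km: "(\<lambda>(t, y). k t y) \<in> borel_measurable (lborel \<Otimes>\<^sub>M \<mu>)"
    unfolding k_def gauss_wave_def E_def by measurable
  define c where "c = norm \<xi> * exp (1 / (2 * s\<^sup>2))"
  have inner_bound: "norm (\<i> * of_real (\<xi> \<bullet> y) * gauss_wave s \<zeta> y) \<le> c" for y \<zeta>
  proof -
    have "norm (\<i> * of_real (\<xi> \<bullet> y) * gauss_wave s \<zeta> y) \<le> (norm \<xi> * norm y) * gauss_factor s y"
      by (simp add: norm_mult norm_gauss_wave) (intro mult_right_mono Cauchy_Schwarz_ineq2 gauss_factor_bounds)
    also have "\<dots> \<le> c"
      unfolding mult.assoc c_def by (intro mult_left_mono norm_mult_gauss_factor_le s) simp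
    finally show ?thesis .
  qed
  have wave_bound: "norm (gauss_wave s \<zeta> y) \<le> 1" for \<zeta> y :: 'a
    by (simp add: norm_gauss_wave gauss_factor_bounds)
  have int_inner: "integrable \<mu> (\<lambda>y. \<i> * of_real (\<xi> \<bullet> y) * gauss_wave s \<zeta> y)" for \<zeta>
    by (rule \<mu>.integrable_const_bound[OF AE_I2[OF inner_bound]]) measurable
  have int_wave: "integrable \<mu> (gauss_wave s \<zeta>)" for \<zeta>
    by (rule \<mu>.integrable_const_bound[OF AE_I2[OF wave_bound]]) measurable
  \<comment> \<open>Integrable because \<delta> > 0 keeps t^(\<alpha>-1) continuous on the compact
    interval; the dependence of \<open>c\<close> on s is harmless at fixed s.\<close>
  define w where "w t = indicator {\<delta>..1} t *\<^sub>R ((c + norm (of_real (\<alpha> * t powr (\<alpha> - 1)) * eta \<xi>)) * exp (norm (eta \<xi>)))" for t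
  have w_int: "integrable lborel w"
    unfolding w_def using \<delta> by (intro borel_integrable_compact continuous_intros) auto
  have k_bound: "norm (k t y) \<le> w t" for t y
  proof (cases "t \<in> {\<delta>..1}")
    case True
    have "norm ((\<i> * of_real (\<xi> \<bullet> y) - of_real (\<alpha> * t powr (\<alpha> - 1)) * eta \<xi>) * gauss_wave s (t *\<^sub>R \<xi>) y)
        \<le> norm (\<i> * of_real (\<xi> \<bullet> y) * gauss_wave s (t *\<^sub>R \<xi>) y)
          + norm (of_real (\<alpha> * t powr (\<alpha> - 1)) * eta \<xi>) * norm (gauss_wave s (t *\<^sub>R \<xi>) y)"
      unfolding left_diff_distrib norm_mult[symmetric] by (rule norm_triangle_ineq4)
    also have "\<dots> \<le> c + norm (of_real (\<alpha> * t powr (\<alpha> - 1)) * eta \<xi>)"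
      by (intro add_mono inner_bound mult_left_le wave_bound norm_ge_zero)
    finally show ?thesis
      using True unfolding k_def w_def
      by (simp only: indicator_simps(1) scaleR_one norm_mult[of _ "E t"])
        (intro mult_mono E_bound add_nonneg_nonneg, auto simp: c_def)
  qed (simp add: k_def w_def)
  have "integrable (lborel \<Otimes>\<^sub>M \<mu>) (\<lambda>p. w (fst p) * 1)"
    by (intro integrable_pair_mult w_int) (auto intro: sigma_finite_lborel \<mu>.sigma_finite_measure_axioms)
  then have k_int: "integrable (lborel \<Otimes>\<^sub>M \<mu>) (\<lambda>(t, y). k t y)"
  proof (rule Bochner_Integration.integrable_bound[OF _ km], intro AE_I2, clarify)
    show "norm (k t y) \<le> norm (w (fst (t, y)) * 1)" for t y
      using k_bound[of t y] by (simp del: real_scaleR_def)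
  qed
  have path: "(CLINT t|lborel. k t y) = gauss_wave s \<xi> y * E 1 - gauss_wave s (\<delta> *\<^sub>R \<xi>) y * E \<delta>" for y
  proof -
    define F where "F t = of_real (gauss_factor s y) * exp (\<i> * of_real (t * (\<xi> \<bullet> y)) - of_real (t powr \<alpha>) * eta \<xi>)" for t
    have F: "gauss_wave s (t *\<^sub>R \<xi>) y * E t = F t" for t
      by (simp add: gauss_wave_def E_def F_def mult.assoc exp_diff exp_minus divide_inverse)
    have "(CLINT t|lborel. indicator {\<delta>..1} t *\<^sub>R
        ((\<i> * of_real (\<xi> \<bullet> y) - of_real (\<alpha> * t powr (\<alpha> - 1)) * eta \<xi>) * F t)) = F 1 - F \<delta>"
    proof (rule integral_FTC_Icc[OF \<delta>(2)])
      fix t :: real assume t: "\<delta> \<le> t" "t \<le> 1"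
      have "((\<lambda>t. t powr \<alpha>) has_real_derivative \<alpha> * t powr (\<alpha> - 1)) (at t within {\<delta>..1})"
        using t \<delta> by (auto intro!: derivative_eq_intros)
      then have powr: "((\<lambda>t. of_real (t powr \<alpha>) :: complex) has_vector_derivative of_real (\<alpha> * t powr (\<alpha> - 1))) (at t within {\<delta>..1})"
        by (simp only: has_real_derivative_iff_has_vector_derivative has_vector_derivative_of_real)
      have "((\<lambda>t. t * (\<xi> \<bullet> y)) has_real_derivative \<xi> \<bullet> y) (at t within {\<delta>..1})"
        by (auto intro!: derivative_eq_intros)
      then have "((\<lambda>t. of_real (t * (\<xi> \<bullet> y)) :: complex) has_vector_derivative of_real (\<xi> \<bullet> y)) (at t within {\<delta>..1})"
        by (simp only: has_real_derivative_iff_has_vector_derivative has_vector_derivative_of_real)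
      from has_vector_derivative_diff[OF has_vector_derivative_mult_right[OF this, of \<i>] has_vector_derivative_mult_left[OF powr, of "eta \<xi>"]]
      have "((\<lambda>t. \<i> * of_real (t * (\<xi> \<bullet> y)) - of_real (t powr \<alpha>) * eta \<xi>) has_vector_derivative
          \<i> * of_real (\<xi> \<bullet> y) - of_real (\<alpha> * t powr (\<alpha> - 1)) * eta \<xi>) (at t within {\<delta>..1})" .
      from has_vector_derivative_mult_right[OF field_vector_diff_chain_within[OF this has_field_derivative_at_within[OF DERIV_exp]], of "of_real (gauss_factor s y)"]
      show "(F has_vector_derivative (\<i> * of_real (\<xi> \<bullet> y) - of_real (\<alpha> * t powr (\<alpha> - 1)) * eta \<xi>) * F t) (at t within {\<delta>..1})"
        by (simp only: F_def[abs_def] comp_def mult.assoc mult.left_commute mult.commute)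
    next
      show "continuous_on {\<delta>..1} (\<lambda>t. (\<i> * of_real (\<xi> \<bullet> y) - of_real (\<alpha> * t powr (\<alpha> - 1)) * eta \<xi>) * F t)"
        unfolding F_def using \<delta> by (intro continuous_intros) auto
    qed
    then show ?thesis
      using F[of 1] F[of \<delta>] by (simp only: k_def mult.assoc F scaleR_one)
  qed
  have fiber: "(CLINT y|\<mu>. k t y) = indicator {\<delta>..1} t *\<^sub>R
      (E t * ((CLINT y|\<mu>. \<i> * of_real (\<xi> \<bullet> y) * gauss_wave s (t *\<^sub>R \<xi>) y)
        - of_real (\<alpha> * t powr (\<alpha> - 1)) * eta \<xi> * (CLINT y|\<mu>. gauss_wave s (t *\<^sub>R \<xi>) y)))" for t
  proof -
    let ?c = "of_real (\<alpha> * t powr (\<alpha> - 1)) * eta \<xi>"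
    have "(CLINT y|\<mu>. \<i> * of_real (\<xi> \<bullet> y) * gauss_wave s (t *\<^sub>R \<xi>) y - ?c * gauss_wave s (t *\<^sub>R \<xi>) y)
        = (CLINT y|\<mu>. \<i> * of_real (\<xi> \<bullet> y) * gauss_wave s (t *\<^sub>R \<xi>) y) - (CLINT y|\<mu>. ?c * gauss_wave s (t *\<^sub>R \<xi>) y)"
      by (intro Bochner_Integration.integral_diff int_inner integrable_mult_right int_wave)
    moreover have "k t y = indicator {\<delta>..1} t *\<^sub>R ((\<i> * of_real (\<xi> \<bullet> y) * gauss_wave s (t *\<^sub>R \<xi>) y
        - ?c * gauss_wave s (t *\<^sub>R \<xi>) y) * E t)" for y
      by (simp only: k_def left_diff_distrib[of _ _ "gauss_wave s (t *\<^sub>R \<xi>) y"])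
    ultimately show ?thesis
      by (simp only: integral_scaleR_right integral_mult_left_zero integral_mult_right_zero mult.commute[of "E t"])
  qed
  have "(CLINT y|\<mu>. gauss_wave s \<xi> y) * E 1 - (CLINT y|\<mu>. gauss_wave s (\<delta> *\<^sub>R \<xi>) y) * E \<delta>
      = (CLINT y|\<mu>. CLINT t|lborel. k t y)"
    unfolding path using int_wave
    by (subst Bochner_Integration.integral_diff) auto
  also have "\<dots> = (CLINT t|lborel. CLINT y|\<mu>. k t y)"
    by (rule L\<mu>.Fubini_integral[OF k_int])
  finally show ?thesis
    by (simp only: fiber)
qed

text \<open>The product of the characteristic function at t \<xi> and the integrating factor is
  constant on (0, 1] and tends to 1 as t \<rightarrow> 0. For damped waves, constancy fails by an
  integral of residuals, which vanishes in the limit by the Stein identity.\<close>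

lemma char_if_stein_identity:
  assumes \<mu>: "prob_space \<mu>" and sets_\<mu>: "sets \<mu> = sets borel"
    and stein: "\<And>f. f \<in> schwartz \<Longrightarrow>
      (\<integral>y. y \<bullet> gradient f y \<partial>\<mu>) = \<alpha> * (\<integral>y. (\<integral>u. f (y + u) - f y \<partial>\<nu>) \<partial>\<mu>)"
  shows "(CLINT y|\<mu>. iexp (\<xi> \<bullet> y)) = exp (eta \<xi>)"
proof -
  interpret \<mu>: prob_space \<mu> by fact
  note [measurable_cong] = sets_\<mu>
  define s where "s n = inverse (real (Suc n))" for n
  have s: "0 < s n" "0 \<le> s n" "s n \<le> 1" for n
    by (simp_all add: s_def inverse_le_1_iff)
  have s_lim: "s \<longlonglongrightarrow> 0"
    unfolding s_def by (rule LIMSEQ_inverse_real_of_nat)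
  define E where "E t = exp (- (of_real (t powr \<alpha>) * eta \<xi>))" for t
  define \<phi> where "\<phi> t = (CLINT y|\<mu>. iexp ((t *\<^sub>R \<xi>) \<bullet> y))" for t
  define W where "W n t = (CLINT y|\<mu>. gauss_wave (s n) (t *\<^sub>R \<xi>) y)" for n t
  define Q where "Q n t = (CLINT y|\<mu>. of_real ((s n * norm y)\<^sup>2) * gauss_wave (s n) (t *\<^sub>R \<xi>) y)" for n t
  define R where "R n t = (CLINT y|\<mu>. CLINT u|\<nu>. gauss_wave (s n) (t *\<^sub>R \<xi>) (y + u) - gauss_wave (s n) (t *\<^sub>R \<xi>) y)" for n t
  \<comment> \<open>The residual of the differential equation for the damped wave, times the
    integrating factor: the integrand of \<open>damped_ray_increment\<close>.\<close>
  define F where "F n t = E t * ((CLINT y|\<mu>. \<i> * of_real (\<xi> \<bullet> y) * gauss_wave (s n) (t *\<^sub>R \<xi>) y)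
        - of_real (\<alpha> * t powr (\<alpha> - 1)) * eta \<xi> * W n t)" for n t
  have Fm: "F n \<in> borel_measurable borel" for n
    unfolding F_def[abs_def] E_def W_def gauss_wave_def by measurable
  have W_lim: "(\<lambda>n. W n t) \<longlonglongrightarrow> \<phi> t" for t
    unfolding W_def \<phi>_def s_def by (rule gauss_wave_limits(1)[OF \<mu> sets_\<mu>])
  define K where "K = (3 + norm \<xi>) * (\<integral>u. min 1 (norm u) \<partial>\<nu>)"
  have I_nonneg: "0 \<le> (\<integral>u. min 1 (norm u) \<partial>\<nu>)"
    by (rule integral_nonneg_AE) simp
  have W_bound: "norm (W n t) \<le> 1" for n t
  proof -
    have "norm (W n t) \<le> (\<integral>y. 1 \<partial>\<mu>)"
      unfolding W_def
      by (rule Bochner_Integration.integral_norm_bound_integral)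
        (auto simp: norm_gauss_wave gauss_factor_bounds intro!: \<mu>.integrable_const_bound[where B = 1])
    then show ?thesis using \<mu>.prob_space by simp
  qed
  have Q_bound: "norm (Q n t) \<le> 2" for n t
  proof -
    have le: "norm (of_real ((s n * norm y)\<^sup>2) * gauss_wave (s n) (t *\<^sub>R \<xi>) y) \<le> 2" for y
      by (simp only: norm_mult norm_gauss_wave norm_of_real abs_power2 sq_mult_gauss_factor_le)
    have "norm (Q n t) \<le> (\<integral>y. 2 \<partial>\<mu>)"
      unfolding Q_def
      by (rule Bochner_Integration.integral_norm_bound_integral[OF \<mu>.integrable_const_bound[OF AE_I2[OF le]]]) (use le in auto)
    then show ?thesis using \<mu>.prob_space by simp
  qed
  have R_bound: "norm (R n t) \<le> K" if "t \<in> {0..1}" for n t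
  proof -
    have le: "norm (CLINT u|\<nu>. gauss_wave (s n) (t *\<^sub>R \<xi>) (y + u) - gauss_wave (s n) (t *\<^sub>R \<xi>) y) \<le> K" for y
    proof -
      have "norm (CLINT u|\<nu>. gauss_wave (s n) (t *\<^sub>R \<xi>) (y + u) - gauss_wave (s n) (t *\<^sub>R \<xi>) y)
          \<le> (3 + norm (t *\<^sub>R \<xi>)) * (\<integral>u. min 1 (norm u) \<partial>\<nu>)"
        by (rule integrable_increment(2)[OF borel_measurable_gauss_wave gauss_wave_diff_le[OF s(2,3)]])
      also have "\<dots> \<le> K"
        unfolding K_def using that mult_right_mono[of t 1 "norm \<xi>"]
        by (intro mult_right_mono I_nonneg) simp
      finally show ?thesis .
    qed
    have "norm (R n t) \<le> (\<integral>y. K \<partial>\<mu>)"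
      unfolding R_def
      by (rule Bochner_Integration.integral_norm_bound_integral[OF \<mu>.integrable_const_bound[OF AE_I2[OF le]]]) (use le in auto)
    then show ?thesis using \<mu>.prob_space by simp
  qed
  \<comment> \<open>The Stein identity at frequency t \<xi> carries an extra factor t, hence the
    division. It trades the term with \<xi> \<bullet> y for \<open>Q\<close> and \<open>R\<close>,
    whose bounds are uniform in n.\<close>
  have F_eq: "F n t = E t * (of_real (inverse t) * (Q n t + of_real \<alpha> * R n t) - of_real (\<alpha> * t powr (\<alpha> - 1)) * eta \<xi> * W n t)"
    if "t > 0" for n t
  proof -
    have "(CLINT y|\<mu>. \<i> * of_real ((t *\<^sub>R \<xi>) \<bullet> y) * gauss_wave (s n) (t *\<^sub>R \<xi>) y) = Q n t + of_real \<alpha> * R n t"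
      unfolding Q_def R_def by (rule stein_identity_gauss_wave[OF \<mu> sets_\<mu> stein s(1,3)])
    also have "(\<lambda>y. \<i> * of_real ((t *\<^sub>R \<xi>) \<bullet> y) * gauss_wave (s n) (t *\<^sub>R \<xi>) y)
        = (\<lambda>y. of_real t * (\<i> * of_real (\<xi> \<bullet> y) * gauss_wave (s n) (t *\<^sub>R \<xi>) y))"
      by (simp add: fun_eq_iff mult_ac)
    finally have "of_real t * (CLINT y|\<mu>. \<i> * of_real (\<xi> \<bullet> y) * gauss_wave (s n) (t *\<^sub>R \<xi>) y) = Q n t + of_real \<alpha> * R n t"
      by (simp only: integral_mult_right_zero)
    then have "of_real (inverse t) * (Q n t + of_real \<alpha> * R n t)
        = of_real (inverse t) * (of_real t * (CLINT y|\<mu>. \<i> * of_real (\<xi> \<bullet> y) * gauss_wave (s n) (t *\<^sub>R \<xi>) y))"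
      by (simp only:)
    moreover have "of_real (inverse t) * (of_real t * z) = z" for z :: complex
      using that by (simp add: mult.assoc[symmetric])
    ultimately show ?thesis by (simp only: F_def)
  qed
  have F_lim: "(\<lambda>n. F n t) \<longlonglongrightarrow> 0" if "t > 0" for t
  proof -
    have "(\<lambda>n. F n t) \<longlonglongrightarrow> E t * (of_real (inverse t) * (0 + of_real \<alpha> * (eta (t *\<^sub>R \<xi>) * \<phi> t)) - of_real (\<alpha> * t powr (\<alpha> - 1)) * eta \<xi> * \<phi> t)"
      unfolding F_eq[OF that]
    proof (intro tendsto_intros W_lim)
      show "(\<lambda>n. Q n t) \<longlonglongrightarrow> 0"
        unfolding Q_def s_def by (rule gauss_wave_limits(2)[OF \<mu> sets_\<mu>])
      show "(\<lambda>n. R n t) \<longlonglongrightarrow> eta (t *\<^sub>R \<xi>) * \<phi> t"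
        unfolding R_def s_def \<phi>_def by (rule gauss_wave_limits(3)[OF \<mu> sets_\<mu>])
    qed
    \<comment> \<open>By scaling, \<alpha> / t times t^\<alpha> is \<alpha> t^(\<alpha>-1), so the
      two parts of the limiting residual cancel.\<close>
    moreover have "of_real (inverse t) * (0 + of_real \<alpha> * (eta (t *\<^sub>R \<xi>) * \<phi> t)) = of_real (\<alpha> * t powr (\<alpha> - 1)) * eta \<xi> * \<phi> t"
      using that by (simp add: eta_scale powr_diff divide_inverse)
    ultimately show ?thesis by (simp only: diff_self mult_zero_right)
  qed
  have const: "\<phi> 1 * E 1 = \<phi> \<delta> * E \<delta>" if \<delta>: "0 < \<delta>" "\<delta> \<le> 1" for \<delta>
  proof -
    define w where "w t = indicator {\<delta>..1} t *\<^sub>R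
      (exp (norm (eta \<xi>)) * (inverse t * (2 + \<alpha> * K) + \<alpha> * t powr (\<alpha> - 1) * norm (eta \<xi>)))" for t
    have "(\<lambda>n. CLINT t|lborel. indicator {\<delta>..1} t *\<^sub>R F n t) \<longlonglongrightarrow> (CLINT t|(lborel :: real measure). 0)"
    proof (rule integral_dominated_convergence[where w = w])
      show "integrable lborel w"
        unfolding w_def using \<delta> by (intro borel_integrable_compact continuous_intros) auto
      show "AE t in lborel. (\<lambda>n. indicator {\<delta>..1} t *\<^sub>R F n t) \<longlonglongrightarrow> 0"
      proof (intro AE_I2)
        fix t
        show "(\<lambda>n. indicator {\<delta>..1} t *\<^sub>R F n t) \<longlonglongrightarrow> 0"
          using F_lim[of t] \<delta> by (cases "t \<in> {\<delta>..1}") auto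
      qed
      show "AE t in lborel. norm (indicator {\<delta>..1} t *\<^sub>R F n t) \<le> w t" for n
      proof (intro AE_I2)
        fix t
        show "norm (indicator {\<delta>..1} t *\<^sub>R F n t) \<le> w t"
        proof (cases "t \<in> {\<delta>..1}")
          case True
          then have t: "t > 0" "t \<in> {0..1}" using \<delta> by auto
          have "norm (of_real (t powr \<alpha>) * eta \<xi>) \<le> 1 * norm (eta \<xi>)"
            using t \<alpha> by (subst norm_mult, intro mult_right_mono) (auto intro: powr_le1)
          then have E: "norm (E t) \<le> exp (norm (eta \<xi>))"
            unfolding E_def by (intro order_trans[OF norm_exp]) simp
          have "norm (of_real (inverse t) * (Q n t + of_real \<alpha> * R n t) - of_real (\<alpha> * t powr (\<alpha> - 1)) * eta \<xi> * W n t)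
              \<le> inverse t * norm (Q n t + of_real \<alpha> * R n t) + \<alpha> * t powr (\<alpha> - 1) * norm (eta \<xi>) * norm (W n t)"
            using t \<alpha> by (intro order_trans[OF norm_triangle_ineq4]) (simp add: norm_mult norm_inverse abs_mult)
          also have "\<dots> \<le> inverse t * (2 + \<alpha> * K) + \<alpha> * t powr (\<alpha> - 1) * norm (eta \<xi>) * 1"
          proof (intro add_mono mult_left_mono W_bound)
            have "norm (of_real \<alpha> * R n t) \<le> \<alpha> * K"
              using \<alpha> R_bound[OF t(2), of n] by (simp add: norm_mult)
            then show "norm (Q n t + of_real \<alpha> * R n t) \<le> 2 + \<alpha> * K"
              by (intro order_trans[OF norm_triangle_ineq] add_mono Q_bound)
          qed (use t \<alpha> in auto)
          finally have "norm (E t) * norm (of_real (inverse t) * (Q n t + of_real \<alpha> * R n t) - of_real (\<alpha> * t powr (\<alpha> - 1)) * eta \<xi> * W n t)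
              \<le> exp (norm (eta \<xi>)) * (inverse t * (2 + \<alpha> * K) + \<alpha> * t powr (\<alpha> - 1) * norm (eta \<xi>))"
            by (intro mult_mono E) auto
          then show ?thesis
            using True by (simp only: F_eq[OF t(1)] w_def indicator_simps(1) scaleR_one norm_mult)
        qed (simp add: w_def)
      qed
    qed (use Fm in \<open>simp_all add: measurable_lborel1\<close>)
    then have "(\<lambda>n. W n 1 * E 1 - W n \<delta> * E \<delta>) \<longlonglongrightarrow> 0"
      using damped_ray_increment[OF \<mu> sets_\<mu> s(1) \<delta>, of _ \<xi>]
      by (simp only: W_def F_def E_def scaleR_one Bochner_Integration.integral_zero)
    moreover have "(\<lambda>n. W n 1 * E 1 - W n \<delta> * E \<delta>) \<longlonglongrightarrow> \<phi> 1 * E 1 - \<phi> \<delta> * E \<delta>"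
      by (intro tendsto_intros W_lim)
    ultimately have "\<phi> 1 * E 1 - \<phi> \<delta> * E \<delta> = 0"
      by (rule LIMSEQ_unique[rotated])
    then show ?thesis by simp
  qed
  \<comment> \<open>The sequence \<open>s\<close> is reused as points of the ray tending to 0, in
    order to identify the constant as 1.\<close>
  have "(\<lambda>m. \<phi> (s m)) \<longlonglongrightarrow> (CLINT y|\<mu>. 1)"
    unfolding \<phi>_def
  proof (rule integral_dominated_convergence[where w = "\<lambda>_. 1"])
    show "AE y in \<mu>. (\<lambda>m. iexp ((s m *\<^sub>R \<xi>) \<bullet> y)) \<longlonglongrightarrow> 1"
    proof (intro AE_I2)
      fix y
      have "(\<lambda>m. iexp ((s m *\<^sub>R \<xi>) \<bullet> y)) \<longlonglongrightarrow> iexp ((0 *\<^sub>R \<xi>) \<bullet> y)"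
        by (intro tendsto_intros s_lim)
      then show "(\<lambda>m. iexp ((s m *\<^sub>R \<xi>) \<bullet> y)) \<longlonglongrightarrow> 1" by simp
    qed
  qed simp_all
  moreover have "(\<lambda>m. E (s m)) \<longlonglongrightarrow> exp (- (of_real 0 * eta \<xi>))"
    unfolding E_def
    by (intro tendsto_intros tendsto_zero_powrI[OF s_lim tendsto_const]) (use s \<alpha> in auto)
  ultimately have "(\<lambda>m. \<phi> (s m) * E (s m)) \<longlonglongrightarrow> 1 * 1"
    using \<mu>.prob_space by (intro tendsto_mult) simp_all
  then have "(\<lambda>m. \<phi> 1 * E 1) \<longlonglongrightarrow> 1"
    using const[OF s(1,3)] by simp
  then have "\<phi> 1 * E 1 = 1"
    by (simp add: LIMSEQ_const_iff)
  then show ?thesis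
    by (simp add: \<phi>_def E_def exp_minus field_simps)
qed

end

section \<open>Stable vectors\<close>

context stable_levy
begin

text \<open>For \<alpha> < 1 the compensator is \<nu>-integrable by itself and can be moved into the
  drift.\<close>

lemma levy_exponent_eq:
  "levy_exponent b \<nu> \<xi> = \<i> * of_real ((b - (LINT u:{u. norm u \<le> 1}|\<nu>. u)) \<bullet> \<xi>) + eta \<xi>"
proof -
  let ?I = "\<lambda>u::'a. indicator {u. norm u \<le> 1} u *\<^sub>R u"
  have I: "integrable \<nu> ?I"
    by (rule Bochner_Integration.integrable_bound[OF integrable_min_norm])
      (auto intro!: AE_I2 simp: indicator_def)
  have e: "integrable \<nu> (\<lambda>u. iexp (\<xi> \<bullet> u) - 1)"
    using integrable_increment(1)[of "\<lambda>u. iexp (\<xi> \<bullet> u)" "2 + norm \<xi>" 0, OF _ norm_iexp_inner_diff_le] by simp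
  have l: "integrable \<nu> (\<lambda>u. \<i> * of_real ((\<xi> \<bullet> u) * indicator {u. norm u \<le> 1} u))"
    using integrable_inner_right[OF I, of \<xi>]
    by (intro integrable_mult_right integrable_of_real) (simp add: mult.commute)
  have "(CLINT u|\<nu>. iexp (\<xi> \<bullet> u) - 1 - \<i> * of_real ((\<xi> \<bullet> u) * indicator {u. norm u \<le> 1} u))
      = eta \<xi> - (CLINT u|\<nu>. \<i> * of_real ((\<xi> \<bullet> u) * indicator {u. norm u \<le> 1} u))"
    unfolding eta_def by (rule Bochner_Integration.integral_diff[OF e l])
  also have "(CLINT u|\<nu>. \<i> * of_real ((\<xi> \<bullet> u) * indicator {u. norm u \<le> 1} u))
      = \<i> * of_real (\<integral>u. \<xi> \<bullet> ?I u \<partial>\<nu>)"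
    by (simp only: integral_mult_right_zero integral_complex_of_real inner_scaleR_right mult.commute)
  also have "(\<integral>u. \<xi> \<bullet> ?I u \<partial>\<nu>) = \<xi> \<bullet> (LINT u:{u. norm u \<le> 1}|\<nu>. u)"
    unfolding set_lebesgue_integral_def using I by (intro integral_inner_right) auto
  finally show ?thesis
    by (simp add: levy_exponent_def inner_diff_left inner_commute algebra_simps)
qed

text \<open>Self-similarity gives explicit n-th roots: with c^\<alpha> = 1 / n, scaling turns
  \<eta>(c \<xi>) into \<eta>(\<xi>) / n, so n independent copies of c (X - a) + a / n sum to a
  vector with the characteristic function of X. Uniqueness then identifies the laws.\<close>

lemma infinitely_divisible_if_char:
  assumes M: "prob_space M" and X: "X \<in> borel_measurable M"
    and char: "\<And>\<xi>. (CLINT \<omega>|M. iexp (\<xi> \<bullet> (X \<omega> - a))) = exp (eta \<xi>)"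
  shows "infinitely_divisible M X"
  unfolding infinitely_divisible_def
proof (intro allI impI)
  interpret M: prob_space M by fact
  note X[measurable]
  fix n :: nat assume n: "n \<ge> 1"
  define c where "c = real n powr (- 1 / \<alpha>)"
  have "c powr \<alpha> = real n powr (- 1 / \<alpha> * \<alpha>)"
    unfolding c_def by (rule powr_powr)
  then have c: "c > 0" "c powr \<alpha> = 1 / real n"
    using n \<alpha> by (simp_all add: c_def powr_minus_divide)
  define \<rho> where "\<rho> = distr M borel (\<lambda>\<omega>. c *\<^sub>R (X \<omega> - a) + a /\<^sub>R real n)"
  have sets_\<rho> [measurable_cong]: "sets \<rho> = sets borel"
    by (simp add: \<rho>_def)
  have \<rho>: "prob_space \<rho>"
    unfolding \<rho>_def by (rule M.prob_space_distr) measurable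
  interpret \<rho>: prob_space \<rho> by fact
  interpret P: product_sigma_finite "\<lambda>_::nat. \<rho>" ..
  interpret PP: product_prob_space "\<lambda>_::nat. \<rho>" "{..<n}" ..
  have X_char: "(CLINT \<omega>|M. iexp (\<xi> \<bullet> X \<omega>)) = iexp (\<xi> \<bullet> a) * exp (eta \<xi>)" for \<xi>
  proof -
    have "iexp (\<xi> \<bullet> X \<omega>) = iexp (\<xi> \<bullet> a) * iexp (\<xi> \<bullet> (X \<omega> - a))" for \<omega>
      by (simp add: inner_diff_right algebra_simps flip: exp_add)
    then show ?thesis
      by (simp only: integral_mult_right_zero char)
  qed
  have \<rho>_char: "(CLINT x|\<rho>. iexp (\<xi> \<bullet> x)) = exp ((\<i> * of_real (\<xi> \<bullet> a) + eta \<xi>) / of_nat n)" for \<xi>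
  proof -
    have "(CLINT x|\<rho>. iexp (\<xi> \<bullet> x)) = (CLINT \<omega>|M. iexp (\<xi> \<bullet> (c *\<^sub>R (X \<omega> - a) + a /\<^sub>R real n)))"
      unfolding \<rho>_def by (rule integral_distr) measurable
    also have "\<dots> = (CLINT \<omega>|M. exp (\<i> * of_real (\<xi> \<bullet> a) / of_nat n) * iexp ((c *\<^sub>R \<xi>) \<bullet> (X \<omega> - a)))"
      unfolding exp_add[symmetric]
      by (simp add: inner_add_right divide_inverse algebra_simps)
    also have "\<dots> = exp (\<i> * of_real (\<xi> \<bullet> a) / of_nat n) * exp (eta (c *\<^sub>R \<xi>))"
      by (simp only: integral_mult_right_zero char)
    also have "\<dots> = exp ((\<i> * of_real (\<xi> \<bullet> a) + eta \<xi>) / of_nat n)"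
      using c by (simp add: eta_scale add_divide_distrib exp_add)
    finally show ?thesis .
  qed
  have sum_meas [measurable]: "(\<lambda>Y. \<Sum>i<n. Y i) \<in> borel_measurable (\<Pi>\<^sub>M i\<in>{..<n}. \<rho>)"
    by measurable
  have "distr M borel X = distr (\<Pi>\<^sub>M i\<in>{..<n}. \<rho>) borel (\<lambda>Y. \<Sum>i<n. Y i)"
  proof (rule measure_eq_if_iexp_eq)
    show "prob_space (distr M borel X)"
      by (rule M.prob_space_distr) measurable
    show "prob_space (distr (\<Pi>\<^sub>M i\<in>{..<n}. \<rho>) borel (\<lambda>Y. \<Sum>i<n. Y i))"
      by (rule PP.prob_space_distr) measurable
    fix \<xi> :: 'a
    have int: "integrable \<rho> (\<lambda>x. iexp (\<xi> \<bullet> x))"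
      by (rule \<rho>.integrable_const_bound[where B = 1]) simp_all
    have "(CLINT x|distr (\<Pi>\<^sub>M i\<in>{..<n}. \<rho>) borel (\<lambda>Y. \<Sum>i<n. Y i). iexp (\<xi> \<bullet> x))
        = (CLINT Y|\<Pi>\<^sub>M i\<in>{..<n}. \<rho>. iexp (\<xi> \<bullet> (\<Sum>i<n. Y i)))"
      by (rule integral_distr) measurable
    also have "\<dots> = (CLINT Y|\<Pi>\<^sub>M i\<in>{..<n}. \<rho>. \<Prod>i<n. iexp (\<xi> \<bullet> Y i))"
      by (simp add: inner_sum_right sum_distrib_left exp_sum)
    also have "\<dots> = (\<Prod>i<n. CLINT x|\<rho>. iexp (\<xi> \<bullet> x))"
      by (rule P.product_integral_prod) (use int in auto)
    also have "\<dots> = exp (\<i> * of_real (\<xi> \<bullet> a) + eta \<xi>)"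
      using n by (simp add: \<rho>_char flip: exp_of_nat_mult)
    also have "\<dots> = (CLINT x|distr M borel X. iexp (\<xi> \<bullet> x))"
      by (subst integral_distr) (simp_all add: X_char exp_add)
    finally show "(CLINT x|distr M borel X. iexp (\<xi> \<bullet> x))
        = (CLINT x|distr (\<Pi>\<^sub>M i\<in>{..<n}. \<rho>) borel (\<lambda>Y. \<Sum>i<n. Y i). iexp (\<xi> \<bullet> x))" ..
  qed simp_all
  then show "\<exists>\<rho> :: 'a measure. prob_space \<rho> \<and> sets \<rho> = sets borel \<and>
      distr M borel X = distr (\<Pi>\<^sub>M i\<in>{..<n}. \<rho>) borel (\<lambda>Y. \<Sum>i<n. Y i)"
    using \<rho> sets_\<rho> by blast
qed

text \<open>Centring at \<open>a\<close> cancels the drift factor. The other conjuncts of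
  \<open>stable_vector\<close> follow from scaling: infinite divisibility once the characteristic
  function is known, the spherical measure from \<nu> alone.\<close>

lemma stable_vector_iff_char:
  fixes b :: 'a
  assumes M: "prob_space M" and X: "X \<in> borel_measurable M"
  defines "a \<equiv> b - (LINT u:{u. norm u \<le> 1}|\<nu>. u)"
  shows "stable_vector M X b \<alpha> \<nu> \<longleftrightarrow> (\<forall>\<xi>. (CLINT y|distr M borel (\<lambda>\<omega>. X \<omega> - a). iexp (\<xi> \<bullet> y)) = exp (eta \<xi>))"
proof -
  note X[measurable]
  have distr: "(CLINT y|distr M borel (\<lambda>\<omega>. X \<omega> - a). iexp (\<xi> \<bullet> y)) = (CLINT \<omega>|M. iexp (\<xi> \<bullet> (X \<omega> - a)))" for \<xi>
    by (rule integral_distr) measurable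
  have "char_fun M X \<xi> = iexp (\<xi> \<bullet> a) * (CLINT \<omega>|M. iexp (\<xi> \<bullet> (X \<omega> - a)))" for \<xi>
  proof -
    have "iexp (\<xi> \<bullet> X \<omega>) = iexp (\<xi> \<bullet> a) * iexp (\<xi> \<bullet> (X \<omega> - a))" for \<omega>
      by (simp add: inner_diff_right algebra_simps flip: exp_add)
    then show ?thesis
      by (simp only: char_fun_def integral_mult_right_zero)
  qed
  then have "char_fun M X \<xi> = exp (levy_exponent b \<nu> \<xi>) \<longleftrightarrow> (CLINT \<omega>|M. iexp (\<xi> \<bullet> (X \<omega> - a))) = exp (eta \<xi>)" for \<xi>
    by (simp add: levy_exponent_eq exp_add inner_commute flip: a_def)
  then show ?thesis
    using infinitely_divisible_if_char[OF M X, of a] nu_eq_polar_stable_measure levy \<alpha>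
    by (auto simp: stable_vector_def distr)
qed

text \<open>Centring X shifts the test function by \<open>a\<close> and subtracts the drift term.
  Splitting the expectation is legitimate because both integrands are bounded for Schwartz
  f.\<close>

lemma stein_identity_translate:
  assumes M: "prob_space M" and X: "X \<in> borel_measurable M" and f: "f \<in> schwartz"
  shows "(\<integral>\<omega>. X \<omega> \<bullet> gradient f (X \<omega>) \<partial>M) =
        (\<integral>\<omega>. a \<bullet> gradient f (X \<omega>) \<partial>M) + \<alpha> * (\<integral>\<omega>. (\<integral>u. f (X \<omega> + u) - f (X \<omega>) \<partial>\<nu>) \<partial>M)
    \<longleftrightarrow> (\<integral>y. y \<bullet> gradient (\<lambda>y. f (y + a)) y \<partial>distr M borel (\<lambda>\<omega>. X \<omega> - a)) =
        \<alpha> * (\<integral>y. (\<integral>u. f (y + u + a) - f (y + a) \<partial>\<nu>) \<partial>distr M borel (\<lambda>\<omega>. X \<omega> - a))"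
proof -
  interpret M: prob_space M by fact
  note X[measurable]
  obtain B where B: "B > 0" "\<And>x. (1 + norm x) * norm (gradient f x) \<le> B"
    using schwartz_gradient_bounded[OF f] by blast
  have [measurable]: "f \<in> borel_measurable borel" "gradient f \<in> borel_measurable borel"
    using schwartz_continuous_on[OF f] schwartz_gradient_continuous_on[OF f]
    by (auto intro: borel_measurable_continuous_onI)
  have int: "integrable M (\<lambda>\<omega>. X \<omega> \<bullet> gradient f (X \<omega>))"
  proof (rule M.integrable_const_bound)
    show "AE \<omega> in M. norm (X \<omega> \<bullet> gradient f (X \<omega>)) \<le> B"
    proof (intro AE_I2)
      fix \<omega>
      have "norm (X \<omega> \<bullet> gradient f (X \<omega>)) \<le> norm (X \<omega>) * norm (gradient f (X \<omega>))"
        by (simp add: Cauchy_Schwarz_ineq2)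
      also have "\<dots> \<le> (1 + norm (X \<omega>)) * norm (gradient f (X \<omega>))"
        by (intro mult_right_mono) auto
      also have "\<dots> \<le> B"
        by (rule B)
      finally show "norm (X \<omega> \<bullet> gradient f (X \<omega>)) \<le> B" .
    qed
  qed measurable
  have int_a: "integrable M (\<lambda>\<omega>. a \<bullet> gradient f (X \<omega>))"
  proof (rule M.integrable_const_bound)
    show "AE \<omega> in M. norm (a \<bullet> gradient f (X \<omega>)) \<le> norm a * B"
    proof (intro AE_I2)
      fix \<omega>
      have "1 * norm (gradient f (X \<omega>)) \<le> (1 + norm (X \<omega>)) * norm (gradient f (X \<omega>))"
        by (intro mult_right_mono) auto
      then have "norm a * norm (gradient f (X \<omega>)) \<le> norm a * B"
        using B(2)[of "X \<omega>"] by (intro mult_left_mono) auto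
      then show "norm (a \<bullet> gradient f (X \<omega>)) \<le> norm a * B"
        using Cauchy_Schwarz_ineq2[of a "gradient f (X \<omega>)"] by simp
    qed
  qed measurable
  have "(\<integral>y. y \<bullet> gradient (\<lambda>y. f (y + a)) y \<partial>distr M borel (\<lambda>\<omega>. X \<omega> - a))
      = (\<integral>\<omega>. X \<omega> \<bullet> gradient f (X \<omega>) - a \<bullet> gradient f (X \<omega>) \<partial>M)"
    unfolding gradient_translate by (subst integral_distr) (simp_all add: inner_diff_left)
  also have "\<dots> = (\<integral>\<omega>. X \<omega> \<bullet> gradient f (X \<omega>) \<partial>M) - (\<integral>\<omega>. a \<bullet> gradient f (X \<omega>) \<partial>M)"
    by (rule Bochner_Integration.integral_diff[OF int int_a])
  finally have 1: "(\<integral>y. y \<bullet> gradient (\<lambda>y. f (y + a)) y \<partial>distr M borel (\<lambda>\<omega>. X \<omega> - a)) = \<dots>" .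
  have 2: "(\<integral>y. (\<integral>u. f (y + u + a) - f (y + a) \<partial>\<nu>) \<partial>distr M borel (\<lambda>\<omega>. X \<omega> - a))
      = (\<integral>\<omega>. (\<integral>u. f (X \<omega> + u) - f (X \<omega>) \<partial>\<nu>) \<partial>M)"
    by (subst integral_distr) (simp_all add: algebra_simps)
  show ?thesis
    unfolding 1 2 by linarith
qed

end

theorem theorem3p1:
  fixes M :: "'b measure" and X :: "'b \<Rightarrow> 'a::euclidean_space"
    and b b\<^sub>0 :: 'a and \<alpha> :: real and \<nu> :: "'a measure"
  assumes "prob_space M" and "X \<in> borel_measurable M"
    and "0 < \<alpha>" and "\<alpha> < 1"
    and "levy_measure \<nu>"
    and "\<And>c. 0 < c \<Longrightarrow> \<nu> = scale_measure (ennreal (c powr (- \<alpha>))) (dilation c \<nu>)"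
    and "b\<^sub>0 = b - (LINT u:{u. norm u \<le> 1}|\<nu>. u)"
  shows "(\<forall>f\<in>schwartz.
            (LINT \<omega>|M. X \<omega> \<bullet> gradient f (X \<omega>)) =
            (LINT \<omega>|M. b\<^sub>0 \<bullet> gradient f (X \<omega>)) +
            \<alpha> * (LINT \<omega>|M. (LINT u|\<nu>. f (X \<omega> + u) - f (X \<omega>))))
         \<longleftrightarrow> stable_vector M X b \<alpha> \<nu>"
    (is "?stein \<longleftrightarrow> _")
proof -
  note X [measurable] = assms(2)
  interpret M: prob_space M by fact
  interpret stable_levy \<nu> \<alpha>
    by standard (rule assms)+
  define \<mu> where "\<mu> = distr M borel (\<lambda>\<omega>. X \<omega> - b\<^sub>0)"
  have \<mu>: "prob_space \<mu>"
    unfolding \<mu>_def by (rule M.prob_space_distr) measurable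
  have sets_\<mu>: "sets \<mu> = sets borel"
    by (simp add: \<mu>_def)
  let ?Q = "\<lambda>g. (\<integral>y. y \<bullet> gradient g y \<partial>\<mu>) = \<alpha> * (\<integral>y. (\<integral>u. g (y + u) - g y \<partial>\<nu>) \<partial>\<mu>)"
  have "?stein \<longleftrightarrow> (\<forall>f\<in>schwartz. ?Q (\<lambda>y. f (y + b\<^sub>0)))"
    using stein_identity_translate[OF assms(1,2), of _ b\<^sub>0] by (simp add: \<mu>_def)
  \<comment> \<open>Translation by \<open>b\<^sub>0\<close> permutes the Schwartz space, with
    translation by \<open>- b\<^sub>0\<close> as inverse, so the shifted test functions exhaust
    it.\<close>
  also have "\<dots> \<longleftrightarrow> (\<forall>g\<in>schwartz. ?Q g)"
  proof (intro iffI ballI)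
    fix g :: "'a \<Rightarrow> real" assume Q: "\<forall>f\<in>schwartz. ?Q (\<lambda>y. f (y + b\<^sub>0))" and g: "g \<in> schwartz"
    have "(\<lambda>y. g (y + - b\<^sub>0)) \<in> schwartz"
      by (rule schwartz_translate[OF g])
    from bspec[OF Q this] show "?Q g" by simp
  qed (use schwartz_translate in blast)
  also have "\<dots> \<longleftrightarrow> (\<forall>\<xi>. (CLINT y|\<mu>. iexp (\<xi> \<bullet> y)) = exp (eta \<xi>))"
    using stein_identity_if_char[OF \<mu> sets_\<mu>] char_if_stein_identity[OF \<mu> sets_\<mu>] by blast
  also have "\<dots> \<longleftrightarrow> stable_vector M X b \<alpha> \<nu>"
    using stable_vector_iff_char[OF assms(1,2), of b] by (simp add: \<mu>_def assms(7))
  finally show ?thesis .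
qed

end
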